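(* Let $(\Omega,\mathcal F,\mathbb P)$ be a complete probability space with an increasing sequence of sub-$\sigma$-algebras $(\mathcal F_n)_{n\ge0}$ such that $\mathcal F=\sigma(\bigcup_n\mathcal F_n)$ and every $\mathcal F_n$ is generated by countably many atoms. Let $p(\cdot):\Omega\to(0,\infty)$ be measurable with $0<p_-\le p_+<\infty$, assume there is a constant $K_{p(\cdot)}\ge1$ depending only on $p(\cdot)$ such that $\mathbb P(A)^{p_-(A)-p_+(A)}\le K_{p(\cdot)}$ for every atom $A$ of every $\mathcal F_n$, and let $0<q\le\infty$. If $(\mathcal F_n)_{n\ge0}$ is regular, then $$H^S_{p(\cdot),q}=H_{p(\cdot),q}^{\mathrm{at},2,\infty},\qquad H^M_{p(\cdot),q}=H_{p(\cdot),q}^{\mathrm{at},3,\infty}$$ with equivalent quasi-norms.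
   Context: For measurable $A\subset\Omega$, $p_-(A)=\operatorname{ess\,inf}_{x\in A}p(x)$, $p_+(A)=\operatorname{ess\,sup}_{x\in A}p(x)$; $p_\pm=p_\pm(\Omega)$; $\|f\|_{p(\cdot)}=\inf\{\lambda>0:\int_\Omega(|f(x)|/\lambda)^{p(x)}d\mathbb P\le1\}$. Variable Lorentz quasi-norm: $\|f\|_{L_{p(\cdot),q}}=\left(\int_0^\infty\lambda^q\|\chi_{\{|f|>\lambda\}}\|_{p(\cdot)}^q\frac{d\lambda}{\lambda}\right)^{1/q}$ for $q<\infty$, $\|f\|_{L_{p(\cdot),\infty}}=\sup_{\lambda>0}\lambda\|\chi_{\{|f|>\lambda\}}\|_{p(\cdot)}$. $B\in\mathcal F_n$ is an atom of $\mathcal F_n$ if every $A\subset B$ with $A\in\mathcal F_n$ and $\mathbb P(A)<\mathbb P(B)$ satisfies $\mathbb P(A)=0$. $(\mathcal F_n)_{n\ge0}$ is regular if there is a constant $R>0$, independent of $n$, such that for all $n\ge1$ and $A\in\mathcal F_n$ there is $B\in\mathcal F_{n-1}$ with $A\subset B$ and $\mathbb P(B)\le R\,\mathbb P(A)$. $\mathbb E_n=\mathbb E(\cdot|\mathcal F_n)$. A martingale is a sequence $f=(f_n)_{n\ge0}\subset L_1(\Omega)$ with $\mathbb E_n(f_{n+1})=f_n$ for every $n\ge0$; $f_{-1}:=0$ and $d_nf=f_n-f_{n-1}$, $n\ge0$. $M(f)=\sup_{n\ge0}|f_n|$, $S(f)=(\sum_{k=0}^\infty|d_kf|^2)^{1/2}$;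 for a function $a$ these are applied to the martingale $a_n=\mathbb E_na$. $H^S_{p(\cdot),q}$ (resp. $H^M_{p(\cdot),q}$) is the space of martingales with $\|f\|_{H^S_{p(\cdot),q}}=\|S(f)\|_{L_{p(\cdot),q}}<\infty$ (resp. $\|f\|_{H^M_{p(\cdot),q}}=\|M(f)\|_{L_{p(\cdot),q}}<\infty$). A $(2,p(\cdot),\infty)$-atom (resp. $(3,p(\cdot),\infty)$-atom) is a measurable function $a$ for which there is a stopping time $\tau$ with respect to $(\mathcal F_n)$ (possibly taking the value $\infty$) such that $\mathbb E(a|\mathcal F_n)=0$ for all $n\le\tau$, i.e. on $\{n\le\tau\}$, and $\|S(a)\|_\infty$ (resp. $\|M(a)\|_\infty$) is at most $1/\|\chi_{\{\tau<\infty\}}\|_{p(\cdot)}$. For $d\in\{2,3\}$, $H_{p(\cdot),q}^{\mathrm{at},d,\infty}$ is the space of all martingales $f=(f_n)_{n\ge0}$ such that, for all $n\in\mathbb N=\{0,1,2,\dots\}$, $f_n=\sum_{k\in\mathbb Z}\mu_ka^k_n$ a.e., where $(a^k)_{k\in\mathbb Z}$ is a sequence of $(d,p(\cdot),\infty)$-atoms associated with stopping times $(\tau_k)_{k\in\mathbb Z}$, $a^k_n=\mathbb E_na^k$, and $\mu_k=3\cdot2^k\|\chi_{\{\tau_k<\infty\}}\|_{p(\cdot)}$ for each $k$; for such $f$, $$\|f\|_{H_{p(\cdot),q}^{\mathrm{at},d,\infty}}=\inf\left(\sum_{k\in\mathbb Z}2^{kq}\|\chi_{\{\tau_k<\infty\}}\|_{p(\cdot)}^q\right)^{1/q}\approx\inf\|(\mu_k)_{k\in\mathbb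 Z}\|_{\ell_q}$$ (with the supremum over $k$ of $2^k\|\chi_{\{\tau_k<\infty\}}\|_{p(\cdot)}$ if $q=\infty$), the infimum being taken over all such decompositions of $f$.
   Formalization: The Hardy spaces are restricted to martingales with f_0 = 0 a.e. (atoms force f_0 = 0, while the constant martingale 1 lies in both Hardy spaces), and the atomic spaces consist of the martingales whose atomic quasi-norm is finite. *)

theory Defs
  imports "HOL-Probability.Probability"
begin

section \<open>Variable Lebesgue and Lorentz quasi-norms\<close>

text \<open>Real powers on \<open>[0, \<infinity>]\<close>, only used with exponent \<open>r > 0\<close>.\<close>

definition ennreal_powr :: "ennreal \<Rightarrow> real \<Rightarrow> ennreal" where
  "ennreal_powr a r = (if a = \<infinity> then \<infinity> else ennreal (enn2real a powr r))"

definition exponent_sup :: "'a measure \<Rightarrow> ('a \<Rightarrow> real) \<Rightarrow> 'a set \<Rightarrow> ereal" where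
  "exponent_sup M p A = esssup (restrict_space M A) (\<lambda>x. ereal (p x))"

definition exponent_inf :: "'a measure \<Rightarrow> ('a \<Rightarrow> real) \<Rightarrow> 'a set \<Rightarrow> ereal" where
  "exponent_inf M p A = - esssup (restrict_space M A) (\<lambda>x. - ereal (p x))"

definition var_norm :: "'a measure \<Rightarrow> ('a \<Rightarrow> real) \<Rightarrow> ('a \<Rightarrow> real) \<Rightarrow> ennreal" where
  "var_norm M p f =
     (INF c \<in> {c::real. 0 < c \<and> (\<integral>\<^sup>+ x. ennreal ((\<bar>f x\<bar> / c) powr p x) \<partial>M) \<le> 1}. ennreal c)"

abbreviation set_var_norm :: "'a measure \<Rightarrow> ('a \<Rightarrow> real) \<Rightarrow> 'a set \<Rightarrow> ennreal" where
  "set_var_norm M p A \<equiv> var_norm M p (indicator A)"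

text \<open>The argument is \<open>[0, \<infinity>]\<close>-valued, since the functionals are applied to square and
  maximal functions, which may be infinite.\<close>

definition lorentz_norm ::
  "'a measure \<Rightarrow> ('a \<Rightarrow> real) \<Rightarrow> ennreal \<Rightarrow> ('a \<Rightarrow> ennreal) \<Rightarrow> ennreal" where
  "lorentz_norm M p q g =
     (if q = \<infinity>
      then SUP t \<in> {0<..}. ennreal t * set_var_norm M p {x \<in> space M. ennreal t < g x}
      else ennreal_powr
        (\<integral>\<^sup>+ t. ennreal (t powr enn2real q)
               * ennreal_powr (set_var_norm M p {x \<in> space M. ennreal t < g x}) (enn2real q)
               / ennreal t * indicator {0<..} t \<partial>lborel)
        (1 / enn2real q))"

section \<open>Filtrations\<close>

definition sigma_atom :: "'a measure \<Rightarrow> 'a measure \<Rightarrow> 'a set \<Rightarrow> bool" where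
  "sigma_atom M G B \<longleftrightarrow> B \<in> sets G \<and>
     (\<forall>A \<in> sets G. A \<subseteq> B \<longrightarrow> measure M A < measure M B \<longrightarrow> measure M A = 0)"

text \<open>The \<open>\<sigma>\<close>-algebra of \<open>G\<close> is generated by \<open>\<C>\<close> up to null sets: it lies between \<open>\<sigma>(\<C>)\<close> and the
  completion of \<open>\<sigma>(\<C>)\<close>. This includes the case where it is exactly \<open>\<sigma>(\<C>)\<close>, and is the customary
  meaning of generation in a complete probability space: for instance, the Lebesgue \<open>\<sigma>\<close>-algebra
  of the unit interval is generated by the dyadic intervals in this sense only.\<close>

definition generated_by :: "'a measure \<Rightarrow> 'a measure \<Rightarrow> 'a set set \<Rightarrow> bool" where
  "generated_by M G \<C> \<longleftrightarrow> sigma_sets (space M) \<C> \<subseteq> sets G \<and>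
     (\<forall>A \<in> sets G. \<exists>B \<in> sigma_sets (space M) \<C>. (A - B) \<union> (B - A) \<in> null_sets M)"

definition atomic_filtration :: "'a measure \<Rightarrow> (nat \<Rightarrow> 'a measure) \<Rightarrow> bool" where
  "atomic_filtration M F \<longleftrightarrow>
     filtration (space M) F \<and> (\<forall>n. subalgebra M (F n)) \<and>
     generated_by M M (\<Union>n. sets (F n)) \<and>
     (\<forall>n. \<exists>\<C>. countable \<C> \<and> (\<forall>B \<in> \<C>. sigma_atom M (F n) B) \<and> generated_by M (F n) \<C>)"

definition regular_filtration :: "'a measure \<Rightarrow> (nat \<Rightarrow> 'a measure) \<Rightarrow> bool" where
  "regular_filtration M F \<longleftrightarrow>
     (\<exists>R>0. \<forall>n\<ge>1. \<forall>A \<in> sets (F n). \<exists>B \<in> sets (F (n - 1)).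
        A \<subseteq> B \<and> measure M B \<le> R * measure M A)"

text \<open>Null sets satisfy the definition of an atom; for them the inequality below holds trivially,
  because \<^term>\<open>(0::real) powr s = 0\<close> for every \<open>s\<close>.\<close>

definition exponent_condition ::
  "'a measure \<Rightarrow> (nat \<Rightarrow> 'a measure) \<Rightarrow> ('a \<Rightarrow> real) \<Rightarrow> bool" where
  "exponent_condition M F p \<longleftrightarrow>
     (\<exists>K\<ge>1. \<forall>n A. sigma_atom M (F n) A \<longrightarrow>
        measure M A powr (real_of_ereal (exponent_inf M p A) - real_of_ereal (exponent_sup M p A))
          \<le> K)"

definition ext_stopping_time :: "'a measure \<Rightarrow> (nat \<Rightarrow> 'a measure) \<Rightarrow> ('a \<Rightarrow> enat) \<Rightarrow> bool" where
  "ext_stopping_time M F \<tau> \<longleftrightarrow> (\<forall>n. {x \<in> space M. \<tau> x \<le> enat n} \<in> sets (F n))"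

section \<open>Martingales and Hardy spaces\<close>

text \<open>Functions are representatives of classes modulo a.e. equality; adaptedness (a.e.) is implied
  by the martingale identity.\<close>

definition martingale :: "'a measure \<Rightarrow> (nat \<Rightarrow> 'a measure) \<Rightarrow> (nat \<Rightarrow> 'a \<Rightarrow> real) \<Rightarrow> bool" where
  "martingale M F f \<longleftrightarrow>
     (\<forall>n. integrable M (f n)) \<and>
     (\<forall>n. AE x in M. real_cond_exp M (F n) (f (Suc n)) x = f n x)"

definition mdiff :: "(nat \<Rightarrow> 'a \<Rightarrow> real) \<Rightarrow> nat \<Rightarrow> 'a \<Rightarrow> real" where
  "mdiff f n x = (case n of 0 \<Rightarrow> f 0 x | Suc m \<Rightarrow> f (Suc m) x - f m x)"

definition square_fun :: "(nat \<Rightarrow> 'a \<Rightarrow> real) \<Rightarrow> 'a \<Rightarrow> ennreal" where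
  "square_fun f x = ennreal_powr (\<Sum>k. ennreal (\<bar>mdiff f k x\<bar>\<^sup>2)) (1/2)"

definition maximal_fun :: "(nat \<Rightarrow> 'a \<Rightarrow> real) \<Rightarrow> 'a \<Rightarrow> ennreal" where
  "maximal_fun f x = (SUP n. ennreal \<bar>f n x\<bar>)"

text \<open>From here on \<open>T\<close> is either \<^const>\<open>square_fun\<close> or \<^const>\<open>maximal_fun\<close>, which gives the spaces
  \<open>H\<^sup>S\<close> and \<open>H\<^sup>M\<close> and the atoms of type 2 and 3, respectively.\<close>

definition hardy_norm ::
  "((nat \<Rightarrow> 'a \<Rightarrow> real) \<Rightarrow> 'a \<Rightarrow> ennreal) \<Rightarrow> 'a measure \<Rightarrow> ('a \<Rightarrow> real) \<Rightarrow> ennreal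
     \<Rightarrow> (nat \<Rightarrow> 'a \<Rightarrow> real) \<Rightarrow> ennreal" where
  "hardy_norm T M p q f = lorentz_norm M p q (T f)"

definition hardy_space ::
  "((nat \<Rightarrow> 'a \<Rightarrow> real) \<Rightarrow> 'a \<Rightarrow> ennreal) \<Rightarrow> 'a measure \<Rightarrow> (nat \<Rightarrow> 'a measure) \<Rightarrow> ('a \<Rightarrow> real)
     \<Rightarrow> ennreal \<Rightarrow> (nat \<Rightarrow> 'a \<Rightarrow> real) set" where
  "hardy_space T M F p q = {f. martingale M F f \<and> hardy_norm T M p q f < \<infinity>}"

section \<open>Atomic Hardy spaces\<close>

text \<open>Integrability of \<open>a\<close> is what makes the conditional expectations \<open>E(a|F\<^sub>n)\<close> meaningful. In
  \<^typ>\<open>ennreal\<close>, \<^term>\<open>1 / 0 = \<infinity>\<close>.\<close>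

definition hardy_atom ::
  "((nat \<Rightarrow> 'a \<Rightarrow> real) \<Rightarrow> 'a \<Rightarrow> ennreal) \<Rightarrow> 'a measure \<Rightarrow> (nat \<Rightarrow> 'a measure) \<Rightarrow> ('a \<Rightarrow> real)
     \<Rightarrow> ('a \<Rightarrow> real) \<Rightarrow> ('a \<Rightarrow> enat) \<Rightarrow> bool" where
  "hardy_atom T M F p a \<tau> \<longleftrightarrow>
     integrable M a \<and> ext_stopping_time M F \<tau> \<and>
     (\<forall>n. AE x in M. enat n \<le> \<tau> x \<longrightarrow> real_cond_exp M (F n) a x = 0) \<and>
     esssup M (T (\<lambda>n. real_cond_exp M (F n) a))
       \<le> 1 / set_var_norm M p {x \<in> space M. \<tau> x < \<infinity>}"

definition atomic_decomposition ::
  "((nat \<Rightarrow> 'a \<Rightarrow> real) \<Rightarrow> 'a \<Rightarrow> ennreal) \<Rightarrow> 'a measure \<Rightarrow> (nat \<Rightarrow> 'a measure) \<Rightarrow> ('a \<Rightarrow> real)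
     \<Rightarrow> (nat \<Rightarrow> 'a \<Rightarrow> real) \<Rightarrow> (int \<Rightarrow> 'a \<Rightarrow> real) \<Rightarrow> (int \<Rightarrow> 'a \<Rightarrow> enat) \<Rightarrow> bool" where
  "atomic_decomposition T M F p f a \<tau> \<longleftrightarrow>
     (\<forall>k. hardy_atom T M F p (a k) (\<tau> k)) \<and>
     (\<forall>n. AE x in M.
        ((\<lambda>k. 3 * 2 powi k * enn2real (set_var_norm M p {x \<in> space M. \<tau> k x < \<infinity>})
               * real_cond_exp M (F n) (a k) x) has_sum f n x) UNIV)"

definition decomposition_norm ::
  "'a measure \<Rightarrow> ('a \<Rightarrow> real) \<Rightarrow> ennreal \<Rightarrow> (int \<Rightarrow> 'a \<Rightarrow> enat) \<Rightarrow> ennreal" where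
  "decomposition_norm M p q \<tau> =
     (if q = \<infinity>
      then SUP k. ennreal (2 powi k) * set_var_norm M p {x \<in> space M. \<tau> k x < \<infinity>}
      else ennreal_powr
        (\<Sum>\<^sub>\<infinity>k\<in>UNIV. ennreal (2 powr (real_of_int k * enn2real q))
           * ennreal_powr (set_var_norm M p {x \<in> space M. \<tau> k x < \<infinity>}) (enn2real q))
        (1 / enn2real q))"

text \<open>The infimum over the empty set is \<^term>\<open>\<infinity> :: ennreal\<close>, so finiteness of
  \<open>atomic_norm\<close> includes the existence of a decomposition.\<close>

definition atomic_norm ::
  "((nat \<Rightarrow> 'a \<Rightarrow> real) \<Rightarrow> 'a \<Rightarrow> ennreal) \<Rightarrow> 'a measure \<Rightarrow> (nat \<Rightarrow> 'a measure) \<Rightarrow> ('a \<Rightarrow> real)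
     \<Rightarrow> ennreal \<Rightarrow> (nat \<Rightarrow> 'a \<Rightarrow> real) \<Rightarrow> ennreal" where
  "atomic_norm T M F p q f =
     Inf {decomposition_norm M p q \<tau> | a \<tau>. atomic_decomposition T M F p f a \<tau>}"

definition atomic_hardy_space ::
  "((nat \<Rightarrow> 'a \<Rightarrow> real) \<Rightarrow> 'a \<Rightarrow> ennreal) \<Rightarrow> 'a measure \<Rightarrow> (nat \<Rightarrow> 'a measure) \<Rightarrow> ('a \<Rightarrow> real)
     \<Rightarrow> ennreal \<Rightarrow> (nat \<Rightarrow> 'a \<Rightarrow> real) set" where
  "atomic_hardy_space T M F p q = {f. martingale M F f \<and> atomic_norm T M F p q f < \<infinity>}"

text \<open>The cancellation condition on an atom at \<open>n = 0 \<le> \<tau>\<close> forces \<open>f\<^sub>0 = 0\<close> a.e. for every \<open>f\<close> in an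
  atomic space, so atomic spaces can only be compared with Hardy spaces of martingales that
  start at zero.\<close>

definition null_start :: "'a measure \<Rightarrow> (nat \<Rightarrow> 'a \<Rightarrow> real) set" where
  "null_start M = {f. AE x in M. f 0 x = 0}"

definition equivalent_norms_on :: "'b set \<Rightarrow> ('b \<Rightarrow> ennreal) \<Rightarrow> ('b \<Rightarrow> ennreal) \<Rightarrow> bool" where
  "equivalent_norms_on X N N' \<longleftrightarrow>
     (\<exists>c C :: real. 0 < c \<and> 0 < C \<and>
        (\<forall>f \<in> X. ennreal c * N f \<le> N' f \<and> N' f \<le> ennreal C * N f))"

end

theory Submission
  imports Defs
begin

text \<open>
  Let \<open>T\<close> be the square function or the maximal function. Both have the form \<open>T f = sup\<^sub>N \<phi>\<^sub>N(f)\<close>,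
  where \<open>\<phi>\<^sub>N\<close> is a seminorm of the finite sequence \<open>f\<^sub>0(x), \<dots>, f\<^sub>N(x)\<close>, and
  stopping the sequence at \<open>m\<close> turns \<open>\<phi>\<^sub>N\<close> into \<open>\<phi>\<^bsub>min N m\<^esub>\<close>. The locale
  \<open>hardy_functional\<close> collects what is used of \<open>T\<close>, so
  that the two halves of the theorem have one proof.

  \<^emph>\<open>Decomposing a martingale.\<close> Let \<open>f\<^sub>0 = 0\<close> a.e. After changing \<open>f\<close> on
  null sets it is adapted. For a level \<open>t > 0\<close> the
  set \<open>A\<^sub>n = {\<phi>\<^sub>n\<^sub>+\<^sub>1(f) > t}\<close> lies in \<open>F\<^sub>n\<^sub>+\<^sub>1\<close>. Let \<open>U\<^sub>n\<close>, its hull, be the union of the atoms of \<open>F\<^sub>n\<close> that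
  meet \<open>A\<^sub>n\<close> in positive measure, and let \<open>\<tau>\<^sub>t\<close> be the first \<open>n\<close> with \<open>x \<in> U\<^sub>n\<close>. This is a stopping time, it
  increases with \<open>t\<close>, and since \<open>A\<^sub>n \<subseteq> U\<^sub>n\<close> a.e. the process stops before \<open>\<phi>\<close> exceeds \<open>t\<close>; so the stopped
  martingale \<open>f\<^sup>\<tau>\<close> satisfies \<open>T(f\<^sup>\<tau>) \<le> t\<close>. The differences of the martingales stopped at \<open>\<tau>\<close> for the
  levels \<open>2\<^sup>k\<^sup>+\<^sup>1\<close> and \<open>2\<^sup>k\<close> telescope to \<open>f\<close>, vanish up to the earlier time and satisfy \<open>T \<le> 3 \<cdot> 2\<^sup>k\<close>.
  They are bounded in \<open>L\<^sub>2\<close>, hence closed by integrable functions (\<open>L2_bounded_martingale_closed\<close>), which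
  are the atoms after division by \<open>\<mu>\<^sub>k\<close>.

  \<^emph>\<open>Size of the stopping sets.\<close> Regularity gives \<open>P(D) \<le> R P(D \<inter> A\<^sub>n)\<close> for each atom \<open>D\<close> in the hull
  \<open>U\<^sub>n\<close>. If \<open>0 < c \<le> 1\<close> and the modular \<open>\<integral>\<^sub>E c\<^sup>-\<^sup>p\<close> of \<open>E = {T f > t}\<close> is at most \<open>1\<close>, then
  \<open>P(D)/R \<le> c\<close> to the power \<open>p\<^sub>-\<close>, and so the exponent condition bounds \<open>c\<close> to the power
  \<open>p\<^sub>-(D) - p\<^sub>+(D)\<close> by a constant. Hence replacing \<open>D \<inter> A\<^sub>n\<close> by \<open>D\<close> increases the modular at most by a
  constant factor; summing over the disjoint pieces of \<open>{\<tau>\<^sub>t < \<infinity>}\<close> shows that the norm of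
  \<open>{\<tau>\<^sub>t < \<infinity>}\<close> is at most a constant times the norm of \<open>{T f > t}\<close> (\<open>set_var_norm_atom_hulls_le\<close>). No
  maximal inequality is needed.

  \<^emph>\<open>Bounding a decomposed martingale.\<close> If \<open>f = \<Sum>\<^sub>k \<mu>\<^sub>k a\<^sup>k\<close>, then \<open>\<mu>\<^sub>k T(a\<^sup>k) \<le> 3 \<cdot> 2\<^sup>k\<close>, and \<open>T(a\<^sup>k) = 0\<close>
  off \<open>{\<tau>\<^sub>k < \<infinity>}\<close>. Summing a geometric series, \<open>{T f > 3 \<cdot> 2\<^sup>K}\<close> is contained in the union of the sets
  \<open>{\<tau>\<^sub>k < \<infinity>}\<close> with \<open>k \<ge> K\<close>, up to a null set (\<open>AE_level_subset_tail\<close>). The norm of a union of sets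
  \<open>B\<^sub>j\<close> is at most a constant times the supremum of the numbers \<open>2\<^sup>j\<^sup>/\<^sup>2\<close> times the norm of \<open>B\<^sub>j\<close>
  (\<open>set_var_norm_UN\<close>).

  In both directions the Lorentz integral is compared with a sum over dyadic levels. In the second one the
  weights \<open>2\<^sup>j\<^sup>/\<^sup>2\<close> are absorbed by \<open>2\<^sup>K = 2\<^sup>K\<^sup>+\<^sup>j 2\<^sup>-\<^sup>j\<close>, which makes the double sum converge for every
  \<open>q\<close>.
\<close>

section \<open>Real powers on the extended half-line\<close>

lemma ennreal_powr_ennreal: "0 \<le> x \<Longrightarrow> ennreal_powr (ennreal x) r = ennreal (x powr r)"
  by (simp add: ennreal_powr_def)

lemma ennreal_powr_top [simp]: "ennreal_powr top r = top"
  by (simp add: ennreal_powr_def)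

lemma ennreal_powr_0 [simp]: "ennreal_powr 0 r = 0"
  by (simp add: ennreal_powr_def)

lemma ennreal_powr_mono: "a \<le> b \<Longrightarrow> 0 \<le> r \<Longrightarrow> ennreal_powr a r \<le> ennreal_powr b r"
  by (cases a; cases b) (auto simp: ennreal_powr_ennreal top_unique intro!: ennreal_leI powr_mono2)

lemma ennreal_powr_mult:
  assumes "0 < c"
  shows "ennreal_powr (ennreal c * a) r = ennreal (c powr r) * ennreal_powr a r"
proof (cases a)
  case (real x)
  then show ?thesis using assms
    by (simp add: ennreal_mult[symmetric] ennreal_powr_ennreal powr_mult)
next
  case top
  then show ?thesis using assms by (simp add: ennreal_mult_top)
qed

lemma ennreal_powr_powr: "0 < r \<Longrightarrow> ennreal_powr (ennreal_powr a r) s = ennreal_powr a (r * s)"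
  by (cases a) (auto simp: ennreal_powr_ennreal powr_powr)

lemma ennreal_powr_1 [simp]: "ennreal_powr a 1 = a"
  by (cases a) (auto simp: ennreal_powr_ennreal)

lemma ennreal_powr_inverse:
  assumes "0 < r"
  shows "ennreal_powr (ennreal_powr a r) (1 / r) = a" "ennreal_powr (ennreal_powr a (1 / r)) r = a"
  using assms by (simp_all add: ennreal_powr_powr)

lemma ennreal_le_of_less_imp_le:
  fixes A Y :: ennreal
  assumes "0 < C" and le: "\<And>c. 0 < c \<Longrightarrow> A < ennreal c \<Longrightarrow> Y \<le> ennreal (C * c)"
  shows "Y \<le> ennreal C * A"
proof (cases A)
  case (real a)
  show ?thesis
  proof (rule ennreal_le_epsilon)
    fix e :: real assume "0 < e"
    have "Y \<le> ennreal (C * (a + e / C))"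
      using real \<open>0 < e\<close> \<open>0 < C\<close> by (intro le) (auto intro!: ennreal_lessI add_nonneg_pos)
    also have "C * (a + e / C) = C * a + e" using \<open>0 < C\<close> by (simp add: field_simps)
    finally show "Y \<le> ennreal C * A + ennreal e"
      using real \<open>0 < e\<close> \<open>0 < C\<close> by (simp add: ennreal_mult)
  qed
next
  case top
  then show ?thesis using \<open>0 < C\<close> by (simp add: ennreal_mult_top)
qed

section \<open>Variable norms of sets\<close>

text \<open>A measurable exponent on a probability space with an a.e. positive lower bound \<open>pm\<close>, which
  plays the role of \<open>p\<^sub>-\<close>.\<close>

locale variable_exponent = prob_space M for M :: "'a measure" +
  fixes p :: "'a \<Rightarrow> real" and pm :: real
  assumes p_measurable [measurable]: "p \<in> borel_measurable M"
    and pm_pos: "0 < pm" and pm_le: "AE x in M. pm \<le> p x"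
begin

text \<open>The modular \<open>\<integral>\<^sub>B c\<^sup>-\<^sup>p\<close>: the norm of \<open>B\<close> is the infimum of the \<open>c > 0\<close> for which it is at
  most \<open>1\<close>.\<close>

definition modular :: "real \<Rightarrow> 'a set \<Rightarrow> ennreal" where
  "modular c B = (\<integral>\<^sup>+x. ennreal ((1 / c) powr p x) * indicator B x \<partial>M)"

lemma set_var_norm_eq: "set_var_norm M p B = (INF c \<in> {c. 0 < c \<and> modular c B \<le> 1}. ennreal c)"
proof -
  have "(\<integral>\<^sup>+ x. ennreal ((\<bar>indicator B x\<bar> / c) powr p x) \<partial>M) = modular c B" for c
    unfolding modular_def by (intro nn_integral_cong) (simp split: split_indicator)
  then show ?thesis unfolding var_norm_def by simp
qed

lemma set_var_norm_leI: "0 < c \<Longrightarrow> modular c B \<le> 1 \<Longrightarrow> set_var_norm M p B \<le> ennreal c"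
  unfolding set_var_norm_eq by (rule INF_lower) simp

lemma modular_mono_AE:
  "AE x in M. x \<in> A \<longrightarrow> x \<in> B \<Longrightarrow> modular c A \<le> modular c B"
  unfolding modular_def by (intro nn_integral_mono_AE) (auto split: split_indicator)

lemma set_var_norm_mono_AE:
  assumes "AE x in M. x \<in> A \<longrightarrow> x \<in> B"
  shows "set_var_norm M p A \<le> set_var_norm M p B"
  unfolding set_var_norm_eq
  by (rule INF_superset_mono) (auto intro: order_trans[OF modular_mono_AE[OF assms]])

lemma modular_rescale:
  assumes "0 < c" "0 < t" "t \<le> 1" and [measurable]: "B \<in> sets M"
  shows "modular (c / t) B \<le> ennreal (t powr pm) * modular c B"
proof -
  have "modular (c / t) B
      \<le> (\<integral>\<^sup>+x. ennreal (t powr pm) * (ennreal ((1 / c) powr p x) * indicator B x) \<partial>M)"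
    unfolding modular_def
  proof (rule nn_integral_mono_AE, use pm_le in eventually_elim)
    fix x assume "pm \<le> p x"
    have "(1 / (c / t)) powr p x = t powr p x * (1 / c) powr p x"
      using assms by (simp add: powr_divide)
    also have "\<dots> \<le> t powr pm * (1 / c) powr p x"
      using \<open>pm \<le> p x\<close> assms by (intro mult_right_mono) (auto intro: powr_mono')
    finally show "ennreal ((1 / (c / t)) powr p x) * indicator B x
        \<le> ennreal (t powr pm) * (ennreal ((1 / c) powr p x) * indicator B x)"
      by (auto simp: ennreal_mult[symmetric] split: split_indicator intro!: ennreal_leI)
  qed
  also have "\<dots> = ennreal (t powr pm) * modular c B"
    unfolding modular_def by (intro nn_integral_cmult) measurable
  finally show ?thesis .
qed

lemma modular_antimono:
  assumes "0 < c" "c \<le> d"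
  shows "modular d B \<le> modular c B"
  unfolding modular_def
proof (rule nn_integral_mono_AE, use pm_le in eventually_elim)
  fix x assume "pm \<le> p x"
  then have "(1 / d) powr p x \<le> (1 / c) powr p x"
    using assms pm_pos by (intro powr_mono2) (auto simp: frac_le)
  then show "ennreal ((1 / d) powr p x) * indicator B x \<le> ennreal ((1 / c) powr p x) * indicator B x"
    by (auto split: split_indicator intro!: ennreal_leI)
qed

lemma modular_le_1:
  assumes "set_var_norm M p B < ennreal c"
  shows "modular c B \<le> 1"
proof -
  obtain c0 where "0 < c0" "modular c0 B \<le> 1" "ennreal c0 < ennreal c"
    using assms unfolding set_var_norm_eq INF_less_iff by auto
  moreover from this have "c0 \<le> c" by (simp add: ennreal_less_iff)
  ultimately show ?thesis using modular_antimono[of c0 c B] by simp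
qed

lemma modular_1: "B \<in> sets M \<Longrightarrow> modular 1 B = emeasure M B"
  unfolding modular_def by simp

lemma set_var_norm_le_1: "set_var_norm M p B \<le> 1"
proof -
  have "modular 1 B \<le> modular 1 (space M)" by (rule modular_mono_AE) simp
  also have "\<dots> = 1" by (simp add: modular_1 emeasure_space_1)
  finally show ?thesis using set_var_norm_leI[of 1 B] by simp
qed

lemma set_var_norm_neq_top [simp]: "set_var_norm M p B \<noteq> top"
  using set_var_norm_le_1[of B] by (auto simp: top_unique)

lemma measure_le_of_modular:
  assumes "B \<in> sets M" "modular c B \<le> 1" "0 < c" "c \<le> 1"
  shows "measure M B \<le> c powr pm"
proof -
  have "ennreal (measure M B) = modular (c / c) B"
    using assms by (simp add: modular_1 emeasure_eq_measure)
  also have "\<dots> \<le> ennreal (c powr pm) * modular c B"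
    using assms by (intro modular_rescale) auto
  also have "\<dots> \<le> ennreal (c powr pm) * 1"
    using assms by (intro mult_left_mono) auto
  finally show ?thesis by (simp add: ennreal_le_iff)
qed

lemma set_var_norm_eq_0_imp_null:
  assumes "B \<in> sets M" "set_var_norm M p B = 0"
  shows "measure M B = 0"
proof (rule ccontr)
  assume "measure M B \<noteq> 0"
  then have pos: "0 < measure M B" by (simp add: zero_less_measure_iff)
  define c where "c = (measure M B / 2) powr (1 / pm)"
  have "measure M B \<le> 1" by simp
  have "0 < c" "c \<le> 1" unfolding c_def using pos pm_pos prob_le_1[of B]
    by (auto intro!: powr_le1 simp del: prob_le_1 measure_le_1)
  then have "measure M B \<le> c powr pm"
    using assms by (intro measure_le_of_modular modular_le_1) auto
  also have "\<dots> = measure M B / 2" unfolding c_def using pm_pos by (simp add: powr_powr)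
  finally show False using pos by simp
qed

lemma set_var_norm_le_of_modular:
  assumes "B \<in> sets M" "0 < c" "1 \<le> L" "modular c B \<le> ennreal L"
  shows "set_var_norm M p B \<le> ennreal (L powr (1 / pm) * c)"
proof -
  define t where "t = L powr (- (1 / pm))"
  have t: "0 < t" "t \<le> 1" unfolding t_def using assms pm_pos
    by (auto simp: powr_minus inverse_le_1_iff intro: ge_one_powr_ge_zero)
  have "modular (c / t) B \<le> ennreal (t powr pm) * modular c B"
    using t assms by (intro modular_rescale) auto
  also have "\<dots> \<le> ennreal (t powr pm) * ennreal L" using assms by (intro mult_left_mono) auto
  also have "\<dots> = ennreal (t powr pm * L)" using assms by (simp add: ennreal_mult)
  also have "t powr pm = 1 / L" unfolding t_def using assms pm_pos
    by (simp add: powr_powr powr_neg_one)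
  also have "ennreal (1 / L * L) = 1" using assms by simp
  finally have "set_var_norm M p B \<le> ennreal (c / t)"
    using t assms by (intro set_var_norm_leI) auto
  also have "c / t = L powr (1 / pm) * c" unfolding t_def by (simp add: powr_minus field_simps)
  finally show ?thesis .
qed

lemma modular_UN_disjoint:
  assumes "\<And>j. X j \<in> sets M" "disjoint_family X"
  shows "modular c (\<Union>j::nat. X j) = (\<Sum>j. modular c (X j))"
proof -
  have "modular c B = emeasure (density M (\<lambda>x. ennreal ((1 / c) powr p x))) B" if "B \<in> sets M" for B
    unfolding modular_def using that by (subst emeasure_density) auto
  then show ?thesis
    using assms suminf_emeasure[of X "density M (\<lambda>x. ennreal ((1 / c) powr p x))", symmetric]
    by auto
qed

text \<open>This replaces the quasi-triangle inequality for infinitely many sets. The weights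
  \<open>2\<^sup>j\<^sup>/\<^sup>2\<close> make the modulars of the \<open>B\<^sub>j\<close> summable; any other geometric weight growing more slowly
  than \<open>2\<^sup>j\<close> would serve the argument as well.\<close>

lemma set_var_norm_UN:
  obtains C :: real where "0 < C"
    "\<And>B :: nat \<Rightarrow> 'a set. (\<And>j. B j \<in> sets M) \<Longrightarrow>
       set_var_norm M p (\<Union>j. B j)
         \<le> ennreal C * (SUP j. ennreal (2 powr (real j / 2)) * set_var_norm M p (B j))"
proof -
  define \<theta> where "\<theta> = (2::real) powr (- (pm / 2))"
  have \<theta>: "0 < \<theta>" "\<theta> < 1" unfolding \<theta>_def using pm_pos by (auto simp: powr_less_one)
  define W where "W = 1 / (1 - \<theta>)"
  have W: "1 \<le> W" unfolding W_def using \<theta> by (simp add: field_simps)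
  have "set_var_norm M p (\<Union>j. B j)
         \<le> ennreal (W powr (1 / pm)) * (SUP j. ennreal (2 powr (real j / 2)) * set_var_norm M p (B j))"
    (is "_ \<le> _ * ?A")
    if B[measurable]: "\<And>j. B j \<in> sets M" for B :: "nat \<Rightarrow> 'a set"
  proof (rule ennreal_le_of_less_imp_le)
    show "0 < W powr (1 / pm)" using W by simp
    fix c :: real assume c: "0 < c" "?A < ennreal c"
    \<comment> \<open>The norm of \<open>B\<^sub>j\<close> is less than \<open>c t\<close>; rescaling from \<open>c t\<close> back to \<open>c\<close> gains the factor
      \<open>t\<close> to the power \<open>pm\<close>.\<close>
    have mod_j: "modular c (B j) \<le> ennreal (\<theta> ^ j)" for j
    proof -
      define t where "t = (2::real) powr (- (real j / 2))"
      have t: "0 < t" "t \<le> 1" unfolding t_def by (auto simp: powr_minus inverse_le_1_iff intro: ge_one_powr_ge_zero)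
      have "ennreal (1 / t) * set_var_norm M p (B j) < ennreal c"
        using le_less_trans[OF SUP_upper[of j] c(2)] by (simp add: t_def powr_minus_divide)
      then have "set_var_norm M p (B j) < ennreal (c * t)"
        using t c set_var_norm_neq_top[of "B j"]
        by (cases "set_var_norm M p (B j)")
          (auto simp: ennreal_mult[symmetric] ennreal_less_iff field_simps)
      then have "modular (c * t) (B j) \<le> 1" by (rule modular_le_1)
      have "modular (c * t / t) (B j) \<le> ennreal (t powr pm) * modular (c * t) (B j)"
        using t c by (intro modular_rescale) auto
      also have "\<dots> \<le> ennreal (t powr pm) * 1"
        using \<open>modular (c * t) (B j) \<le> 1\<close> by (intro mult_left_mono) auto
      also have "t powr pm = \<theta> ^ j"
        unfolding t_def \<theta>_def by (simp add: powr_powr powr_realpow[symmetric] mult.commute)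
      finally show ?thesis using t by simp
    qed
    have "modular c (\<Union>j. B j) \<le> (\<integral>\<^sup>+x. (\<Sum>j. ennreal ((1 / c) powr p x) * indicator (B j) x) \<partial>M)"
      unfolding modular_def
    proof (intro nn_integral_mono)
      fix x
      show "ennreal ((1 / c) powr p x) * indicator (\<Union>j. B j) x
          \<le> (\<Sum>j. ennreal ((1 / c) powr p x) * indicator (B j) x)"
      proof (cases "x \<in> (\<Union>j. B j)")
        case True
        then obtain j where "x \<in> B j" by auto
        then have "ennreal ((1 / c) powr p x) * indicator (\<Union>j. B j) x
            = (\<Sum>i\<in>{j}. ennreal ((1 / c) powr p x) * indicator (B i) x)"
            by (auto simp: indicator_def)
        also have "\<dots> \<le> (\<Sum>j. ennreal ((1 / c) powr p x) * indicator (B j) x)"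
          by (rule sum_le_suminf) auto
        finally show ?thesis .
      qed simp
    qed
    also have "\<dots> = (\<Sum>j. modular c (B j))"
      unfolding modular_def by (intro nn_integral_suminf) measurable
    also have "\<dots> \<le> (\<Sum>j. ennreal (\<theta> ^ j))" by (intro suminf_le mod_j) auto
    also have "\<dots> = ennreal W" unfolding W_def using \<theta>
      by (intro suminf_ennreal_eq) (auto intro: geometric_sums)
    finally show "set_var_norm M p (\<Union>j. B j) \<le> ennreal (W powr (1 / pm) * c)"
      using W c by (intro set_var_norm_le_of_modular) auto
  qed
  moreover have "0 < W powr (1 / pm)" using W by simp
  ultimately show ?thesis using that by blast
qed

end

section \<open>Dyadic sums and Lorentz integrals\<close>

text \<open>The blocks \<open>(s 2\<^sup>k\<^sup>-\<^sup>1, s 2\<^sup>k]\<close>, \<open>k \<in> \<int>\<close>, partition the positive half-line.\<close>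

definition dyadic_block :: "real \<Rightarrow> int \<Rightarrow> real set" where
  "dyadic_block s k = {s * 2 powr (real_of_int k - 1) <.. s * 2 powr real_of_int k}"

lemma mem_dyadic_block_iff:
  assumes "0 < s"
  shows "t \<in> dyadic_block s k \<longleftrightarrow> 0 < t \<and> \<lceil>log 2 (t / s)\<rceil> = k"
proof (cases "0 < t")
  case True
  then have "0 < t / s" using assms by simp
  have "t \<in> dyadic_block s k \<longleftrightarrow> 2 powr (real_of_int k - 1) < t / s \<and> t / s \<le> 2 powr real_of_int k"
    unfolding dyadic_block_def using assms by (auto simp: field_simps)
  also have "\<dots> \<longleftrightarrow> real_of_int k - 1 < log 2 (t / s) \<and> log 2 (t / s) \<le> real_of_int k"
    using \<open>0 < t / s\<close> by (simp add: less_log_iff log_le_iff)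
  also have "\<dots> \<longleftrightarrow> \<lceil>log 2 (t / s)\<rceil> = k" by linarith
  finally show ?thesis using True by simp
next
  case False
  have "0 < s * 2 powr (real_of_int k - 1)" using assms by simp
  with False show ?thesis unfolding dyadic_block_def by auto
qed

lemma sum_dyadic_blocks:
  fixes c :: "int \<Rightarrow> ennreal"
  assumes "0 < s" "finite K"
  shows "(\<Sum>k\<in>K. c k * indicator (dyadic_block s k) t)
    = (if 0 < t \<and> \<lceil>log 2 (t / s)\<rceil> \<in> K then c \<lceil>log 2 (t / s)\<rceil> else 0)"
proof -
  have "(\<Sum>k\<in>K. c k * indicator (dyadic_block s k) t)
      = (\<Sum>k\<in>K. if \<lceil>log 2 (t / s)\<rceil> = k then (if 0 < t then c k else 0) else 0)"
    by (intro sum.cong refl) (auto simp: indicator_def mem_dyadic_block_iff[OF assms(1)])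
  then show ?thesis using assms by (simp add: sum.delta')
qed

lemma nn_integral_dyadic_blocks:
  fixes c :: "int \<Rightarrow> ennreal"
  assumes "0 < s" "finite K"
  shows "(\<integral>\<^sup>+t. (\<Sum>k\<in>K. c k * indicator (dyadic_block s k) t) \<partial>lborel)
    = (\<Sum>k\<in>K. c k * ennreal (s * 2 powr (real_of_int k - 1)))"
proof -
  have "emeasure lborel (dyadic_block s k) = ennreal (s * 2 powr (real_of_int k - 1))" for k
  proof -
    have eq: "2 powr real_of_int k = 2 * 2 powr (real_of_int k - 1)" by (simp add: powr_diff)
    have "0 \<le> s * 2 powr (real_of_int k - 1)" using assms by simp
    then show ?thesis unfolding dyadic_block_def eq
      by (subst emeasure_lborel_Ioc) (auto simp: algebra_simps)
  qed
  moreover have "dyadic_block s k \<in> sets lborel" for k unfolding dyadic_block_def by simp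
  ultimately show ?thesis
    by (subst nn_integral_sum) (auto intro!: sum.cong simp: nn_integral_cmult_indicator)
qed

lemma dyadic_sum_le_integral:
  fixes G :: "real \<Rightarrow> ennreal"
  assumes "0 < r" and anti: "\<And>s t. 0 < s \<Longrightarrow> s \<le> t \<Longrightarrow> G t \<le> G s" and "finite K"
  shows "(\<Sum>k\<in>K. ennreal (2 powr (real_of_int k * r)) * G (2 powr real_of_int k))
    \<le> ennreal (2 powr (r + 1))
       * (\<integral>\<^sup>+t. ennreal (t powr r) * G t / ennreal t * indicator {0<..} t \<partial>lborel)"
proof -
  define c where "c k = ennreal (2 powr ((real_of_int k - 1) * r) / 2 powr real_of_int k)
    * G (2 powr real_of_int k)" for k
  have "(\<Sum>k\<in>K. ennreal (2 powr (real_of_int k * r)) * G (2 powr real_of_int k))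
      = ennreal (2 powr (r + 1)) * (\<Sum>k\<in>K. c k * ennreal (1 * 2 powr (real_of_int k - 1)))"
    unfolding sum_distrib_left
  proof (intro sum.cong refl)
    fix k
    define u v w :: real where "u = 2 powr (r + 1)"
      and "v = 2 powr ((real_of_int k - 1) * r) / 2 powr real_of_int k"
      and "w = 1 * 2 powr (real_of_int k - 1)"
    have "2 powr (real_of_int k * r) = u * v * w" unfolding u_def v_def w_def
      by (simp add: powr_diff[symmetric] powr_add[symmetric] algebra_simps)
    moreover have "0 \<le> u" "0 \<le> v" "0 \<le> w" unfolding u_def v_def w_def by simp_all
    ultimately show "ennreal (2 powr (real_of_int k * r)) * G (2 powr real_of_int k)
        = ennreal (2 powr (r + 1)) * (c k * ennreal (1 * 2 powr (real_of_int k - 1)))"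
      unfolding c_def u_def[symmetric] v_def[symmetric] w_def[symmetric]
      by (simp add: ennreal_mult mult_ac)
  qed
  also have "(\<Sum>k\<in>K. c k * ennreal (1 * 2 powr (real_of_int k - 1)))
      = (\<integral>\<^sup>+t. (\<Sum>k\<in>K. c k * indicator (dyadic_block 1 k) t) \<partial>lborel)"
    using assms by (intro nn_integral_dyadic_blocks[symmetric]) auto
  also have "\<dots> \<le> (\<integral>\<^sup>+t. ennreal (t powr r) * G t / ennreal t * indicator {0<..} t \<partial>lborel)"
  proof (intro nn_integral_mono)
    fix t :: real
    show "(\<Sum>k\<in>K. c k * indicator (dyadic_block 1 k) t)
        \<le> ennreal (t powr r) * G t / ennreal t * indicator {0<..} t"
    proof (cases "0 < t \<and> \<lceil>log 2 (t / 1)\<rceil> \<in> K")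
      case True
      define k where "k = \<lceil>log 2 (t / 1)\<rceil>"
      have "t \<in> dyadic_block 1 k" using True by (simp add: mem_dyadic_block_iff k_def)
      then have t: "2 powr (real_of_int k - 1) < t" "t \<le> 2 powr real_of_int k"
        by (auto simp: dyadic_block_def)
      have "c k \<le> ennreal (t powr r / t) * G t"
        unfolding c_def
      proof (intro mult_mono ennreal_leI)
        have "2 powr ((real_of_int k - 1) * r) = (2 powr (real_of_int k - 1)) powr r"
          by (simp add: powr_powr)
        also have "\<dots> \<le> t powr r" using t assms by (intro powr_mono2) auto
        finally show "2 powr ((real_of_int k - 1) * r) / 2 powr real_of_int k \<le> t powr r / t"
          using t True by (intro frac_le) auto
        show "G (2 powr real_of_int k) \<le> G t" using t True by (intro anti) auto
      qed auto
      also have "\<dots> = ennreal (t powr r) * G t / ennreal t * indicator {0<..} t"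
        using True by (simp add: divide_ennreal[symmetric] ennreal_times_divide mult.commute)
      finally show ?thesis
        using True assms by (subst sum_dyadic_blocks) (auto simp: k_def)
    next
      case False
      then show ?thesis using assms by (subst sum_dyadic_blocks) auto
    qed
  qed
  finally show ?thesis by (simp add: mult_left_mono)
qed

text \<open>No measurability of \<open>G\<close> is needed: the integrand is dominated by a step function, which is the
  increasing limit of its restrictions to finitely many blocks.\<close>

lemma integral_le_dyadic_sum:
  fixes G :: "real \<Rightarrow> ennreal"
  assumes "0 < r" "0 < s" and anti: "\<And>s t. 0 < s \<Longrightarrow> s \<le> t \<Longrightarrow> G t \<le> G s"
    and S: "\<And>K. finite K \<Longrightarrow>
      (\<Sum>k\<in>K. ennreal (2 powr (real_of_int k * r)) * G (s * 2 powr real_of_int k)) \<le> S"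
  shows "(\<integral>\<^sup>+t. ennreal (t powr r) * G t / ennreal t * indicator {0<..} t \<partial>lborel)
    \<le> ennreal ((2 * s) powr r) * S"
proof -
  define c where "c k = ennreal ((s * 2 powr real_of_int k) powr r / (s * 2 powr (real_of_int k - 1)))
    * G (s * 2 powr (real_of_int k - 1))" for k
  define h where "h N t = (\<Sum>k\<in>{- int N..int N}. c k * indicator (dyadic_block s k) t)" for N t
  have "(\<integral>\<^sup>+t. ennreal (t powr r) * G t / ennreal t * indicator {0<..} t \<partial>lborel)
      \<le> (\<integral>\<^sup>+t. (SUP N. h N t) \<partial>lborel)"
  proof (intro nn_integral_mono)
    fix t :: real
    show "ennreal (t powr r) * G t / ennreal t * indicator {0<..} t \<le> (SUP N. h N t)"
    proof (cases "0 < t")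
      case True
      define k where "k = \<lceil>log 2 (t / s)\<rceil>"
      have "t \<in> dyadic_block s k" using True assms by (simp add: mem_dyadic_block_iff k_def)
      then have t: "s * 2 powr (real_of_int k - 1) < t" "t \<le> s * 2 powr real_of_int k"
        by (auto simp: dyadic_block_def)
      have "ennreal (t powr r) * G t / ennreal t * indicator {0<..} t = ennreal (t powr r / t) * G t"
        using True by (simp add: divide_ennreal[symmetric] ennreal_times_divide mult.commute)
      also have "\<dots> \<le> c k" unfolding c_def
        using t True assms
        by (intro mult_mono ennreal_leI frac_le powr_mono2 anti) auto
      also have "c k = h (nat \<bar>k\<bar>) t"
        unfolding h_def using True assms by (subst sum_dyadic_blocks) (auto simp: k_def)
      also have "\<dots> \<le> (SUP N. h N t)" by (rule SUP_upper) simp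
      finally show ?thesis .
    qed simp
  qed
  also have "\<dots> = (SUP N. \<integral>\<^sup>+t. h N t \<partial>lborel)"
  proof (rule nn_integral_monotone_convergence_SUP)
    show "incseq h"
      unfolding h_def incseq_def le_fun_def by (intro allI impI sum_mono2) auto
    show "h N \<in> borel_measurable lborel" for N
      unfolding h_def dyadic_block_def by measurable
  qed
  also have "\<dots> \<le> ennreal ((2 * s) powr r) * S"
  proof (rule SUP_least)
    fix N
    have "(\<integral>\<^sup>+t. h N t \<partial>lborel)
        = (\<Sum>k\<in>{- int N..int N}. c k * ennreal (s * 2 powr (real_of_int k - 1)))"
      unfolding h_def using assms by (intro nn_integral_dyadic_blocks) auto
    also have "\<dots> = (\<Sum>k\<in>{- int N..int N}. ennreal ((2 * s) powr r)
        * (ennreal (2 powr (real_of_int (k - 1) * r)) * G (s * 2 powr real_of_int (k - 1))))"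
    proof (intro sum.cong refl)
      fix k
      have "(s * 2 powr real_of_int k) powr r = ((2 * s) * 2 powr (real_of_int k - 1)) powr r"
        by (simp add: powr_diff)
      also have "\<dots> = (2 * s) powr r * 2 powr (real_of_int (k - 1) * r)"
        using assms by (subst powr_mult) (auto simp: powr_powr)
      finally have "(s * 2 powr real_of_int k) powr r / (s * 2 powr (real_of_int k - 1))
            * (s * 2 powr (real_of_int k - 1)) = (2 * s) powr r * 2 powr (real_of_int (k - 1) * r)"
        using assms by simp
      moreover have "c k * ennreal (s * 2 powr (real_of_int k - 1))
          = ennreal ((s * 2 powr real_of_int k) powr r / (s * 2 powr (real_of_int k - 1))
            * (s * 2 powr (real_of_int k - 1))) * G (s * 2 powr real_of_int (k - 1))"
        unfolding c_def using assms by (subst ennreal_mult) (auto simp: mult_ac)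
      ultimately show "c k * ennreal (s * 2 powr (real_of_int k - 1)) = ennreal ((2 * s) powr r)
          * (ennreal (2 powr (real_of_int (k - 1) * r)) * G (s * 2 powr real_of_int (k - 1)))"
        by (simp add: ennreal_mult mult.assoc)
    qed
    also have "\<dots> = ennreal ((2 * s) powr r) * (\<Sum>k\<in>(\<lambda>k. k - 1) ` {- int N..int N}.
        ennreal (2 powr (real_of_int k * r)) * G (s * 2 powr real_of_int k))"
      by (subst sum.reindex) (auto simp: sum_distrib_left inj_on_def)
    also have "\<dots> \<le> ennreal ((2 * s) powr r) * S" by (intro mult_left_mono S) auto
    finally show "(\<integral>\<^sup>+t. h N t \<partial>lborel) \<le> ennreal ((2 * s) powr r) * S" .
  qed
  finally show ?thesis .
qed

section \<open>Martingales: adapted versions, stopping and closing\<close>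

text \<open>The index \<open>min n t\<close> as a natural number, for a possibly infinite time \<open>t\<close>.\<close>

definition stop_index :: "nat \<Rightarrow> enat \<Rightarrow> nat" where
  "stop_index n t = the_enat (min (enat n) t)"

lemma stop_index_simps [simp]:
  "stop_index n (enat m) = min n m" "stop_index n \<infinity> = n" "stop_index 0 t = 0"
  unfolding stop_index_def using the_enat.simps[of 0] by (simp_all add: enat_0)

lemma stop_index_eq: "enat n \<le> t \<Longrightarrow> stop_index n t = n"
  by (cases t) auto

lemma stop_index_le: "stop_index n t \<le> n" "enat (stop_index n t) \<le> t"
  by (cases t; auto)+

lemma stop_index_Suc: "stop_index (Suc n) t = (if enat (Suc n) \<le> t then Suc n else stop_index n t)"
  by (cases t) auto

text \<open>The stopped process \<open>g\<^bsub>min n \<tau>\<^esub>\<close>.\<close>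

definition stopped :: "('a \<Rightarrow> enat) \<Rightarrow> (nat \<Rightarrow> 'a \<Rightarrow> real) \<Rightarrow> nat \<Rightarrow> 'a \<Rightarrow> real" where
  "stopped \<tau> g n x = g (stop_index n (\<tau> x)) x"

lemma stopped_0 [simp]: "stopped \<tau> g 0 = g 0"
  by (simp add: stopped_def fun_eq_iff)

text \<open>A probability space with a filtration of its \<open>\<sigma>\<close>-algebra.\<close>

locale filtered_prob_space = prob_space M for M :: "'a measure" +
  fixes F :: "nat \<Rightarrow> 'a measure"
  assumes filt: "filtration (space M) F" and subalg: "\<And>n. subalgebra M (F n)"
begin

lemma sets_F_imp_M: "A \<in> sets (F n) \<Longrightarrow> A \<in> sets M"
  using subalg[of n] by (auto simp: subalgebra_def)

lemma space_F [simp]: "space (F n) = space M"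
  using subalg[of n] by (auto simp: subalgebra_def)

lemma sets_F_mono: "m \<le> n \<Longrightarrow> A \<in> sets (F m) \<Longrightarrow> A \<in> sets (F n)"
  using filtration.sets_F_mono[OF filt, of m n] by auto

lemma sigma_finite_subalgebra_F: "sigma_finite_subalgebra M (F n)"
  by (intro finite_measure_subalgebra_is_sigma_finite finite_measure_subalgebra.intro
      finite_measure_subalgebra_axioms.intro subalg finite_measure_axioms)

lemma measurable_F_imp_M: "f \<in> borel_measurable (F n) \<Longrightarrow> f \<in> borel_measurable M"
  by (rule measurable_from_subalg[OF subalg])

lemma measurable_F_mono: "m \<le> n \<Longrightarrow> f \<in> borel_measurable (F m) \<Longrightarrow> f \<in> borel_measurable (F n)"
  by (rule measurable_from_subalg) (auto simp: subalgebra_def sets_F_mono)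

text \<open>A martingale each of whose members is measurable for its own \<open>\<sigma>\<close>-algebra, not only up to a
  null set. Hitting times need this exact form.\<close>

definition adapted_martingale :: "(nat \<Rightarrow> 'a \<Rightarrow> real) \<Rightarrow> bool" where
  "adapted_martingale g \<longleftrightarrow> martingale M F g \<and> (\<forall>n. g n \<in> borel_measurable (F n))"

lemma adapted_martingaleD:
  assumes "adapted_martingale g"
  shows "integrable M (g n)" "AE x in M. real_cond_exp M (F n) (g (Suc n)) x = g n x"
    "g n \<in> borel_measurable (F n)" "g n \<in> borel_measurable M"
  using assms measurable_F_imp_M unfolding adapted_martingale_def martingale_def by auto

lemma martingale_adapted_version:
  assumes f: "martingale M F f"
  obtains g where "adapted_martingale g" "\<And>n. AE x in M. g n x = f n x"
proof
  define g where "g n = real_cond_exp M (F n) (f (Suc n))" for n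
  have f_int: "integrable M (f n)" and f_mart: "AE x in M. g n x = f n x" for n
    using f unfolding martingale_def g_def by auto
  then show "AE x in M. g n x = f n x" for n by blast
  have g_meas: "g n \<in> borel_measurable (F n)" for n unfolding g_def by simp
  have g_int: "integrable M (g n)" for n
    unfolding g_def
    by (rule sigma_finite_subalgebra.real_cond_exp_int[OF sigma_finite_subalgebra_F f_int])
  have "AE x in M. real_cond_exp M (F n) (g (Suc n)) x = g n x" for n
    unfolding g_def[of n] using g_int f_int
    by (intro sigma_finite_subalgebra.real_cond_exp_cong[OF sigma_finite_subalgebra_F] f_mart) auto
  then show "adapted_martingale g"
    unfolding adapted_martingale_def martingale_def using g_int g_meas by blast
qed

lemma adapted_martingale_diff:
  assumes f: "adapted_martingale f" and g: "adapted_martingale g"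
  shows "adapted_martingale (\<lambda>n x. f n x - g n x)"
proof -
  have "AE x in M. real_cond_exp M (F n) (\<lambda>x. f (Suc n) x - g (Suc n) x) x = f n x - g n x" for n
    using sigma_finite_subalgebra.real_cond_exp_diff[OF sigma_finite_subalgebra_F
        adapted_martingaleD(1)[OF f, of "Suc n"] adapted_martingaleD(1)[OF g, of "Suc n"], of n]
      adapted_martingaleD(2)[OF f, of n] adapted_martingaleD(2)[OF g, of n]
    by eventually_elim simp
  then show ?thesis
    using adapted_martingaleD[OF f] adapted_martingaleD[OF g]
    unfolding adapted_martingale_def martingale_def by auto
qed

lemma martingale_integral_eq:
  assumes g: "adapted_martingale g" and h: "h \<in> borel_measurable (F m)"
    and int: "\<And>n. integrable M (\<lambda>x. h x * g n x)" and "m \<le> n"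
  shows "(\<integral>x. h x * g n x \<partial>M) = (\<integral>x. h x * g m x \<partial>M)"
  using \<open>m \<le> n\<close>
proof (induction n rule: dec_induct)
  case (step n)
  have hn: "h \<in> borel_measurable (F n)" by (rule measurable_F_mono[OF _ h]) fact
  have "(\<integral>x. h x * g (Suc n) x \<partial>M) = (\<integral>x. h x * real_cond_exp M (F n) (g (Suc n)) x \<partial>M)"
    using int[of "Suc n"] hn adapted_martingaleD(4)[OF g, of "Suc n"]
    by (intro sigma_finite_subalgebra.real_cond_exp_intg(2)[OF sigma_finite_subalgebra_F, symmetric])
  also have "\<dots> = (\<integral>x. h x * g n x \<partial>M)"
  proof (rule integral_cong_AE)
    show "AE x in M. h x * real_cond_exp M (F n) (g (Suc n)) x = h x * g n x"
      using adapted_martingaleD(2)[OF g, of n] by eventually_elim simp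
    show "(\<lambda>x. h x * real_cond_exp M (F n) (g (Suc n)) x) \<in> borel_measurable M"
      "(\<lambda>x. h x * g n x) \<in> borel_measurable M"
      using measurable_F_imp_M[OF h] adapted_martingaleD(4)[OF g, of n] by auto
  qed
  finally show ?case using step by simp
qed simp

lemma martingale_increment_L2:
  assumes g: "adapted_martingale g" and bd: "\<And>n. AE x in M. \<bar>g n x\<bar> \<le> C n" and "m \<le> n"
  shows "(\<integral>x. (g n x - g m x)\<^sup>2 \<partial>M) = (\<integral>x. (g n x)\<^sup>2 \<partial>M) - (\<integral>x. (g m x)\<^sup>2 \<partial>M)"
    "integrable M (\<lambda>x. (g n x - g m x)\<^sup>2)"
proof -
  have [measurable]: "g k \<in> borel_measurable M" for k using adapted_martingaleD(4)[OF g] .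
  have int: "integrable M (\<lambda>x. g i x * g j x)" for i j
  proof (rule integrable_const_bound[where B = "\<bar>C i\<bar> * \<bar>C j\<bar>"])
    show "AE x in M. norm (g i x * g j x) \<le> \<bar>C i\<bar> * \<bar>C j\<bar>"
      using bd[of i] bd[of j] by eventually_elim (auto simp: abs_mult intro!: mult_mono)
  qed measurable
  have *: "(\<integral>x. g m x * g n x \<partial>M) = (\<integral>x. g m x * g m x \<partial>M)"
    by (rule martingale_integral_eq[OF g adapted_martingaleD(3)[OF g] int \<open>m \<le> n\<close>])
  have eq: "(g n x - g m x)\<^sup>2 = g n x * g n x - 2 * (g m x * g n x) + g m x * g m x" for x
    by (simp add: power2_eq_square algebra_simps)
  show "integrable M (\<lambda>x. (g n x - g m x)\<^sup>2)" unfolding eq using int by simp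
  show "(\<integral>x. (g n x - g m x)\<^sup>2 \<partial>M) = (\<integral>x. (g n x)\<^sup>2 \<partial>M) - (\<integral>x. (g m x)\<^sup>2 \<partial>M)"
    unfolding eq using int * by (simp add: power2_eq_square)
qed

lemma martingale_integral_indicator_eq:
  assumes g: "adapted_martingale g" and A: "A \<in> sets (F m)" and "m \<le> n"
  shows "(\<integral>x. indicator A x * g n x \<partial>M) = (\<integral>x. indicator A x * g m x \<partial>M)"
  using integrable_real_mult_indicator[OF sets_F_imp_M[OF A] adapted_martingaleD(1)[OF g]] A
  by (intro martingale_integral_eq[OF g _ _ \<open>m \<le> n\<close>]) (auto simp: mult.commute)

text \<open>By orthogonality of increments \<open>\<integral> g\<^sub>n\<^sup>2\<close> increases to a limit, so a subsequence has
  \<open>L\<^sub>2\<close>-increments of size \<open>2\<^sup>-\<^sup>k\<close>. Its telescoping series converges absolutely in \<open>L\<^sub>1\<close>, and the sum is the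
  closing function.\<close>

lemma L2_bounded_martingale_closed:
  assumes g: "adapted_martingale g" and bd: "\<And>n. AE x in M. \<bar>g n x\<bar> \<le> C n"
    and L2: "\<And>n. (\<integral>x. (g n x)\<^sup>2 \<partial>M) \<le> E"
  obtains a where "integrable M a" "\<And>n. AE x in M. real_cond_exp M (F n) a x = g n x"
proof -
  have [measurable]: "g k \<in> borel_measurable M" for k using adapted_martingaleD(4)[OF g] .
  have g_int: "integrable M (g k)" for k using adapted_martingaleD(1)[OF g] .
  define e where "e n = (\<integral>x. (g n x)\<^sup>2 \<partial>M)" for n
  have inc: "(\<integral>x. (g n x - g m x)\<^sup>2 \<partial>M) = e n - e m" if "m \<le> n" for m n
    unfolding e_def using martingale_increment_L2(1)[OF g bd that] .
  have "incseq e"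
  proof (rule incseq_SucI)
    fix n
    have "0 \<le> (\<integral>x. (g (Suc n) x - g n x)\<^sup>2 \<partial>M)" by simp
    then show "e n \<le> e (Suc n)" by (simp add: inc)
  qed
  then obtain L where L: "e \<longlonglongrightarrow> L" "\<And>n. e n \<le> L"
    using incseq_convergent[of e E] L2 unfolding e_def by blast
  have "\<exists>N. L - e N < (1 / 4) ^ k" for k :: nat
  proof -
    have "\<forall>\<^sub>F n in sequentially. L - (1 / 4) ^ k < e n"
      by (rule order_tendstoD(1)[OF L(1)]) simp
    then show ?thesis by (auto simp: eventually_sequentially less_diff_eq diff_less_eq add.commute)
  qed
  then obtain r0 where r0: "L - e (r0 k) < (1 / 4) ^ k" for k by metis
  \<comment> \<open>The partial sums turn the indices \<open>r0 k\<close> into an increasing sequence that tends to infinity.\<close>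
  define r where "r k = k + (\<Sum>j\<le>k. r0 j)" for k
  have r_Suc: "r k \<le> r (Suc k)" for k unfolding r_def by simp
  have "r0 k \<le> (\<Sum>j\<le>k. r0 j)" for k by (rule member_le_sum) auto
  then have r0_le: "r0 k \<le> r k" for k unfolding r_def by (simp add: trans_le_add2)
  have e_r: "e (r (Suc k)) - e (r k) < (1 / 4) ^ k" for k
    using r0[of k] L(2)[of "r (Suc k)"] incseqD[OF \<open>incseq e\<close> r0_le[of k]] by linarith
  define d where "d k x = g (r (Suc k)) x - g (r k) x" for k x
  have d_int: "integrable M (d k)" for k unfolding d_def using g_int by simp
  have [measurable]: "d k \<in> borel_measurable M" for k using d_int by auto
  have d_L1: "(\<integral>x. \<bar>d k x\<bar> \<partial>M) \<le> 2 * (1 / 2) ^ k" for k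
  proof -
    have sq: "integrable M (\<lambda>x. (d k x)\<^sup>2)"
      unfolding d_def using martingale_increment_L2(2)[OF g bd r_Suc] .
    have "(\<integral>x. \<bar>d k x\<bar> \<partial>M) \<le> (\<integral>x. 2 ^ k * (d k x)\<^sup>2 + (1 / 2) ^ k \<partial>M)"
    proof (rule integral_mono)
      fix x
      \<comment> \<open>\<open>\<bar>d\<bar> \<le> 2\<^sup>k d\<^sup>2 + 2\<^sup>-\<^sup>k\<close> replaces the Cauchy-Schwarz inequality.\<close>
      have "0 \<le> (2 ^ k * \<bar>d k x\<bar> - 1)\<^sup>2" by simp
      then have "2 ^ k * (2 * \<bar>d k x\<bar>) \<le> 2 ^ k * (2 ^ k * (d k x)\<^sup>2 + (1 / 2) ^ k)"
        by (simp add: power2_eq_square algebra_simps power_one_over)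
      then have "2 * \<bar>d k x\<bar> \<le> 2 ^ k * (d k x)\<^sup>2 + (1 / 2) ^ k" by (simp only: mult_le_cancel_left) simp
      then show "\<bar>d k x\<bar> \<le> 2 ^ k * (d k x)\<^sup>2 + (1 / 2) ^ k" by simp
    qed (use d_int sq in auto)
    also have "\<dots> = 2 ^ k * (e (r (Suc k)) - e (r k)) + (1 / 2) ^ k"
      using sq inc[OF r_Suc[of k]] by (simp add: prob_space d_def)
    also have "\<dots> \<le> 2 ^ k * (1 / 4) ^ k + (1 / 2) ^ k"
      using e_r[of k] by (intro add_mono mult_left_mono) auto
    also have "(2::real) ^ k * (1 / 4) ^ k = (1 / 2) ^ k" by (simp add: power_mult_distrib[symmetric])
    finally show ?thesis by simp
  qed
  have summ_L1: "summable (\<lambda>k. \<integral>x. \<bar>d k x\<bar> \<partial>M)"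
    by (rule summable_comparison_test'[where g = "\<lambda>k. 2 * (1 / 2) ^ k" and N = 0])
      (use d_L1 in \<open>auto intro!: summable_mult summable_geometric\<close>)
  have AE_summ: "AE x in M. summable (\<lambda>k. \<bar>d k x\<bar>)"
  proof -
    have "(\<integral>\<^sup>+x. (\<Sum>k. ennreal \<bar>d k x\<bar>) \<partial>M) = (\<Sum>k. \<integral>\<^sup>+x. ennreal \<bar>d k x\<bar> \<partial>M)"
      by (intro nn_integral_suminf) measurable
    also have "\<dots> = (\<Sum>k. ennreal (\<integral>x. \<bar>d k x\<bar> \<partial>M))"
      by (intro suminf_cong nn_integral_eq_integral integrable_abs d_int AE_I2 abs_ge_zero)
    also have "\<dots> \<noteq> \<infinity>"
      unfolding infinity_ennreal_def by (rule ennreal_suminf_neq_top[OF summ_L1]) simp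
    finally have "AE x in M. (\<Sum>k. ennreal \<bar>d k x\<bar>) \<noteq> \<infinity>"
      by (intro nn_integral_PInf_AE) measurable
    then show ?thesis by eventually_elim (auto intro: summable_suminf_not_top)
  qed
  define a where "a x = g (r 0) x + (\<Sum>k. d k x)" for x
  have sum_int: "integrable M (\<lambda>x. \<Sum>k. d k x)"
    using d_int AE_summ summ_L1 by (intro integrable_suminf) auto
  then have a_int: "integrable M a" unfolding a_def using g_int by simp
  have "AE x in M. real_cond_exp M (F n) a x = g n x" for n
  proof (rule sigma_finite_subalgebra.real_cond_exp_charact[OF sigma_finite_subalgebra_F])
    fix A assume A: "A \<in> sets (F n)"
    have [measurable]: "A \<in> sets M" by (rule sets_F_imp_M[OF A])
    have Ad_int: "integrable M (\<lambda>x. indicator A x * d k x)" for k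
      using integrable_real_mult_indicator[OF _ d_int, of A] by (simp add: mult.commute)
    have Ag_int: "integrable M (\<lambda>x. indicator A x * g k x)" for k
      using integrable_real_mult_indicator[OF _ g_int, of A] by (simp add: mult.commute)
    have "(\<lambda>k. \<integral>x. indicator A x * d k x \<partial>M) sums (\<integral>x. (\<Sum>k. indicator A x * d k x) \<partial>M)"
    proof (rule sums_integral)
      show "AE x in M. summable (\<lambda>k. norm (indicator A x * d k x))"
        using AE_summ by eventually_elim (auto simp: abs_mult intro: summable_mult)
      show "summable (\<lambda>k. \<integral>x. norm (indicator A x * d k x) \<partial>M)"
      proof (rule summable_comparison_test'[OF summ_L1, where N = 0])
        fix k
        have "(\<integral>x. norm (indicator A x * d k x) \<partial>M) \<le> (\<integral>x. \<bar>d k x\<bar> \<partial>M)"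
          by (intro integral_mono integrable_norm integrable_abs Ad_int d_int)
            (auto split: split_indicator)
        then show "norm (\<integral>x. norm (indicator A x * d k x) \<partial>M) \<le> (\<integral>x. \<bar>d k x\<bar> \<partial>M)"
          by simp
      qed
    qed (rule Ad_int)
    moreover have "(\<lambda>k. \<integral>x. indicator A x * d k x \<partial>M) sums
        ((\<integral>x. indicator A x * g n x \<partial>M) - (\<integral>x. indicator A x * g (r 0) x \<partial>M))"
    proof -
      have "(\<lambda>k. \<integral>x. indicator A x * g (r k) x \<partial>M) \<longlonglongrightarrow> (\<integral>x. indicator A x * g n x \<partial>M)"
      proof (rule tendsto_eventually, rule eventually_sequentiallyI[of n])
        fix k assume "n \<le> k"
        then have "n \<le> r k" unfolding r_def by simp
        then show "(\<integral>x. indicator A x * g (r k) x \<partial>M) = (\<integral>x. indicator A x * g n x \<partial>M)"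
          by (rule martingale_integral_indicator_eq[OF g A])
      qed
      from telescope_sums[OF this] show ?thesis
        using Ag_int by (simp add: d_def right_diff_distrib)
    qed
    ultimately have "(\<integral>x. (\<Sum>k. indicator A x * d k x) \<partial>M)
        = (\<integral>x. indicator A x * g n x \<partial>M) - (\<integral>x. indicator A x * g (r 0) x \<partial>M)"
      by (rule sums_unique2)
    moreover have "(\<integral>x. (\<Sum>k. indicator A x * d k x) \<partial>M) = (\<integral>x. indicator A x * (\<Sum>k. d k x) \<partial>M)"
    proof (rule integral_cong_AE)
      show "AE x in M. (\<Sum>k. indicator A x * d k x) = indicator A x * (\<Sum>k. d k x)"
        using AE_summ by eventually_elim (auto intro!: suminf_mult summable_rabs_cancel)
    qed measurable
    moreover have "(\<integral>x. indicator A x * a x \<partial>M)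
        = (\<integral>x. indicator A x * g (r 0) x \<partial>M) + (\<integral>x. indicator A x * (\<Sum>k. d k x) \<partial>M)"
      unfolding a_def using Ag_int integrable_real_mult_indicator[OF _ sum_int, of A]
      by (simp add: distrib_left mult.commute)
    ultimately show "(\<integral>x\<in>A. a x \<partial>M) = (\<integral>x\<in>A. g n x \<partial>M)"
      by (simp add: set_lebesgue_integral_def)
  qed (use a_int g_int adapted_martingaleD(3)[OF g] in auto)
  with a_int show thesis by (rule that)
qed

lemma adapted_martingale_stopped:
  assumes g: "adapted_martingale g" and \<tau>: "ext_stopping_time M F \<tau>"
  shows "adapted_martingale (stopped \<tau> g)"
proof -
  define A where "A n = {x \<in> space M. enat (Suc n) \<le> \<tau> x}" for n
  have A_F: "A n \<in> sets (F n)" for n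
  proof -
    have "A n = space (F n) - {x \<in> space M. \<tau> x \<le> enat n}"
      unfolding A_def by (auto simp: Suc_ile_eq)
    then show ?thesis using \<tau> unfolding ext_stopping_time_def by (metis sets.compl_sets)
  qed
  have step: "stopped \<tau> g (Suc n) x = stopped \<tau> g n x + indicator (A n) x * (g (Suc n) x - g n x)"
    if "x \<in> space M" for n x
  proof (cases "enat (Suc n) \<le> \<tau> x")
    case True
    then have "enat n \<le> \<tau> x" by (metis Suc_ile_eq less_imp_le)
    with True that show ?thesis by (simp add: stopped_def stop_index_eq A_def)
  next
    case False
    then show ?thesis by (simp add: stopped_def stop_index_Suc A_def)
  qed
  note gD = adapted_martingaleD[OF g]
  have meas: "stopped \<tau> g n \<in> borel_measurable (F n)" for n
  proof (induction n)
    case (Suc n)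
    have [measurable]: "stopped \<tau> g n \<in> borel_measurable (F (Suc n))" "g n \<in> borel_measurable (F (Suc n))"
      "g (Suc n) \<in> borel_measurable (F (Suc n))" "A n \<in> sets (F (Suc n))"
      using measurable_F_mono[of n "Suc n"] Suc gD(3) sets_F_mono[of n "Suc n"] A_F by auto
    have "(\<lambda>x. stopped \<tau> g n x + indicator (A n) x * (g (Suc n) x - g n x)) \<in> borel_measurable (F (Suc n))"
      by measurable
    then show ?case by (subst measurable_cong[OF step]) auto
  qed (use gD(3) in simp)
  have d_int: "integrable M (\<lambda>x. indicator (A n) x * (g (Suc n) x - g n x))" for n
    using integrable_real_mult_indicator[OF sets_F_imp_M[OF A_F], of "\<lambda>x. g (Suc n) x - g n x" n] gD(1)
    by (simp add: mult.commute)
  have int: "integrable M (stopped \<tau> g n)" for n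
  proof (induction n)
    case (Suc n)
    have "integrable M (\<lambda>x. stopped \<tau> g n x + indicator (A n) x * (g (Suc n) x - g n x))"
      using Suc d_int by simp
    then show ?case by (subst Bochner_Integration.integrable_cong[OF refl step])
  qed (use gD(1) in simp)
  have "AE x in M. real_cond_exp M (F n) (stopped \<tau> g (Suc n)) x = stopped \<tau> g n x" for n
  proof -
    interpret G: sigma_finite_subalgebra M "F n" by (rule sigma_finite_subalgebra_F)
    have [measurable]: "stopped \<tau> g k \<in> borel_measurable M" "g k \<in> borel_measurable M" "A k \<in> sets M" for k
      using int gD(1) sets_F_imp_M[OF A_F] by auto
    have 1: "AE x in M. real_cond_exp M (F n) (stopped \<tau> g (Suc n)) x
        = real_cond_exp M (F n) (\<lambda>x. stopped \<tau> g n x + indicator (A n) x * (g (Suc n) x - g n x)) x"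
      by (intro G.real_cond_exp_cong AE_I2 step) measurable
    have 2: "AE x in M. real_cond_exp M (F n)
          (\<lambda>x. stopped \<tau> g n x + indicator (A n) x * (g (Suc n) x - g n x)) x
        = real_cond_exp M (F n) (stopped \<tau> g n) x
          + real_cond_exp M (F n) (\<lambda>x. indicator (A n) x * (g (Suc n) x - g n x)) x"
      by (intro G.real_cond_exp_add int d_int)
    have 3: "AE x in M. real_cond_exp M (F n) (stopped \<tau> g n) x = stopped \<tau> g n x"
      by (intro G.real_cond_exp_F_meas int meas)
    have 4: "AE x in M. real_cond_exp M (F n) (\<lambda>x. indicator (A n) x * (g (Suc n) x - g n x)) x
        = indicator (A n) x * real_cond_exp M (F n) (\<lambda>x. g (Suc n) x - g n x) x"
      using A_F d_int by (intro G.real_cond_exp_mult) auto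
    have 5: "AE x in M. real_cond_exp M (F n) (\<lambda>x. g (Suc n) x - g n x) x
        = real_cond_exp M (F n) (g (Suc n)) x - real_cond_exp M (F n) (g n) x"
      by (intro G.real_cond_exp_diff gD)
    have 6: "AE x in M. real_cond_exp M (F n) (g n) x = g n x"
      by (intro G.real_cond_exp_F_meas gD)
    from 1 2 3 4 5 6 gD(2)[of n] show ?thesis by eventually_elim simp
  qed
  with int meas show ?thesis unfolding adapted_martingale_def martingale_def by blast
qed

end

section \<open>Atoms of the filtration and their hulls\<close>

lemma sigma_atom_subset:
  assumes "finite_measure M" "sets G \<subseteq> sets M" "sigma_atom M G B" "A \<in> sets G" "A \<subseteq> B"
  shows "sigma_atom M G A"
proof -
  have "measure M A \<le> measure M B"
    using assms by (intro finite_measure.finite_measure_mono) (auto simp: sigma_atom_def)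
  show ?thesis unfolding sigma_atom_def
  proof (intro conjI ballI impI)
    fix C assume C: "C \<in> sets G" "C \<subseteq> A" "measure M C < measure M A"
    then have "C \<subseteq> B" "measure M C < measure M B"
      using assms \<open>measure M A \<le> measure M B\<close> by auto
    then show "measure M C = 0" using assms C unfolding sigma_atom_def by blast
  qed fact
qed

text \<open>A \<open>\<sigma>\<close>-algebra generated by countably many atoms is exhausted by a disjoint sequence of atoms, some
  of which may be null or empty. The part of the space not covered by the generators is itself an atom:
  every set of the generated \<open>\<sigma>\<close>-algebra contains it or is disjoint from it.\<close>

lemma atomic_partition:
  assumes sub: "subalgebra M G" and \<C>: "countable \<C>" "\<forall>B \<in> \<C>. sigma_atom M G B"
    and gen: "generated_by M G \<C>" and fin: "finite_measure M"
  obtains D :: "nat \<Rightarrow> 'a set"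
  where "disjoint_family D" "(\<Union>i. D i) = space M" "\<And>i. sigma_atom M G (D i)"
proof -
  interpret finite_measure M by fact
  have spG: "space G = space M" and setsG: "sets G \<subseteq> sets M"
    using sub by (auto simp: subalgebra_def)
  have \<C>_G: "\<C> \<subseteq> sets G" using \<C> by (auto simp: sigma_atom_def)
  define N where "N = space M - \<Union>\<C>"
  have N_G: "N \<in> sets G"
    unfolding N_def spG[symmetric] using \<C> \<C>_G by (intro sets.compl_sets sets.countable_Union) auto
  have dich: "N \<subseteq> B \<or> N \<inter> B = {}" if "B \<in> sigma_sets (space M) \<C>" for B
    using that
  proof induction
    case (Basic a)
    then show ?case unfolding N_def by auto
  next
    case Empty
    then show ?case by auto
  next
    case (Compl a)
    then show ?case unfolding N_def by auto
  next
    case (Union a)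
    then show ?case by auto
  qed
  have N_atom: "sigma_atom M G N"
    unfolding sigma_atom_def
  proof (intro conjI N_G ballI impI)
    fix A assume A: "A \<in> sets G" "A \<subseteq> N" "measure M A < measure M N"
    then obtain B where B: "B \<in> sigma_sets (space M) \<C>" "(A - B) \<union> (B - A) \<in> null_sets M"
      using gen unfolding generated_by_def by auto
    have [measurable]: "A \<in> sets M" "N \<in> sets M" "B \<in> sets M"
      using A N_G B setsG gen unfolding generated_by_def by auto
    have AE_AB: "AE x in M. x \<in> A \<longleftrightarrow> x \<in> B"
      using AE_not_in[OF B(2)] by eventually_elim auto
    show "measure M A = 0"
    proof (cases "N \<subseteq> B")
      case True
      have "measure M A = measure M N"
        by (rule finite_measure_eq_AE, use AE_AB in eventually_elim) (use True A in auto)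
      with A show ?thesis by simp
    next
      case False
      then have "N \<inter> B = {}" using dich B by auto
      have "measure M A = measure M {}"
        by (rule finite_measure_eq_AE, use AE_AB in eventually_elim) (use A \<open>N \<inter> B = {}\<close> in auto)
      then show ?thesis by simp
    qed
  qed
  define E where "E = from_nat_into (insert N \<C>)"
  have E: "range E = insert N \<C>" unfolding E_def using \<C> by (intro range_from_nat_into) auto
  have E_atom: "sigma_atom M G (E i)" for i
    using E \<C> N_atom by (metis insertE rangeI)
  have E_G: "range E \<subseteq> sets G" using E \<C>_G N_G by simp
  show thesis
  proof
    show "disjoint_family (disjointed E)" by (rule disjoint_family_disjointed)
    have "\<Union>\<C> \<subseteq> space M" using \<C>_G spG sets.sets_into_space by blast
    then show "(\<Union>i. disjointed E i) = space M"
      unfolding UN_disjointed_eq using E by (auto simp: N_def)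
    show "sigma_atom M G (disjointed E i)" for i
    proof (rule sigma_atom_subset[OF fin setsG E_atom[of i]])
      show "disjointed E i \<in> sets G" using sets.range_disjointed_sets[OF E_G] by auto
    qed (rule disjointed_subset)
  qed
qed

text \<open>The first \<open>n\<close> with \<open>x \<in> U\<^sub>n\<close>; it is \<open>\<infinity>\<close> if there is none, since the infimum of
  the empty set of extended naturals is \<open>\<infinity>\<close>.\<close>

definition hitting_time :: "(nat \<Rightarrow> 'a set) \<Rightarrow> 'a \<Rightarrow> enat" where
  "hitting_time U x = (INF n \<in> {n. x \<in> U n}. enat n)"

lemma hitting_time_ge_iff: "enat n \<le> hitting_time U x \<longleftrightarrow> (\<forall>m<n. x \<notin> U m)"
  unfolding hitting_time_def le_INF_iff by (auto simp: not_less[symmetric])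

lemma hitting_time_less_infinity_iff: "hitting_time U x < \<infinity> \<longleftrightarrow> (\<exists>n. x \<in> U n)"
  unfolding hitting_time_def INF_less_iff by auto

lemma hitting_time_le_iff: "hitting_time U x \<le> enat n \<longleftrightarrow> (\<exists>m\<le>n. x \<in> U m)"
proof -
  have "hitting_time U x \<le> enat n \<longleftrightarrow> \<not> enat (Suc n) \<le> hitting_time U x"
    by (simp add: not_le Suc_ile_eq) (metis Suc_ile_eq not_le)
  then show ?thesis by (auto simp: hitting_time_ge_iff less_Suc_eq_le)
qed

lemma hitting_time_antimono: "(\<And>n. U n \<subseteq> V n) \<Longrightarrow> hitting_time V x \<le> hitting_time U x"
  unfolding hitting_time_def by (intro INF_superset_mono) auto

text \<open>The hypotheses on filtration and exponent in the form in which they are used: for each \<open>n\<close> a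
  partition \<open>D n\<close> of the space into atoms of \<open>F n\<close>, the regularity constant \<open>R\<close>, and the exponent
  condition with constant \<open>K\<close> on the atoms of positive measure, where \<open>a\<close> and \<open>b\<close> are essential bounds of
  \<open>p\<close> on the atom and \<open>pp\<close> bounds their difference.\<close>

locale regular_atomic = variable_exponent M p pm + filtered_prob_space M F
  for M :: "'a measure" and p :: "'a \<Rightarrow> real" and pm :: real and F :: "nat \<Rightarrow> 'a measure" +
  fixes D :: "nat \<Rightarrow> nat \<Rightarrow> 'a set" and R K pp :: real
  assumes D_disjoint: "\<And>n. disjoint_family (D n)" and D_UN: "\<And>n. (\<Union>i. D n i) = space M"
    and D_atom: "\<And>n i. sigma_atom M (F n) (D n i)"
    and R_ge_1: "1 \<le> R"
    and regular: "\<And>n A. A \<in> sets (F (Suc n)) \<Longrightarrow>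
      \<exists>B \<in> sets (F n). A \<subseteq> B \<and> measure M B \<le> R * measure M A"
    and pp_nonneg: "0 \<le> pp"
    and K_ge_1: "1 \<le> K"
    and exponent: "\<And>n i. 0 < measure M (D n i) \<Longrightarrow> \<exists>a b. a \<le> b \<and> b - a \<le> pp \<and>
      measure M (D n i) powr (a - b) \<le> K \<and> (AE x in M. x \<in> D n i \<longrightarrow> a \<le> p x \<and> p x \<le> b)"
begin

lemma D_F: "D n i \<in> sets (F n)" using D_atom by (simp add: sigma_atom_def)

lemma D_M [measurable]: "D n i \<in> sets M" using D_F sets_F_imp_M by blast

lemma atom_null_or_full:
  "A \<in> sets (F n) \<Longrightarrow> A \<subseteq> D n i \<Longrightarrow> measure M A = 0 \<or> measure M A = measure M (D n i)"
  using D_atom[of n i] finite_measure_mono[of A "D n i"] unfolding sigma_atom_def by force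

lemma regular_atom:
  assumes A: "A \<in> sets (F (Suc n))" and pos: "0 < measure M (D n i \<inter> A)"
  shows "measure M (D n i) \<le> R * measure M (D n i \<inter> A)"
proof -
  have "D n i \<inter> A \<in> sets (F (Suc n))" using A D_F[of n i] sets_F_mono[of n "Suc n"] by auto
  then obtain B where B: "B \<in> sets (F n)" "D n i \<inter> A \<subseteq> B" "measure M B \<le> R * measure M (D n i \<inter> A)"
    using regular by blast
  have BM: "B \<in> sets M" using B sets_F_imp_M by auto
  have "measure M (D n i \<inter> A) \<le> measure M (B \<inter> D n i)"
    using B BM by (intro finite_measure_mono) auto
  then have "measure M (B \<inter> D n i) = measure M (D n i)"
    using atom_null_or_full[of "B \<inter> D n i" n i] B D_F pos by auto
  then have "measure M (D n i) \<le> measure M B"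
    using finite_measure_mono[of "B \<inter> D n i" B] BM by auto
  with B show ?thesis by simp
qed

text \<open>The union of the atoms of \<open>F n\<close> that meet \<open>A\<close> in positive measure. Up to a null set it is the
  smallest set of \<open>F n\<close> containing \<open>A\<close>. Unlike an arbitrary cover provided by regularity, it is monotone in
  \<open>A\<close> and can be estimated on each atom separately.\<close>

definition atom_hull :: "nat \<Rightarrow> 'a set \<Rightarrow> 'a set" where
  "atom_hull n A = (\<Union>i \<in> {i. 0 < measure M (D n i \<inter> A)}. D n i)"

lemma atom_hull_F: "atom_hull n A \<in> sets (F n)"
  unfolding atom_hull_def using D_F by (intro sets.countable_UN'') auto

lemma atom_hull_mono: "A \<subseteq> B \<Longrightarrow> B \<in> sets M \<Longrightarrow> atom_hull n A \<subseteq> atom_hull n B"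
  unfolding atom_hull_def
  by (intro UN_mono subset_refl Collect_mono impI, erule less_le_trans, intro finite_measure_mono) auto

lemma AE_in_atom_hull:
  assumes [measurable]: "A \<in> sets M"
  shows "AE x in M. x \<in> A \<longrightarrow> x \<in> atom_hull n A"
proof -
  have "AE x in M. measure M (D n i \<inter> A) = 0 \<longrightarrow> x \<notin> D n i \<inter> A" for i
  proof (cases "measure M (D n i \<inter> A) = 0")
    case True
    then have "D n i \<inter> A \<in> null_sets M" by (simp add: null_sets_def emeasure_eq_measure)
    then show ?thesis by (rule AE_mp[OF AE_not_in]) simp
  qed simp
  then have "AE x in M. \<forall>i. measure M (D n i \<inter> A) = 0 \<longrightarrow> x \<notin> D n i \<inter> A"
    by (simp add: AE_all_countable)
  with AE_space show ?thesis
  proof eventually_elim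
    case (elim x)
    show ?case
    proof
      assume "x \<in> A"
      obtain i where "x \<in> D n i" using elim(1) D_UN[of n] by blast
      with elim \<open>x \<in> A\<close> show "x \<in> atom_hull n A"
        unfolding atom_hull_def by (auto simp: zero_less_measure_iff)
    qed
  qed
qed

text \<open>The set \<open>D n i \<inter> A k\<close> is null or has at least the fraction \<open>1/R\<close> of the measure of
  \<open>D n i\<close>; the second alternative fails for large \<open>k\<close>.\<close>

lemma not_in_atom_hull_eventually:
  assumes A: "\<And>k::nat. A k \<in> sets (F (Suc n))" and "decseq A" "(\<Inter>k. A k) = {}"
    and "x \<in> space M"
  shows "\<exists>k. x \<notin> atom_hull n (A k)"
proof -
  obtain i where i: "x \<in> D n i" using assms(4) D_UN[of n] by blast
  have uniq: "j = i" if "x \<in> D n j" for j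
    using D_disjoint[of n] i that unfolding disjoint_family_on_def by blast
  show ?thesis
  proof (cases "measure M (D n i) = 0")
    case True
    have "measure M (D n i \<inter> A 0) \<le> measure M (D n i)"
      by (intro finite_measure_mono) auto
    then have "x \<notin> atom_hull n (A 0)"
      unfolding atom_hull_def using uniq True by (auto simp: dest!: uniq)
    then show ?thesis by blast
  next
    case False
    then have pos: "0 < measure M (D n i) / R" using R_ge_1 by (simp add: zero_less_measure_iff)
    have "(\<lambda>k. measure M (D n i \<inter> A k)) \<longlonglongrightarrow> measure M (\<Inter>k. D n i \<inter> A k)"
      using A sets_F_imp_M \<open>decseq A\<close>
      by (intro finite_Lim_measure_decseq) (auto simp: decseq_def, blast)
    also have "(\<Inter>k. D n i \<inter> A k) = {}" using assms(3) by auto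
    finally have "\<forall>\<^sub>F k in sequentially. measure M (D n i \<inter> A k) < measure M (D n i) / R"
      using pos by (auto dest: order_tendstoD)
    then obtain k where k: "measure M (D n i \<inter> A k) < measure M (D n i) / R"
      by (auto simp: eventually_sequentially)
    have "\<not> 0 < measure M (D n i \<inter> A k)"
      using regular_atom[OF A[of k], of i] k R_ge_1 by (auto simp: field_simps)
    then have "x \<notin> atom_hull n (A k)"
      unfolding atom_hull_def by (auto dest!: uniq)
    then show ?thesis by blast
  qed
qed

text \<open>The factor by which a modular grows at most when a set is replaced by its hull.\<close>

definition comparison_const :: real where
  "comparison_const = R * (K * R powr pp) powr (1 / pm)"

lemma comparison_const_ge_1: "1 \<le> comparison_const"
proof -
  have "1 * 1 \<le> K * R powr pp"
    using R_ge_1 K_ge_1 pp_nonneg by (intro mult_mono ge_one_powr_ge_zero) auto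
  then have "1 * 1 \<le> R * (K * R powr pp) powr (1 / pm)"
    using R_ge_1 pm_pos by (intro mult_mono ge_one_powr_ge_zero) auto
  then show ?thesis by (simp add: comparison_const_def)
qed

text \<open>This is the only place where the exponent condition is used. A modular at most \<open>1\<close> forces
  \<open>c\<close> to be at least a power of \<open>P(D)\<close>, so that \<open>c\<close> to the power \<open>a - b\<close> is controlled by \<open>P(D)\<close> to the
  power \<open>a - b\<close>.\<close>

lemma modular_atom_le:
  assumes A: "A \<in> sets (F (Suc n))" and pos: "0 < measure M (D n i \<inter> A)"
    and c: "0 < c" "c \<le> 1" and mod: "modular c (D n i \<inter> A) \<le> 1"
  shows "modular c (D n i) \<le> ennreal comparison_const * modular c (D n i \<inter> A)"
proof -
  define m where "m = measure M (D n i)"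
  define C where "C = D n i \<inter> A"
  have C[measurable]: "C \<in> sets M" unfolding C_def by (intro sets.Int D_M sets_F_imp_M[OF A])
  have mC: "m \<le> R * measure M C" unfolding m_def C_def by (rule regular_atom[OF A pos])
  have "measure M C \<le> m" unfolding m_def C_def by (intro finite_measure_mono) auto
  then have m: "0 < m" using pos by (simp add: C_def)
  then obtain a b where ab: "a \<le> b" "b - a \<le> pp" "m powr (a - b) \<le> K"
    and p_ab: "AE x in M. x \<in> D n i \<longrightarrow> a \<le> p x \<and> p x \<le> b"
    using exponent[of n i] unfolding m_def by blast
  have ic: "1 \<le> 1 / c" using c by simp
  have "m / R \<le> c powr pm"
  proof -
    have "R * measure M C \<le> R * c powr pm"
      using measure_le_of_modular[OF C _ c] mod R_ge_1 by (intro mult_left_mono) (auto simp: C_def)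
    with mC have "m \<le> R * c powr pm" by (rule order_trans)
    then show ?thesis using R_ge_1 by (simp add: pos_divide_le_eq mult.commute)
  qed
  then have "(m / R) powr (1 / pm) \<le> (c powr pm) powr (1 / pm)"
    using m R_ge_1 pm_pos by (intro powr_mono2) auto
  then have "(m / R) powr (1 / pm) \<le> c" using pm_pos c by (simp add: powr_powr)
  then have "c powr (a - b) \<le> ((m / R) powr (1 / pm)) powr (a - b)"
    using ab m R_ge_1 by (intro powr_mono2') auto
  also have "\<dots> = ((m / R) powr (a - b)) powr (1 / pm)" by (simp add: powr_powr mult.commute)
  also have "(m / R) powr (a - b) = m powr (a - b) * R powr (b - a)"
    using m R_ge_1 powr_minus_divide[of R "a - b"] by (simp add: powr_divide)
  also have "(m powr (a - b) * R powr (b - a)) powr (1 / pm) \<le> (K * R powr pp) powr (1 / pm)"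
    using ab R_ge_1 K_ge_1 pm_pos by (intro powr_mono2 mult_mono powr_mono) auto
  finally have c_ab: "c powr (a - b) \<le> (K * R powr pp) powr (1 / pm)" .
  have "modular c (D n i) \<le> (\<integral>\<^sup>+x. ennreal ((1 / c) powr b) * indicator (D n i) x \<partial>M)"
    unfolding modular_def
  proof (rule nn_integral_mono_AE, use p_ab in eventually_elim)
    fix x assume *: "x \<in> D n i \<longrightarrow> a \<le> p x \<and> p x \<le> b"
    show "ennreal ((1 / c) powr p x) * indicator (D n i) x
        \<le> ennreal ((1 / c) powr b) * indicator (D n i) x"
      using * ic by (auto split: split_indicator intro!: ennreal_leI powr_mono)
  qed
  also have "\<dots> = ennreal ((1 / c) powr b * m)"
    by (simp add: nn_integral_cmult_indicator emeasure_eq_measure m_def ennreal_mult)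
  also have "\<dots> \<le> ennreal (comparison_const * ((1 / c) powr a * measure M C))"
  proof (rule ennreal_leI)
    have "(1 / c) powr b = c powr (a - b) * (1 / c) powr a"
      using c by (simp add: powr_divide powr_diff)
    also have "\<dots> \<le> (K * R powr pp) powr (1 / pm) * (1 / c) powr a"
      by (intro mult_right_mono c_ab) auto
    finally have "(1 / c) powr b * m
        \<le> ((K * R powr pp) powr (1 / pm) * (1 / c) powr a) * (R * measure M C)"
      using m mC by (intro mult_mono) auto
    then show "(1 / c) powr b * m \<le> comparison_const * ((1 / c) powr a * measure M C)"
      unfolding comparison_const_def by (simp add: mult_ac)
  qed
  also have "\<dots> = ennreal comparison_const * (\<integral>\<^sup>+x. ennreal ((1 / c) powr a) * indicator C x \<partial>M)"
    using R_ge_1 K_ge_1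
    by (simp add: nn_integral_cmult_indicator emeasure_eq_measure ennreal_mult comparison_const_def)
  also have "(\<integral>\<^sup>+x. ennreal ((1 / c) powr a) * indicator C x \<partial>M) \<le> modular c C"
    unfolding modular_def
  proof (rule nn_integral_mono_AE, use p_ab in eventually_elim)
    fix x assume *: "x \<in> D n i \<longrightarrow> a \<le> p x \<and> p x \<le> b"
    show "ennreal ((1 / c) powr a) * indicator C x \<le> ennreal ((1 / c) powr p x) * indicator C x"
      using * ic by (auto simp: C_def split: split_indicator intro!: ennreal_leI powr_mono)
  qed
  finally show ?thesis unfolding C_def by (simp add: mult_left_mono)
qed

text \<open>The hulls for different \<open>n\<close> overlap. They are made disjoint by \<open>V n = U n - (\<Union>m<n. U m)\<close>,
  which is again a union of atoms of \<open>F n\<close> up to a null set, so that the previous estimate applies on each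
  atom contained in \<open>V n\<close> and the pieces of \<open>E\<close> are counted only once.\<close>

lemma modular_atom_hulls_le:
  assumes A: "\<And>n. A n \<in> sets (F (Suc n))" "\<And>n. A n \<subseteq> E" and E[measurable]: "E \<in> sets M"
    and c: "0 < c" "c \<le> 1" and mod: "modular c E \<le> 1"
  shows "modular c (\<Union>n. atom_hull n (A n)) \<le> ennreal comparison_const"
proof -
  define U where "U n = atom_hull n (A n)" for n
  define V where "V = disjointed U"
  have V_disj: "disjoint_family V" unfolding V_def by (rule disjoint_family_disjointed)
  have V_F: "V n \<in> sets (F n)" for n
    unfolding V_def disjointed_def
    by (intro sets.Diff sets.finite_UN)
      (auto simp: U_def intro: atom_hull_F sets_F_mono[OF _ atom_hull_F])
  have V_M[measurable]: "V n \<in> sets M" for n using V_F sets_F_imp_M by blast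
  have V_U: "V n \<subseteq> U n" for n unfolding V_def by (rule disjointed_subset)
  have split: "modular c (\<Union>n. V n \<inter> X) = (\<Sum>n. \<Sum>i. modular c (V n \<inter> X \<inter> D n i))"
    if [measurable]: "X \<in> sets M" for X
  proof -
    have "modular c (\<Union>n. V n \<inter> X) = (\<Sum>n. modular c (V n \<inter> X))"
      using V_disj by (intro modular_UN_disjoint) (auto simp: disjoint_family_on_def)
    also have "\<dots> = (\<Sum>n. \<Sum>i. modular c (V n \<inter> X \<inter> D n i))"
    proof (intro suminf_cong)
      fix n
      have "V n \<inter> X = (\<Union>i. V n \<inter> X \<inter> D n i)"
        using D_UN[of n] sets.sets_into_space[OF V_M[of n]] by blast
      also have "modular c \<dots> = (\<Sum>i. modular c (V n \<inter> X \<inter> D n i))"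
        using D_disjoint[of n] by (intro modular_UN_disjoint) (auto simp: disjoint_family_on_def)
      finally show "modular c (V n \<inter> X) = (\<Sum>i. modular c (V n \<inter> X \<inter> D n i))" .
    qed
    finally show ?thesis .
  qed
  have piece: "modular c (V n \<inter> space M \<inter> D n i)
      \<le> ennreal comparison_const * modular c (V n \<inter> E \<inter> D n i)" for n i
  proof (cases "measure M (V n \<inter> D n i) = 0")
    case True
    then have "V n \<inter> D n i \<in> null_sets M" by (simp add: null_sets_def emeasure_eq_measure)
    then have "modular c (V n \<inter> space M \<inter> D n i) \<le> modular c {}"
      by (intro modular_mono_AE, elim AE_mp[OF AE_not_in]) simp
    then show ?thesis by (simp add: modular_def)
  next
    case False
    then have full: "measure M (V n \<inter> D n i) = measure M (D n i)"
      using atom_null_or_full[of "V n \<inter> D n i" n i] V_F D_F by auto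
    then have Diff_0: "measure M (D n i - V n) = 0"
      using finite_measure_Diff'[of "D n i" "V n"] by (simp add: Int_commute)
    have D_V: "AE x in M. x \<in> D n i \<longrightarrow> x \<in> V n"
    proof (rule AE_mp[OF AE_not_in])
      show "D n i - V n \<in> null_sets M"
        using Diff_0 by (simp add: null_sets_def emeasure_eq_measure)
    qed simp
    have "V n \<inter> D n i \<noteq> {}" using False by auto
    then obtain x where x: "x \<in> D n i" "x \<in> V n" by blast
    then have "x \<in> atom_hull n (A n)" using V_U[of n] unfolding U_def by blast
    then obtain j where j: "x \<in> D n j" "0 < measure M (D n j \<inter> A n)"
      unfolding atom_hull_def by blast
    have "j = i" using D_disjoint[of n] x j unfolding disjoint_family_on_def by blast
    with j have pos: "0 < measure M (D n i \<inter> A n)" by simp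
    have "modular c (D n i \<inter> A n) \<le> modular c E" using A by (intro modular_mono_AE) auto
    then have le1: "modular c (D n i \<inter> A n) \<le> 1" using mod by simp
    have "modular c (V n \<inter> space M \<inter> D n i) \<le> modular c (D n i)" by (intro modular_mono_AE) auto
    also have "\<dots> \<le> ennreal comparison_const * modular c (D n i \<inter> A n)"
      by (rule modular_atom_le[OF A(1) pos c le1])
    also have "modular c (D n i \<inter> A n) \<le> modular c (V n \<inter> E \<inter> D n i)"
      by (rule modular_mono_AE, use D_V in eventually_elim) (use A(2)[of n] in auto)
    finally show ?thesis by (simp add: mult_left_mono)
  qed
  have "modular c (\<Union>n. U n) = modular c (\<Union>n. V n \<inter> space M)"
  proof -
    have "(\<Union>n. V n \<inter> space M) = (\<Union>n. V n)" using sets.sets_into_space[OF V_M] by blast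
    then show ?thesis unfolding V_def by (simp add: UN_disjointed_eq)
  qed
  also have "\<dots> \<le> (\<Sum>n. \<Sum>i. ennreal comparison_const * modular c (V n \<inter> E \<inter> D n i))"
    unfolding split[OF sets.top] by (intro suminf_le piece) auto
  also have "\<dots> = ennreal comparison_const * modular c (\<Union>n. V n \<inter> E)"
    by (simp only: split[OF E] ennreal_suminf_cmult)
  also have "\<dots> \<le> ennreal comparison_const * modular c E"
    by (intro mult_left_mono modular_mono_AE) auto
  also have "\<dots> \<le> ennreal comparison_const * 1" by (intro mult_left_mono mod) auto
  finally show ?thesis by (simp add: U_def)
qed

lemma set_var_norm_atom_hulls_le:
  assumes A: "\<And>n. A n \<in> sets (F (Suc n))" "\<And>n. A n \<subseteq> E" and E: "E \<in> sets M"
  shows "set_var_norm M p (\<Union>n. atom_hull n (A n))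
    \<le> ennreal (comparison_const powr (1 / pm)) * set_var_norm M p E"
proof (rule ennreal_le_of_less_imp_le)
  have C: "1 \<le> comparison_const" by (rule comparison_const_ge_1)
  then show "0 < comparison_const powr (1 / pm)" by auto
  fix c :: real assume c: "0 < c" "set_var_norm M p E < ennreal c"
  have meas: "(\<Union>n. atom_hull n (A n)) \<in> sets M"
    using sets_F_imp_M[OF atom_hull_F] by blast
  show "set_var_norm M p (\<Union>n. atom_hull n (A n)) \<le> ennreal (comparison_const powr (1 / pm) * c)"
  proof (cases "c \<le> 1")
    case True
    show ?thesis
      proof (intro set_var_norm_le_of_modular meas C)
      show "modular c (\<Union>n. atom_hull n (A n)) \<le> ennreal comparison_const"
        using c True by (intro modular_atom_hulls_le[OF A E] modular_le_1) auto
    qed fact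
  next
    case False
    have "1 * 1 \<le> comparison_const powr (1 / pm) * c"
      using C False pm_pos by (intro mult_mono ge_one_powr_ge_zero) auto
    then have "1 \<le> ennreal (comparison_const powr (1 / pm) * c)" by simp
    with set_var_norm_le_1 show ?thesis by (rule order_trans)
  qed
qed

end

section \<open>The square and maximal functions as suprema of seminorms\<close>

text \<open>What the argument uses of \<open>T\<close>. The seminorm \<open>\<phi> N\<close> is a function of the first \<open>N + 1\<close> terms of a
  sequence (\<open>stop\<close> with \<open>m = N\<close>). The filter in \<open>tendsto\<close> lives on finite sets of integers because the
  limits taken are unconditional sums over \<open>\<int>\<close>. The last assumption bounds the \<open>L\<^sub>2\<close>-norms of an adapted
  martingale \<open>g\<close> by a bound for \<open>T g\<close>; it holds trivially for the maximal function and by orthogonality for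
  the square function.\<close>

locale hardy_functional = filtered_prob_space M F
  for M :: "'a measure" and F :: "nat \<Rightarrow> 'a measure" +
  fixes T :: "(nat \<Rightarrow> 'a \<Rightarrow> real) \<Rightarrow> 'a \<Rightarrow> ennreal"
    and \<phi> :: "nat \<Rightarrow> (nat \<Rightarrow> real) \<Rightarrow> real" and B :: "nat \<Rightarrow> real"
  assumes T_eq: "T f x = (SUP N. ennreal (\<phi> N (\<lambda>n. f n x)))"
    and nonneg: "0 \<le> \<phi> N s"
    and triangle: "\<phi> N (\<lambda>n. s n + t n) \<le> \<phi> N s + \<phi> N t"
    and scale: "\<phi> N (\<lambda>n. c * s n) = \<bar>c\<bar> * \<phi> N s"
    and stop: "\<phi> N (\<lambda>n. s (min n m)) = \<phi> (min N m) s"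
    and at_0: "\<phi> 0 s = \<bar>s 0\<bar>"
    and B_nonneg: "0 \<le> B n"
    and coordinate: "\<bar>s n\<bar> \<le> B n * \<phi> n s"
    and tendsto: "(\<And>n. ((\<lambda>K. u K n) \<longlongrightarrow> s n) \<F>) \<Longrightarrow> ((\<lambda>K. \<phi> N (u K)) \<longlongrightarrow> \<phi> N s) (\<F> :: int set filter)"
    and measurable: "(\<And>n. n \<le> N \<Longrightarrow> f n \<in> borel_measurable G) \<Longrightarrow>
      (\<lambda>x. \<phi> N (\<lambda>n. f n x)) \<in> borel_measurable (G :: 'a measure)"
    and energy: "adapted_martingale g \<Longrightarrow> (\<And>N. AE x in M. \<phi> N (\<lambda>n. g n x) \<le> c) \<Longrightarrow>
      (\<integral>x. (g n x)\<^sup>2 \<partial>M) \<le> c\<^sup>2"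

text \<open>The martingale differences \<open>s\<^sub>k - s\<^sub>k\<^sub>-\<^sub>1\<close> of a single sequence, with \<open>s\<^sub>-\<^sub>1 = 0\<close>.\<close>

definition seq_diff :: "(nat \<Rightarrow> real) \<Rightarrow> nat \<Rightarrow> real" where
  "seq_diff s k = (case k of 0 \<Rightarrow> s 0 | Suc m \<Rightarrow> s (Suc m) - s m)"

lemma sum_seq_diff: "(\<Sum>k\<le>n. seq_diff s k) = s n"
  by (induction n) (auto simp: seq_diff_def)

lemma sum_seq_diff_stopped:
  "(\<Sum>k\<le>N. (seq_diff (\<lambda>n. s (min n m)) k)\<^sup>2) = (\<Sum>k\<le>min N m. (seq_diff s k)\<^sup>2)"
proof (induction N)
  case (Suc N)
  show ?case
  proof (cases "Suc N \<le> m")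
    case True
    then show ?thesis using Suc by (simp add: seq_diff_def min_absorb1)
  next
    case False
    then show ?thesis using Suc by (simp add: seq_diff_def min_absorb2)
  qed
qed (simp add: seq_diff_def)

lemma square_fun_eq:
  "square_fun f x = (SUP N. ennreal (L2_set (seq_diff (\<lambda>n. f n x)) {..N}))"
proof (rule antisym)
  define d where "d = seq_diff (\<lambda>n. f n x)"
  have d: "mdiff f k x = d k" for k
    by (cases k) (auto simp: d_def seq_diff_def mdiff_def)
  have sq: "square_fun f x = ennreal_powr (\<Sum>k. ennreal ((d k)\<^sup>2)) (1/2)"
    unfolding square_fun_def d by simp
  have part: "ennreal_powr (\<Sum>k\<le>N. ennreal ((d k)\<^sup>2)) (1/2) = ennreal (L2_set d {..N})" for N
    by (simp add: sum_nonneg ennreal_powr_ennreal L2_set_def powr_half_sqrt)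
  show "(SUP N. ennreal (L2_set (seq_diff (\<lambda>n. f n x)) {..N})) \<le> square_fun f x"
  proof (rule SUP_least)
    fix N
    have "ennreal_powr (\<Sum>k\<le>N. ennreal ((d k)\<^sup>2)) (1/2) \<le> square_fun f x"
      unfolding sq by (intro ennreal_powr_mono sum_le_suminf) auto
    then show "ennreal (L2_set (seq_diff (\<lambda>n. f n x)) {..N}) \<le> square_fun f x"
      unfolding part by (simp add: d_def)
  qed
  define Y where "Y = (SUP N. ennreal (L2_set d {..N}))"
  have "(\<Sum>k. ennreal ((d k)\<^sup>2)) \<le> ennreal_powr Y 2"
  proof (rule suminf_le_const)
    fix n
    have "(\<Sum>k<n. ennreal ((d k)\<^sup>2)) \<le> (\<Sum>k\<le>n. ennreal ((d k)\<^sup>2))"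
      by (rule sum_mono2) auto
    also have "\<dots> = ennreal_powr (ennreal (L2_set d {..n})) 2"
      unfolding part[symmetric] by (simp add: ennreal_powr_powr)
    also have "\<dots> \<le> ennreal_powr Y 2"
      unfolding Y_def by (intro ennreal_powr_mono SUP_upper) auto
    finally show "(\<Sum>k<n. ennreal ((d k)\<^sup>2)) \<le> ennreal_powr Y 2" .
  qed simp
  then have "square_fun f x \<le> ennreal_powr (ennreal_powr Y 2) (1/2)"
    unfolding sq by (intro ennreal_powr_mono) auto
  also have "\<dots> = Y" by (simp add: ennreal_powr_powr)
  finally show "square_fun f x \<le> (SUP N. ennreal (L2_set (seq_diff (\<lambda>n. f n x)) {..N}))"
    by (simp add: Y_def d_def)
qed

lemma (in filtered_prob_space) hardy_functional_square_fun:
  "hardy_functional M F square_fun (\<lambda>N s. L2_set (seq_diff s) {..N}) (\<lambda>n. real (Suc n))"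
proof unfold_locales
  fix f :: "nat \<Rightarrow> 'a \<Rightarrow> real" and x
  show "square_fun f x = (SUP N. ennreal (L2_set (seq_diff (\<lambda>n. f n x)) {..N}))"
    by (rule square_fun_eq)
next
  fix N and s t :: "nat \<Rightarrow> real"
  have "seq_diff (\<lambda>n. s n + t n) = (\<lambda>k. seq_diff s k + seq_diff t k)"
    by (auto simp: seq_diff_def fun_eq_iff split: nat.split)
  then show "L2_set (seq_diff (\<lambda>n. s n + t n)) {..N}
      \<le> L2_set (seq_diff s) {..N} + L2_set (seq_diff t) {..N}"
    by (simp add: L2_set_triangle_ineq)
next
  fix N c and s :: "nat \<Rightarrow> real"
  have "seq_diff (\<lambda>n. c * s n) = (\<lambda>k. c * seq_diff s k)"
    by (auto simp: seq_diff_def fun_eq_iff right_diff_distrib split: nat.split)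
  then show "L2_set (seq_diff (\<lambda>n. c * s n)) {..N} = \<bar>c\<bar> * L2_set (seq_diff s) {..N}"
    by (simp add: L2_set_def power_mult_distrib sum_distrib_left[symmetric] real_sqrt_mult)
next
  fix N m and s :: "nat \<Rightarrow> real"
  show "L2_set (seq_diff (\<lambda>n. s (min n m))) {..N} = L2_set (seq_diff s) {..min N m}"
    by (simp only: L2_set_def sum_seq_diff_stopped)
next
  fix n and s :: "nat \<Rightarrow> real"
  have "\<bar>s n\<bar> \<le> (\<Sum>k\<le>n. \<bar>seq_diff s k\<bar>)"
    unfolding sum_seq_diff[of s n, symmetric] by (rule sum_abs)
  also have "\<dots> \<le> (\<Sum>k\<le>n. L2_set (seq_diff s) {..n})"
  proof (rule sum_mono)
    fix k assume "k \<in> {..n}"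
    then have "(seq_diff s k)\<^sup>2 \<le> (\<Sum>k\<le>n. (seq_diff s k)\<^sup>2)" by (intro member_le_sum) auto
    then show "\<bar>seq_diff s k\<bar> \<le> L2_set (seq_diff s) {..n}"
      unfolding L2_set_def by (metis real_sqrt_abs real_sqrt_le_iff)
  qed
  finally show "\<bar>s n\<bar> \<le> real (Suc n) * L2_set (seq_diff s) {..n}" by simp
next
  fix N and s :: "nat \<Rightarrow> real" and u :: "int set \<Rightarrow> nat \<Rightarrow> real" and \<F>
  assume u: "\<And>n. ((\<lambda>K. u K n) \<longlongrightarrow> s n) \<F>"
  have "((\<lambda>K. seq_diff (u K) k) \<longlongrightarrow> seq_diff s k) \<F>" for k
    by (cases k) (auto simp: seq_diff_def intro!: tendsto_intros u)
  then show "((\<lambda>K. L2_set (seq_diff (u K)) {..N}) \<longlongrightarrow> L2_set (seq_diff s) {..N}) \<F>"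
    unfolding L2_set_def by (intro tendsto_intros)
next
  fix N and f :: "nat \<Rightarrow> 'a \<Rightarrow> real" and G
  assume f: "\<And>n. n \<le> N \<Longrightarrow> f n \<in> borel_measurable G"
  have [measurable]: "(\<lambda>x. seq_diff (\<lambda>n. f n x) k) \<in> borel_measurable G" if "k \<le> N" for k
    using that f[of k] f[of "k - 1"] by (cases k) (auto simp: seq_diff_def)
  show "(\<lambda>x. L2_set (seq_diff (\<lambda>n. f n x)) {..N}) \<in> borel_measurable G"
    unfolding L2_set_def
  proof (rule measurable_compose[of _ _ borel sqrt])
    show "(\<lambda>x. \<Sum>k\<le>N. (seq_diff (\<lambda>n. f n x) k)\<^sup>2) \<in> borel_measurable G"
      by (intro borel_measurable_sum borel_measurable_power) auto
  qed measurable
next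
  fix g c n
  assume g: "adapted_martingale g" and le: "\<And>N. AE x in M. L2_set (seq_diff (\<lambda>n. g n x)) {..N} \<le> c"
  have meas: "g k \<in> borel_measurable M" for k using adapted_martingaleD(4)[OF g] .
  have [measurable]: "(\<lambda>x. seq_diff (\<lambda>n. g n x) k) \<in> borel_measurable M" for k
    using meas[of k] meas[of "k - 1"] by (cases k) (auto simp: seq_diff_def)
  have d_le: "AE x in M. (\<Sum>k\<le>N. (seq_diff (\<lambda>n. g n x) k)\<^sup>2) \<le> c\<^sup>2" for N
    using le[of N]
  proof eventually_elim
    case (elim x)
    then have "(L2_set (seq_diff (\<lambda>n. g n x)) {..N})\<^sup>2 \<le> c\<^sup>2" by (intro power_mono) auto
    then show ?case by (simp add: L2_set_def sum_nonneg)
  qed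
  have bd: "AE x in M. \<bar>g n x\<bar> \<le> real (Suc n) * c" for n
    using le[of n]
  proof eventually_elim
    case (elim x)
    have "\<bar>g n x\<bar> \<le> (\<Sum>k\<le>n. \<bar>seq_diff (\<lambda>n. g n x) k\<bar>)"
      unfolding sum_seq_diff[of "\<lambda>n. g n x" n, symmetric] by (rule sum_abs)
    also have "\<dots> \<le> (\<Sum>k\<le>n. c)"
    proof (rule sum_mono)
      fix k assume "k \<in> {..n}"
      then have "(seq_diff (\<lambda>n. g n x) k)\<^sup>2 \<le> (\<Sum>k\<le>n. (seq_diff (\<lambda>n. g n x) k)\<^sup>2)"
        by (intro member_le_sum) auto
      then have "\<bar>seq_diff (\<lambda>n. g n x) k\<bar> \<le> L2_set (seq_diff (\<lambda>n. g n x)) {..n}"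
        unfolding L2_set_def by (metis real_sqrt_abs real_sqrt_le_iff)
      with elim show "\<bar>seq_diff (\<lambda>n. g n x) k\<bar> \<le> c" by simp
    qed
    finally show ?case by simp
  qed
  have d_int: "integrable M (\<lambda>x. (seq_diff (\<lambda>n. g n x) k)\<^sup>2)" for k
  proof (rule integrable_const_bound[where B = "c\<^sup>2"])
    show "AE x in M. norm ((seq_diff (\<lambda>n. g n x) k)\<^sup>2) \<le> c\<^sup>2"
      using d_le[of k]
    proof eventually_elim
      case (elim x)
      have "(seq_diff (\<lambda>n. g n x) k)\<^sup>2 \<le> (\<Sum>j\<le>k. (seq_diff (\<lambda>n. g n x) j)\<^sup>2)"
        by (intro member_le_sum) auto
      with elim show ?case by simp
    qed
  qed measurable
  have "(\<integral>x. (g n x)\<^sup>2 \<partial>M) = (\<Sum>k\<le>n. \<integral>x. (seq_diff (\<lambda>n. g n x) k)\<^sup>2 \<partial>M)" for n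
  proof (induction n)
    case (Suc n)
    then show ?case
      using martingale_increment_L2(1)[OF g bd, of n "Suc n"] by (simp add: seq_diff_def)
  qed (simp add: seq_diff_def)
  then have "(\<integral>x. (g n x)\<^sup>2 \<partial>M) = (\<integral>x. (\<Sum>k\<le>n. (seq_diff (\<lambda>n. g n x) k)\<^sup>2) \<partial>M)"
    using d_int by simp
  also have "\<dots> \<le> (\<integral>x. c\<^sup>2 \<partial>M)"
    by (intro integral_mono_AE d_le Bochner_Integration.integrable_sum d_int) simp
  finally show "(\<integral>x. (g n x)\<^sup>2 \<partial>M) \<le> c\<^sup>2" by (simp add: prob_space)
qed (auto simp: L2_set_def seq_diff_def intro!: sum_nonneg)

text \<open>The maximum of \<open>\<bar>s\<^sub>0\<bar>, \<dots>, \<bar>s\<^sub>n\<bar>\<close>.\<close>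

primrec running_max :: "(nat \<Rightarrow> real) \<Rightarrow> nat \<Rightarrow> real" where
  "running_max s 0 = \<bar>s 0\<bar>"
| "running_max s (Suc n) = max (running_max s n) \<bar>s (Suc n)\<bar>"

lemma le_running_max: "n \<le> N \<Longrightarrow> \<bar>s n\<bar> \<le> running_max s N"
  by (induction N) (auto simp: le_Suc_eq le_max_iff_disj)

lemma running_max_nonneg: "0 \<le> running_max s N"
  using le_running_max[of N N s] by simp

lemma running_max_stopped: "running_max (\<lambda>n. s (min n m)) N = running_max s (min N m)"
proof (induction N)
  case (Suc N)
  show ?case
  proof (cases "Suc N \<le> m")
    case True
    then show ?thesis using Suc by (simp add: min_absorb1)
  next
    case False
    then show ?thesis using Suc le_running_max[of m m s] by (simp add: min_absorb2 max_absorb1)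
  qed
qed simp

lemma maximal_fun_eq: "maximal_fun f x = (SUP N. ennreal (running_max (\<lambda>n. f n x) N))"
proof (rule antisym)
  show "maximal_fun f x \<le> (SUP N. ennreal (running_max (\<lambda>n. f n x) N))"
    unfolding maximal_fun_def
    by (intro SUP_mono) (use le_running_max[of _ _ "\<lambda>n. f n x"] in \<open>auto intro: ennreal_leI\<close>)
  have "ennreal (running_max (\<lambda>n. f n x) N) \<le> maximal_fun f x" for N
  proof (induction N)
    case 0
    show ?case unfolding maximal_fun_def by (auto intro: SUP_upper)
  next
    case (Suc N)
    have "ennreal \<bar>f (Suc N) x\<bar> \<le> maximal_fun f x"
      unfolding maximal_fun_def by (auto intro: SUP_upper)
    with Suc show ?case by (simp add: max_def)
  qed
  then show "(SUP N. ennreal (running_max (\<lambda>n. f n x) N)) \<le> maximal_fun f x"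
    by (rule SUP_least)
qed

lemma (in filtered_prob_space) hardy_functional_maximal_fun:
  "hardy_functional M F maximal_fun (\<lambda>N s. running_max s N) (\<lambda>n. 1)"
proof unfold_locales
  fix f :: "nat \<Rightarrow> 'a \<Rightarrow> real" and x
  show "maximal_fun f x = (SUP N. ennreal (running_max (\<lambda>n. f n x) N))"
    by (rule maximal_fun_eq)
next
  fix N and s t :: "nat \<Rightarrow> real"
  show "running_max (\<lambda>n. s n + t n) N \<le> running_max s N + running_max t N"
    by (induction N) auto
next
  fix N c and s :: "nat \<Rightarrow> real"
  show "running_max (\<lambda>n. c * s n) N = \<bar>c\<bar> * running_max s N"
    by (induction N) (auto simp: abs_mult max_mult_distrib_left)
next
  fix N and s :: "nat \<Rightarrow> real" and u :: "int set \<Rightarrow> nat \<Rightarrow> real" and \<F>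
  assume u: "\<And>n. ((\<lambda>K. u K n) \<longlongrightarrow> s n) \<F>"
  show "((\<lambda>K. running_max (u K) N) \<longlongrightarrow> running_max s N) \<F>"
    by (induction N) (auto intro!: tendsto_max tendsto_rabs u)
next
  fix N and f :: "nat \<Rightarrow> 'a \<Rightarrow> real" and G
  assume f: "\<And>n. n \<le> N \<Longrightarrow> f n \<in> borel_measurable G"
  have "(\<lambda>x. running_max (\<lambda>n. f n x) k) \<in> borel_measurable G" if "k \<le> N" for k
    using that by (induction k) (auto intro!: borel_measurable_max borel_measurable_abs f)
  then show "(\<lambda>x. running_max (\<lambda>n. f n x) N) \<in> borel_measurable G" by simp
next
  fix g c n
  assume g: "adapted_martingale g" and le: "\<And>N. AE x in M. running_max (\<lambda>n. g n x) N \<le> c"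
  have [measurable]: "g k \<in> borel_measurable M" for k using adapted_martingaleD(4)[OF g] .
  have sq: "AE x in M. (g n x)\<^sup>2 \<le> c\<^sup>2"
    using le[of n]
  proof eventually_elim
    case (elim x)
    have "\<bar>g n x\<bar>\<^sup>2 \<le> c\<^sup>2"
      using le_running_max[of n n "\<lambda>n. g n x"] elim by (intro power_mono) auto
    then show ?case by simp
  qed
  have "(\<integral>x. (g n x)\<^sup>2 \<partial>M) \<le> (\<integral>x. c\<^sup>2 \<partial>M)"
    by (intro integral_mono_AE sq integrable_const_bound[where B = "c\<^sup>2"]) (use sq in auto)
  then show "(\<integral>x. (g n x)\<^sup>2 \<partial>M) \<le> c\<^sup>2" by (simp add: prob_space)
qed (auto simp: running_max_nonneg running_max_stopped le_running_max)

section \<open>Lorentz norms and decomposition norms\<close>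

lemma infsum_ennreal_le:
  fixes f :: "int \<Rightarrow> ennreal"
  assumes "\<And>K. finite K \<Longrightarrow> sum f K \<le> S"
  shows "infsum f UNIV \<le> S"
  by (subst nonneg_infsum_complete) (auto intro!: SUP_least assms)

lemma sum_le_infsum_ennreal:
  fixes f :: "int \<Rightarrow> ennreal"
  assumes "finite K"
  shows "sum f K \<le> infsum f UNIV"
  by (subst nonneg_infsum_complete) (auto intro!: SUP_upper assms)

lemma powi_2_eq: "(2::real) powi k = 2 powr real_of_int k"
  by (simp add: powr_real_of_int')

context variable_exponent
begin

lemma level_norm_antimono:
  "s \<le> t \<Longrightarrow> set_var_norm M p {x \<in> space M. ennreal t < g x}
    \<le> set_var_norm M p {x \<in> space M. ennreal s < g x}"
  by (intro set_var_norm_mono_AE AE_I2) (auto intro: le_less_trans ennreal_leI)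

text \<open>Here \<open>\<tau>\<close> and \<open>g\<close> are only linked by the norms of the sets \<open>{\<tau>\<^sub>k < \<infinity>}\<close> and
  \<open>{g > 2\<^sup>k}\<close>; the constant does not depend on them.\<close>

lemma decomposition_norm_le_lorentz_norm:
  assumes "0 < q" "0 < C"
  shows "\<exists>C'>0. \<forall>(\<tau> :: int \<Rightarrow> 'a \<Rightarrow> enat) g.
    (\<forall>k. set_var_norm M p {x \<in> space M. \<tau> k x < \<infinity>}
      \<le> ennreal C * set_var_norm M p {x \<in> space M. ennreal (2 powr real_of_int k) < g x}) \<longrightarrow>
    decomposition_norm M p q \<tau> \<le> ennreal C' * lorentz_norm M p q g"
proof (cases "q = \<infinity>")
  case True
  have "decomposition_norm M p q \<tau> \<le> ennreal C * lorentz_norm M p q g"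
    if "\<And>k. set_var_norm M p {x \<in> space M. \<tau> k x < \<infinity>}
      \<le> ennreal C * set_var_norm M p {x \<in> space M. ennreal (2 powr real_of_int k) < g x}"
    for \<tau> :: "int \<Rightarrow> 'a \<Rightarrow> enat" and g
  proof -
    have "(SUP k. ennreal (2 powi k) * set_var_norm M p {x \<in> space M. \<tau> k x < \<infinity>})
      \<le> ennreal C * (SUP t\<in>{0<..}. ennreal t * set_var_norm M p {x \<in> space M. ennreal t < g x})"
    proof (rule SUP_least)
      fix k :: int
      define t :: real where "t = 2 powr real_of_int k"
      have "0 < t" unfolding t_def by simp
      have "ennreal (2 powi k) * set_var_norm M p {x \<in> space M. \<tau> k x < \<infinity>}
          \<le> ennreal t * (ennreal C * set_var_norm M p {x \<in> space M. ennreal t < g x})"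
        unfolding powi_2_eq t_def by (intro mult_left_mono that) auto
      also have "\<dots> = ennreal C * (ennreal t * set_var_norm M p {x \<in> space M. ennreal t < g x})"
        by (simp add: mult_ac)
      also have "\<dots> \<le> ennreal C * (SUP t\<in>{0<..}. ennreal t * set_var_norm M p {x \<in> space M. ennreal t < g x})"
        using \<open>0 < t\<close> by (intro mult_left_mono SUP_upper) auto
      finally show "ennreal (2 powi k) * set_var_norm M p {x \<in> space M. \<tau> k x < \<infinity>}
          \<le> ennreal C * (SUP t\<in>{0<..}. ennreal t * set_var_norm M p {x \<in> space M. ennreal t < g x})" .
    qed
    then show ?thesis using True by (simp add: decomposition_norm_def lorentz_norm_def)
  qed
  with \<open>0 < C\<close> show ?thesis by blast
next
  case False
  define r where "r = enn2real q"
  have r: "0 < r" unfolding r_def using False \<open>0 < q\<close> by (simp add: enn2real_positive_iff less_top)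
  define C' where "C' = C * 2 powr ((r + 1) / r)"
  have "decomposition_norm M p q \<tau> \<le> ennreal C' * lorentz_norm M p q g"
    if le: "\<And>k. set_var_norm M p {x \<in> space M. \<tau> k x < \<infinity>}
      \<le> ennreal C * set_var_norm M p {x \<in> space M. ennreal (2 powr real_of_int k) < g x}"
    for \<tau> :: "int \<Rightarrow> 'a \<Rightarrow> enat" and g
  proof -
    define G where "G t = ennreal_powr (set_var_norm M p {x \<in> space M. ennreal t < g x}) r" for t
    define I where "I = (\<integral>\<^sup>+t. ennreal (t powr r) * G t / ennreal t * indicator {0<..} t \<partial>lborel)"
    have "(\<Sum>\<^sub>\<infinity>k\<in>UNIV. ennreal (2 powr (real_of_int k * r))
          * ennreal_powr (set_var_norm M p {x \<in> space M. \<tau> k x < \<infinity>}) r)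
        \<le> ennreal (C powr r * 2 powr (r + 1)) * I"
    proof (rule infsum_ennreal_le)
      fix K :: "int set" assume K: "finite K"
      have "(\<Sum>k\<in>K. ennreal (2 powr (real_of_int k * r))
          * ennreal_powr (set_var_norm M p {x \<in> space M. \<tau> k x < \<infinity>}) r)
        \<le> (\<Sum>k\<in>K. ennreal (2 powr (real_of_int k * r))
          * (ennreal (C powr r) * G (2 powr real_of_int k)))"
      proof (intro sum_mono mult_left_mono)
        fix k
        have "ennreal_powr (set_var_norm M p {x \<in> space M. \<tau> k x < \<infinity>}) r
            \<le> ennreal_powr (ennreal C * set_var_norm M p {x \<in> space M. ennreal (2 powr real_of_int k) < g x}) r"
          using r by (intro ennreal_powr_mono le) auto
        then show "ennreal_powr (set_var_norm M p {x \<in> space M. \<tau> k x < \<infinity>}) r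
            \<le> ennreal (C powr r) * G (2 powr real_of_int k)"
          using \<open>0 < C\<close> by (simp add: ennreal_powr_mult G_def)
      qed auto
      also have "\<dots> = ennreal (C powr r)
          * (\<Sum>k\<in>K. ennreal (2 powr (real_of_int k * r)) * G (2 powr real_of_int k))"
        by (simp add: sum_distrib_left mult_ac)
      also have "\<dots> \<le> ennreal (C powr r) * (ennreal (2 powr (r + 1)) * I)"
        unfolding I_def
      proof (intro mult_left_mono dyadic_sum_le_integral r K)
        show "G t \<le> G s" if "s \<le> t" for s t
          unfolding G_def using r that by (intro ennreal_powr_mono level_norm_antimono) auto
      qed auto
      finally show "(\<Sum>k\<in>K. ennreal (2 powr (real_of_int k * r))
          * ennreal_powr (set_var_norm M p {x \<in> space M. \<tau> k x < \<infinity>}) r)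
        \<le> ennreal (C powr r * 2 powr (r + 1)) * I"
        by (simp add: ennreal_mult mult.assoc)
    qed
    then have "decomposition_norm M p q \<tau> \<le> ennreal_powr (ennreal (C powr r * 2 powr (r + 1)) * I) (1 / r)"
      unfolding decomposition_norm_def using False r by (auto simp: r_def intro!: ennreal_powr_mono)
    also have "\<dots> = ennreal ((C powr r * 2 powr (r + 1)) powr (1 / r)) * ennreal_powr I (1 / r)"
      using \<open>0 < C\<close> by (intro ennreal_powr_mult) auto
    also have "(C powr r * 2 powr (r + 1)) powr (1 / r) = C'"
      unfolding C'_def using \<open>0 < C\<close> r by (simp add: powr_mult powr_powr)
    also have "ennreal_powr I (1 / r) = lorentz_norm M p q g"
      unfolding lorentz_norm_def I_def G_def using False by (simp add: r_def)
    finally show ?thesis .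
  qed
  moreover have "0 < C'" unfolding C'_def using \<open>0 < C\<close> by simp
  ultimately show ?thesis by blast
qed

text \<open>A Hardy inequality for sequences. For finite \<open>q = r\<close> the supremum over \<open>j\<close>, raised to the power
  \<open>r\<close>, is estimated by a sum, and exchanging the sums over \<open>k\<close> and \<open>j\<close> leaves the geometric series with
  ratio \<open>\<theta> = 2\<^sup>-\<^sup>r\<^sup>/\<^sup>2\<close>.\<close>

lemma lorentz_norm_le_decomposition_norm:
  assumes "0 < q" "0 < C"
  shows "\<exists>C'>0. \<forall>(\<tau> :: int \<Rightarrow> 'a \<Rightarrow> enat) g.
    (\<forall>k. set_var_norm M p {x \<in> space M. ennreal (3 * 2 powr real_of_int k) < g x}
      \<le> ennreal C * (SUP j::nat. ennreal (2 powr (real j / 2))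
          * set_var_norm M p {x \<in> space M. \<tau> (k + int j) x < \<infinity>})) \<longrightarrow>
    lorentz_norm M p q g \<le> ennreal C' * decomposition_norm M p q \<tau>"
proof (cases "q = \<infinity>")
  case True
  have "lorentz_norm M p q g \<le> ennreal (6 * C) * decomposition_norm M p q \<tau>"
    if le: "\<And>k. set_var_norm M p {x \<in> space M. ennreal (3 * 2 powr real_of_int k) < g x}
      \<le> ennreal C * (SUP j::nat. ennreal (2 powr (real j / 2))
          * set_var_norm M p {x \<in> space M. \<tau> (k + int j) x < \<infinity>})"
    for \<tau> :: "int \<Rightarrow> 'a \<Rightarrow> enat" and g
  proof -
    define S where "S = decomposition_norm M p q \<tau>"
    have S: "ennreal (2 powr real_of_int k) * set_var_norm M p {x \<in> space M. \<tau> k x < \<infinity>} \<le> S" for k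
      unfolding S_def decomposition_norm_def using True by (auto simp: powi_2_eq intro: SUP_upper)
    have "ennreal t * set_var_norm M p {x \<in> space M. ennreal t < g x} \<le> ennreal (6 * C) * S"
      if "0 < t" for t
    proof -
      define k where "k = \<lceil>log 2 (t / 3)\<rceil> - 1"
      define v :: real where "v = 2 powr real_of_int k"
      have "t \<in> dyadic_block 3 (k + 1)"
        using \<open>0 < t\<close> by (simp add: mem_dyadic_block_iff k_def)
      then have t: "3 * v < t" "t \<le> 6 * v"
        by (auto simp: dyadic_block_def v_def powr_add)
      define X where "X = (SUP j::nat. ennreal (2 powr (real j / 2))
          * set_var_norm M p {x \<in> space M. \<tau> (k + int j) x < \<infinity>})"
      have "set_var_norm M p {x \<in> space M. ennreal t < g x} \<le> ennreal C * X"
        unfolding X_def using t by (intro order_trans[OF level_norm_antimono le[of k]]) (simp add: v_def)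
      then have "ennreal t * set_var_norm M p {x \<in> space M. ennreal t < g x}
          \<le> ennreal (6 * v) * (ennreal C * X)"
        using t by (intro mult_mono ennreal_leI) auto
      also have "\<dots> = ennreal (6 * C) * (ennreal v * X)"
        using \<open>0 < C\<close> by (simp add: ennreal_mult v_def mult_ac)
      also have "ennreal v * X = (SUP j::nat. ennreal v * (ennreal (2 powr (real j / 2))
            * set_var_norm M p {x \<in> space M. \<tau> (k + int j) x < \<infinity>}))"
        unfolding X_def by (rule SUP_mult_left_ennreal)
      also have "ennreal (6 * C) * \<dots> \<le> ennreal (6 * C) * S"
      proof (intro mult_left_mono SUP_least)
        fix j :: nat
        have "ennreal v * (ennreal (2 powr (real j / 2)) * set_var_norm M p {x \<in> space M. \<tau> (k + int j) x < \<infinity>})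
            = ennreal (v * 2 powr (real j / 2)) * set_var_norm M p {x \<in> space M. \<tau> (k + int j) x < \<infinity>}"
          by (simp add: ennreal_mult v_def mult.assoc)
        also have "\<dots> \<le> ennreal (2 powr real_of_int (k + int j)) * set_var_norm M p {x \<in> space M. \<tau> (k + int j) x < \<infinity>}"
          unfolding v_def powr_add[symmetric] by (intro mult_right_mono ennreal_leI powr_mono) auto
        also have "\<dots> \<le> S" by (rule S)
        finally show "ennreal v * (ennreal (2 powr (real j / 2))
            * set_var_norm M p {x \<in> space M. \<tau> (k + int j) x < \<infinity>}) \<le> S" .
      qed simp
      finally show ?thesis .
    qed
    then show ?thesis unfolding lorentz_norm_def S_def using True by (auto intro!: SUP_least)
  qed
  moreover have "0 < 6 * C" using \<open>0 < C\<close> by simp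
  ultimately show ?thesis by blast
next
  case False
  define r where "r = enn2real q"
  have r: "0 < r" unfolding r_def using False \<open>0 < q\<close> by (simp add: enn2real_positive_iff less_top)
  define \<theta> where "\<theta> = (2::real) powr (- (r / 2))"
  have \<theta>: "0 < \<theta>" "\<theta> < 1" unfolding \<theta>_def using r by (auto simp: powr_less_one)
  define W where "W = 1 / (1 - \<theta>)"
  have W: "0 < W" unfolding W_def using \<theta> by simp
  define C' where "C' = (6 powr r * (C powr r * W)) powr (1 / r)"
  have "lorentz_norm M p q g \<le> ennreal C' * decomposition_norm M p q \<tau>"
    if le: "\<And>k. set_var_norm M p {x \<in> space M. ennreal (3 * 2 powr real_of_int k) < g x}
      \<le> ennreal C * (SUP j::nat. ennreal (2 powr (real j / 2))
          * set_var_norm M p {x \<in> space M. \<tau> (k + int j) x < \<infinity>})"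
    for \<tau> :: "int \<Rightarrow> 'a \<Rightarrow> enat" and g
  proof -
    define G where "G t = ennreal_powr (set_var_norm M p {x \<in> space M. ennreal t < g x}) r" for t
    define b where "b k = ennreal_powr (set_var_norm M p {x \<in> space M. \<tau> k x < \<infinity>}) r" for k
    define S where "S = (\<Sum>\<^sub>\<infinity>k\<in>UNIV. ennreal (2 powr (real_of_int k * r)) * b k)"
    have G_le: "G (3 * 2 powr real_of_int k)
        \<le> ennreal (C powr r) * (\<Sum>j. ennreal (2 powr (real j * r / 2)) * b (k + int j))" for k
    proof -
      define Z where "Z = (\<Sum>j. ennreal (2 powr (real j * r / 2)) * b (k + int j))"
      have "(SUP j::nat. ennreal (2 powr (real j / 2))
          * set_var_norm M p {x \<in> space M. \<tau> (k + int j) x < \<infinity>}) \<le> ennreal_powr Z (1 / r)"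
      proof (rule SUP_least)
        fix j :: nat
        define y where "y = ennreal (2 powr (real j / 2)) * set_var_norm M p {x \<in> space M. \<tau> (k + int j) x < \<infinity>}"
        have "ennreal_powr y r = ennreal (2 powr (real j * r / 2)) * b (k + int j)"
          unfolding y_def b_def by (subst ennreal_powr_mult) (auto simp: powr_powr mult_ac)
        also have "\<dots> = (\<Sum>i\<in>{j}. ennreal (2 powr (real i * r / 2)) * b (k + int i))" by simp
        also have "\<dots> \<le> Z" unfolding Z_def by (rule sum_le_suminf) auto
        finally have "ennreal_powr (ennreal_powr y r) (1 / r) \<le> ennreal_powr Z (1 / r)"
          using r by (intro ennreal_powr_mono) auto
        then show "ennreal (2 powr (real j / 2)) * set_var_norm M p {x \<in> space M. \<tau> (k + int j) x < \<infinity>}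
            \<le> ennreal_powr Z (1 / r)"
          using r by (simp add: ennreal_powr_inverse y_def)
      qed
      then have "set_var_norm M p {x \<in> space M. ennreal (3 * 2 powr real_of_int k) < g x}
          \<le> ennreal C * ennreal_powr Z (1 / r)"
        by (rule order_trans[OF le mult_left_mono]) simp
      then have "G (3 * 2 powr real_of_int k) \<le> ennreal_powr (ennreal C * ennreal_powr Z (1 / r)) r"
        unfolding G_def using r by (intro ennreal_powr_mono) auto
      also have "\<dots> = ennreal (C powr r) * Z"
        using r \<open>0 < C\<close> by (simp add: ennreal_powr_mult ennreal_powr_inverse)
      finally show ?thesis unfolding Z_def .
    qed
    have sum_le: "(\<Sum>k\<in>K. ennreal (2 powr (real_of_int k * r)) * G (3 * 2 powr real_of_int k))
        \<le> ennreal (C powr r * W) * S" if K: "finite K" for K :: "int set"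
    proof -
      have "(\<Sum>k\<in>K. ennreal (2 powr (real_of_int k * r)) * G (3 * 2 powr real_of_int k))
          \<le> (\<Sum>k\<in>K. ennreal (2 powr (real_of_int k * r)) *
              (ennreal (C powr r) * (\<Sum>j. ennreal (2 powr (real j * r / 2)) * b (k + int j))))"
        by (intro sum_mono mult_left_mono G_le) auto
      also have "\<dots> = ennreal (C powr r) * (\<Sum>k\<in>K. \<Sum>j. ennreal (2 powr (real_of_int k * r))
            * (ennreal (2 powr (real j * r / 2)) * b (k + int j)))"
        by (simp only: sum_distrib_left ennreal_suminf_cmult mult.left_commute[of _ "ennreal (C powr r)"])
      also have "(\<Sum>k\<in>K. \<Sum>j. ennreal (2 powr (real_of_int k * r))
            * (ennreal (2 powr (real j * r / 2)) * b (k + int j)))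
          = (\<Sum>j. \<Sum>k\<in>K. ennreal (2 powr (real_of_int k * r))
            * (ennreal (2 powr (real j * r / 2)) * b (k + int j)))"
        by (intro suminf_sum[symmetric]) auto
      also have "\<dots> \<le> (\<Sum>j. ennreal (\<theta> ^ j) * S)"
      proof (intro suminf_le)
        fix j :: nat
        have "(\<Sum>k\<in>K. ennreal (2 powr (real_of_int k * r))
              * (ennreal (2 powr (real j * r / 2)) * b (k + int j)))
            = (\<Sum>k\<in>K. ennreal (\<theta> ^ j) * (ennreal (2 powr (real_of_int (k + int j) * r)) * b (k + int j)))"
        proof (intro sum.cong refl)
          fix k
          have "2 powr (real_of_int k * r) * 2 powr (real j * r / 2)
              = \<theta> ^ j * 2 powr (real_of_int (k + int j) * r)"
            unfolding \<theta>_def by (simp add: powr_realpow[symmetric] powr_powr powr_add[symmetric] algebra_simps)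
          then have "ennreal (2 powr (real_of_int k * r)) * ennreal (2 powr (real j * r / 2))
              = ennreal (\<theta> ^ j) * ennreal (2 powr (real_of_int (k + int j) * r))"
            using \<theta> by (simp add: ennreal_mult[symmetric])
          then show "ennreal (2 powr (real_of_int k * r)) * (ennreal (2 powr (real j * r / 2)) * b (k + int j))
              = ennreal (\<theta> ^ j) * (ennreal (2 powr (real_of_int (k + int j) * r)) * b (k + int j))"
            by (simp only: mult.assoc[symmetric])
        qed
        also have "\<dots> = ennreal (\<theta> ^ j) *
            (\<Sum>k\<in>(\<lambda>k. k + int j) ` K. ennreal (2 powr (real_of_int k * r)) * b k)"
          by (subst sum.reindex) (auto simp: sum_distrib_left inj_on_def)
        also have "\<dots> \<le> ennreal (\<theta> ^ j) * S"
          unfolding S_def using K by (intro mult_left_mono sum_le_infsum_ennreal) auto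
        finally show "(\<Sum>k\<in>K. ennreal (2 powr (real_of_int k * r))
              * (ennreal (2 powr (real j * r / 2)) * b (k + int j))) \<le> ennreal (\<theta> ^ j) * S" .
      qed auto
      also have "\<dots> = ennreal W * S"
      proof -
        have "(\<Sum>j. ennreal (\<theta> ^ j)) = ennreal W"
          unfolding W_def using \<theta> by (intro suminf_ennreal_eq) (auto intro: geometric_sums)
        then show ?thesis by simp
      qed
      finally show ?thesis using \<open>0 < C\<close> W by (simp add: ennreal_mult mult.assoc mult_left_mono)
    qed
    have "(\<integral>\<^sup>+t. ennreal (t powr r) * G t / ennreal t * indicator {0<..} t \<partial>lborel)
        \<le> ennreal ((2 * 3) powr r) * (ennreal (C powr r * W) * S)"
    proof (intro integral_le_dyadic_sum r sum_le)
      show "G t \<le> G s" if "s \<le> t" for s t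
        unfolding G_def using r that by (intro ennreal_powr_mono level_norm_antimono) auto
    qed auto
    also have "\<dots> = ennreal (6 powr r * (C powr r * W)) * S"
      using W by (simp add: ennreal_mult mult.assoc)
    finally have "lorentz_norm M p q g \<le> ennreal_powr (ennreal (6 powr r * (C powr r * W)) * S) (1 / r)"
      unfolding lorentz_norm_def G_def using False r by (auto simp: r_def intro!: ennreal_powr_mono)
    also have "\<dots> = ennreal C' * ennreal_powr S (1 / r)"
      unfolding C'_def using \<open>0 < C\<close> W by (intro ennreal_powr_mult) auto
    also have "ennreal_powr S (1 / r) = decomposition_norm M p q \<tau>"
      unfolding decomposition_norm_def S_def b_def using False by (simp add: r_def)
    finally show ?thesis .
  qed
  moreover have "0 < C'" unfolding C'_def using \<open>0 < C\<close> W by simp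
  ultimately show ?thesis by blast
qed

end

section \<open>Martingales with an atomic decomposition\<close>

context hardy_functional
begin

lemma phi_zero [simp]: "\<phi> N (\<lambda>n. 0) = 0"
  using scale[of N 0 "\<lambda>n. 0"] by simp

lemma phi_diff: "\<phi> N (\<lambda>n. s n - t n) \<le> \<phi> N s + \<phi> N t"
  using triangle[of N s "\<lambda>n. (- 1) * t n"] scale[of N "- 1" t] by simp

lemma phi_sum: "\<phi> N (\<lambda>n. \<Sum>k\<in>K. u k n) \<le> (\<Sum>k\<in>K. \<phi> N (u k))"
proof (induction K rule: infinite_finite_induct)
  case (insert k K)
  then show ?case using triangle[of N "u k" "\<lambda>n. \<Sum>k\<in>K. u k n"] by simp
qed auto

lemma phi_stopped: "\<phi> N (\<lambda>n. s (stop_index n t)) = \<phi> (stop_index N t) s"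
  by (cases t) (auto simp: stop)

lemma T_le_iff: "0 \<le> c \<Longrightarrow> T f x \<le> ennreal c \<longleftrightarrow> (\<forall>N. \<phi> N (\<lambda>n. f n x) \<le> c)"
  unfolding T_eq by (auto simp: SUP_le_iff ennreal_le_iff)

lemma phi_le_T: "ennreal (\<phi> N (\<lambda>n. f n x)) \<le> T f x"
  unfolding T_eq by (rule SUP_upper) simp

lemma T_measurable: "(\<And>n. f n \<in> borel_measurable M) \<Longrightarrow> T f \<in> borel_measurable M"
proof -
  assume f: "\<And>n. f n \<in> borel_measurable M"
  have "(\<lambda>x. SUP N. ennreal (\<phi> N (\<lambda>n. f n x))) \<in> borel_measurable M"
    by (intro borel_measurable_SUP measurable_compose[OF measurable[OF f] measurable_ennreal]) auto
  then show ?thesis unfolding T_eq[abs_def] .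
qed

lemma T_cong_AE:
  assumes "\<And>n. AE x in M. f n x = g n x"
  shows "AE x in M. T f x = T g x"
proof -
  have "AE x in M. \<forall>n. f n x = g n x" using assms by (simp add: AE_all_countable)
  then show ?thesis by eventually_elim (simp add: T_eq)
qed

end

lemma sum_powers_below_le:
  assumes "finite Q"
  shows "(\<Sum>k\<in>Q. if k < K then 2 powr real_of_int k else 0) \<le> (2::real) powr real_of_int K"
proof -
  have geo: "(\<Sum>k\<in>{K - int n..<K}. (2::real) powr real_of_int k)
      = 2 powr real_of_int K - 2 powr real_of_int (K - int n)" for n
  proof (induction n)
    case (Suc n)
    have "{K - int (Suc n)..<K} = insert (K - int (Suc n)) {K - int n..<K}" by auto
    moreover have "(2::real) powr real_of_int (K - int n) = 2 * 2 powr real_of_int (K - int (Suc n))"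
      by (simp add: powr_diff powr_add)
    ultimately show ?case using Suc by simp
  qed simp
  obtain n where n: "\<And>k. k \<in> Q \<Longrightarrow> K - int n \<le> k"
  proof -
    have "bdd_below Q" using assms by simp
    then obtain m where "\<And>k. k \<in> Q \<Longrightarrow> m \<le> k" by (auto simp: bdd_below_def)
    then have "\<And>k. k \<in> Q \<Longrightarrow> K - int (nat (K - m)) \<le> k" by fastforce
    then show thesis by (rule that)
  qed
  have "(\<Sum>k\<in>Q. if k < K then 2 powr real_of_int k else 0)
      = (\<Sum>k\<in>Q \<inter> {k. k < K}. (2::real) powr real_of_int k)"
    using assms by (simp add: sum.inter_restrict)
  also have "\<dots> \<le> (\<Sum>k\<in>{K - int n..<K}. 2 powr real_of_int k)"
    using n by (intro sum_mono2) auto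
  also have "\<dots> \<le> 2 powr real_of_int K" unfolding geo by simp
  finally show ?thesis .
qed

text \<open>An exponent and a Hardy functional on the same space; the estimate of \<open>T f\<close> by an atomic
  decomposition of \<open>f\<close> needs neither atoms of the filtration nor regularity.\<close>

locale variable_hardy = variable_exponent M p pm + hardy_functional M F T \<phi> B
  for M :: "'a measure" and p pm F T \<phi> B
begin

lemma atomic_decomposition_null_start:
  assumes "atomic_decomposition T M F p f a \<tau>"
  shows "AE x in M. f 0 x = 0"
proof -
  have "AE x in M. real_cond_exp M (F 0) (a k) x = 0" for k
  proof -
    have "AE x in M. enat 0 \<le> \<tau> k x \<longrightarrow> real_cond_exp M (F 0) (a k) x = 0"
      using assms unfolding atomic_decomposition_def hardy_atom_def by blast
    then show ?thesis by eventually_elim (simp add: zero_enat_def[symmetric])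
  qed
  then have "AE x in M. \<forall>k. real_cond_exp M (F 0) (a k) x = 0" by (simp add: AE_all_countable)
  moreover have "AE x in M. ((\<lambda>k. 3 * 2 powi k * enn2real (set_var_norm M p {x \<in> space M. \<tau> k x < \<infinity>})
               * real_cond_exp M (F 0) (a k) x) has_sum f 0 x) UNIV"
    using assms unfolding atomic_decomposition_def by blast
  ultimately show ?thesis
  proof eventually_elim
    case (elim x)
    then have "((\<lambda>k::int. 0) has_sum f 0 x) UNIV" by simp
    then show ?case by (metis has_sum_0 has_sum_unique)
  qed
qed

text \<open>Off the union all \<open>a\<^sup>k\<close> with \<open>k \<ge> K\<close> contribute nothing, because all their conditional
  expectations vanish where \<open>\<tau>\<^sub>k = \<infinity>\<close>. The others contribute at most \<open>\<Sum>\<^sub>k\<^sub><\<^sub>K 3 \<cdot> 2\<^sup>k = 3 \<cdot> 2\<^sup>K\<close>.\<close>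

lemma AE_level_subset_tail:
  assumes dec: "atomic_decomposition T M F p f a \<tau>"
  shows "AE x in M. ennreal (3 * 2 powr real_of_int K) < T f x \<longrightarrow>
    x \<in> (\<Union>j::nat. {x \<in> space M. \<tau> (K + int j) x < \<infinity>})"
proof -
  define \<nu> where "\<nu> k = set_var_norm M p {x \<in> space M. \<tau> k x < \<infinity>}" for k
  define E where "E k n = real_cond_exp M (F n) (a k)" for k n
  define \<mu> where "\<mu> k = 3 * 2 powr real_of_int k * enn2real (\<nu> k)" for k
  have "AE x in M. \<forall>n. ((\<lambda>k. \<mu> k * E k n x) has_sum f n x) UNIV"
    using dec unfolding atomic_decomposition_def \<mu>_def E_def \<nu>_def powi_2_eq
    by (simp add: AE_all_countable)
  moreover have "AE x in M. \<forall>k n. enat n \<le> \<tau> k x \<longrightarrow> E k n x = 0"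
    using dec unfolding atomic_decomposition_def hardy_atom_def E_def
    by (simp add: AE_all_countable)
  moreover have "AE x in M. \<forall>k. T (E k) x \<le> 1 / \<nu> k"
    unfolding AE_all_countable
  proof
    fix k
    have "esssup M (T (E k)) \<le> 1 / \<nu> k"
      using dec unfolding atomic_decomposition_def hardy_atom_def E_def \<nu>_def by blast
    with esssup_AE[of "T (E k)" M] show "AE x in M. T (E k) x \<le> 1 / \<nu> k"
      by (auto elim!: eventually_mono)
  qed
  ultimately show ?thesis using AE_space
  proof eventually_elim
    case (elim x)
    show ?case
    proof (rule impI, rule ccontr)
      assume big: "ennreal (3 * 2 powr real_of_int K) < T f x"
        and "x \<notin> (\<Union>j::nat. {x \<in> space M. \<tau> (K + int j) x < \<infinity>})"
      then have inf: "\<tau> (K + int j) x = \<infinity>" for j using elim(4) by auto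
      have term_le: "\<mu> k * \<phi> N (\<lambda>n. E k n x) \<le> 3 * (if k < K then 2 powr real_of_int k else 0)" for k N
      proof (cases "k < K")
        case False
        then have "\<tau> k x = \<infinity>" using inf[of "nat (k - K)"] by simp
        then have "E k n x = 0" for n using elim(2) by simp
        then show ?thesis using False by simp
      next
        case True
        \<comment> \<open>If the norm vanishes, nothing is known about \<open>T (E k)\<close>, but then \<open>\<mu> k = 0\<close>.\<close>
        show ?thesis
        proof (cases "enn2real (\<nu> k) = 0")
          case False
          define v where "v = enn2real (\<nu> k)"
          have v: "0 < v" "\<nu> k = ennreal v"
            using False unfolding v_def \<nu>_def by (auto simp: less_le)
          have "ennreal (\<phi> N (\<lambda>n. E k n x)) \<le> 1 / \<nu> k"
            using phi_le_T[of N "E k" x] elim(3) by (meson order_trans)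
          also have "1 / \<nu> k = ennreal (1 / v)" using v by (simp add: divide_ennreal[symmetric])
          finally have "\<phi> N (\<lambda>n. E k n x) \<le> 1 / v" using v by (simp add: ennreal_le_iff)
          then have "\<mu> k * \<phi> N (\<lambda>n. E k n x) \<le> 3 * 2 powr real_of_int k * v * (1 / v)"
            unfolding \<mu>_def v_def[symmetric] using v by (intro mult_left_mono) auto
          then show ?thesis using v True by simp
        qed (simp add: \<mu>_def True)
      qed
      have "\<phi> N (\<lambda>n. f n x) \<le> 3 * 2 powr real_of_int K" for N
      proof (rule tendsto_upperbound)
        show "((\<lambda>Q. \<phi> N (\<lambda>n. \<Sum>k\<in>Q. \<mu> k * E k n x)) \<longlongrightarrow> \<phi> N (\<lambda>n. f n x)) (finite_subsets_at_top UNIV)"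
          using elim(1) unfolding has_sum_def by (intro tendsto) auto
        show "\<forall>\<^sub>F Q in finite_subsets_at_top UNIV.
            \<phi> N (\<lambda>n. \<Sum>k\<in>Q. \<mu> k * E k n x) \<le> 3 * 2 powr real_of_int K"
        proof (rule eventually_finite_subsets_at_top_weakI)
          fix Q :: "int set" assume "finite Q"
          have "\<phi> N (\<lambda>n. \<Sum>k\<in>Q. \<mu> k * E k n x) \<le> (\<Sum>k\<in>Q. \<phi> N (\<lambda>n. \<mu> k * E k n x))"
            by (rule phi_sum)
          also have "\<dots> = (\<Sum>k\<in>Q. \<mu> k * \<phi> N (\<lambda>n. E k n x))"
            by (simp add: scale \<mu>_def)
          also have "\<dots> \<le> (\<Sum>k\<in>Q. 3 * (if k < K then 2 powr real_of_int k else 0))"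
            by (intro sum_mono term_le)
          also have "\<dots> \<le> 3 * 2 powr real_of_int K"
            using sum_powers_below_le[OF \<open>finite Q\<close>, of K] by (simp only: sum_distrib_left[symmetric])
          finally show "\<phi> N (\<lambda>n. \<Sum>k\<in>Q. \<mu> k * E k n x) \<le> 3 * 2 powr real_of_int K" .
        qed
      qed simp
      then have "T f x \<le> ennreal (3 * 2 powr real_of_int K)" by (subst T_le_iff) auto
      with big show False by simp
    qed
  qed
qed

lemma hardy_norm_le_decomposition_norm:
  assumes "0 < q"
  shows "\<exists>C>0. \<forall>f a \<tau>. atomic_decomposition T M F p f a \<tau> \<longrightarrow>
    hardy_norm T M p q f \<le> ennreal C * decomposition_norm M p q \<tau>"
proof -
  obtain C0 :: real where C0: "0 < C0" "\<And>B :: nat \<Rightarrow> 'a set. (\<And>j. B j \<in> sets M) \<Longrightarrow>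
       set_var_norm M p (\<Union>j. B j)
         \<le> ennreal C0 * (SUP j. ennreal (2 powr (real j / 2)) * set_var_norm M p (B j))"
    using set_var_norm_UN by blast
  obtain C where C: "0 < C" "\<And>(\<tau> :: int \<Rightarrow> 'a \<Rightarrow> enat) g.
    (\<And>k. set_var_norm M p {x \<in> space M. ennreal (3 * 2 powr real_of_int k) < g x}
      \<le> ennreal C0 * (SUP j::nat. ennreal (2 powr (real j / 2))
          * set_var_norm M p {x \<in> space M. \<tau> (k + int j) x < \<infinity>})) \<Longrightarrow>
    lorentz_norm M p q g \<le> ennreal C * decomposition_norm M p q \<tau>"
    using lorentz_norm_le_decomposition_norm[OF \<open>0 < q\<close> C0(1)] by blast
  have "hardy_norm T M p q f \<le> ennreal C * decomposition_norm M p q \<tau>"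
    if dec: "atomic_decomposition T M F p f a \<tau>" for f a \<tau>
    unfolding hardy_norm_def
  proof (rule C(2))
    fix k
    have meas: "{x \<in> space M. \<tau> k x < \<infinity>} \<in> sets M" for k
    proof -
      have "{x \<in> space M. \<tau> k x < \<infinity>} = (\<Union>n. {x \<in> space M. \<tau> k x \<le> enat n})"
      proof (intro set_eqI iffI)
        fix x assume "x \<in> {x \<in> space M. \<tau> k x < \<infinity>}"
        then show "x \<in> (\<Union>n. {x \<in> space M. \<tau> k x \<le> enat n})" by (cases "\<tau> k x") auto
      next
        fix x assume "x \<in> (\<Union>n. {x \<in> space M. \<tau> k x \<le> enat n})"
        then show "x \<in> {x \<in> space M. \<tau> k x < \<infinity>}" by (cases "\<tau> k x") auto
      qed
      also have "\<dots> \<in> sets M"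
        using dec sets_F_imp_M
        unfolding atomic_decomposition_def hardy_atom_def ext_stopping_time_def by blast
      finally show ?thesis .
    qed
    have "set_var_norm M p {x \<in> space M. ennreal (3 * 2 powr real_of_int k) < T f x}
        \<le> set_var_norm M p (\<Union>j::nat. {x \<in> space M. \<tau> (k + int j) x < \<infinity>})"
      by (rule set_var_norm_mono_AE, use AE_level_subset_tail[OF dec, of k] in eventually_elim) simp
    also have "\<dots> \<le> ennreal C0 * (SUP j::nat. ennreal (2 powr (real j / 2))
          * set_var_norm M p {x \<in> space M. \<tau> (k + int j) x < \<infinity>})"
      by (rule C0(2)) (rule meas)
    finally show "set_var_norm M p {x \<in> space M. ennreal (3 * 2 powr real_of_int k) < T f x}
        \<le> ennreal C0 * (SUP j::nat. ennreal (2 powr (real j / 2))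
          * set_var_norm M p {x \<in> space M. \<tau> (k + int j) x < \<infinity>})" .
  qed
  with C(1) show ?thesis by blast
qed

end

section \<open>Atomic decomposition of a martingale\<close>

text \<open>The terms with \<open>k \<ge> k0\<close> vanish, and the remaining ones are summed from \<open>k0 - 1\<close> downwards. The
  bound makes the sum absolutely convergent, as unconditional summation requires.\<close>

lemma telescoping_has_sum:
  fixes v :: "int \<Rightarrow> real"
  assumes top: "\<And>k. k0 \<le> k \<Longrightarrow> v k = L" and bot: "\<And>k. \<bar>v k\<bar> \<le> C * 2 powr real_of_int k"
  shows "((\<lambda>k. v (k + 1) - v k) has_sum L) UNIV"
proof -
  define w where "w j = v (k0 - int j)" for j
  have w_bd: "\<bar>w j\<bar> \<le> C * 2 powr real_of_int k0 * (1 / 2) ^ j" for j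
    using bot[of "k0 - int j"] by (simp add: w_def powr_diff powr_realpow power_one_over)
  have lim_bd: "(\<lambda>j. C * 2 powr real_of_int k0 * (1 / 2) ^ j) \<longlonglongrightarrow> 0"
    using tendsto_mult_left[OF LIMSEQ_power_zero[of "1/2 :: real"], of "C * 2 powr real_of_int k0"] by simp
  have "w \<longlonglongrightarrow> 0"
    by (rule Lim_null_comparison[OF _ lim_bd]) (use w_bd in auto)
  then have "(\<lambda>j. w j - w (Suc j)) sums (w 0 - 0)" by (rule telescope_sums')
  moreover have "w 0 = L" using top[of k0] by (simp add: w_def)
  ultimately have sums: "(\<lambda>j. w j - w (Suc j)) sums L" by simp
  have "summable (\<lambda>j. norm (w j - w (Suc j)))"
  proof (rule summable_comparison_test'[where N = 0])
    show "summable (\<lambda>j. 2 * (C * 2 powr real_of_int k0) * (1 / 2 :: real) ^ j)"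
      by (intro summable_mult summable_geometric) simp
    fix j
    have "0 \<le> C * 2 powr real_of_int k0 * (1 / 2) ^ j" using w_bd[of j] by linarith
    then have "C * 2 powr real_of_int k0 * (1 / 2) ^ Suc j \<le> C * 2 powr real_of_int k0 * (1 / 2) ^ j"
      by simp
    then show "norm (norm (w j - w (Suc j))) \<le> 2 * (C * 2 powr real_of_int k0) * (1 / 2) ^ j"
      using w_bd[of j] w_bd[of "Suc j"] by simp
  qed
  then have "((\<lambda>j. w j - w (Suc j)) has_sum L) UNIV"
    using sums by (rule norm_summable_imp_has_sum)
  then have "(((\<lambda>k. v (k + 1) - v k) \<circ> (\<lambda>j. k0 - 1 - int j)) has_sum L) UNIV"
    by (simp add: w_def o_def algebra_simps)
  then have "((\<lambda>k. v (k + 1) - v k) has_sum L) (range (\<lambda>j. k0 - 1 - int j))"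
    by (subst has_sum_reindex) (auto simp: inj_on_def)
  moreover have "range (\<lambda>j. k0 - 1 - int j) = {..<k0}"
  proof (intro set_eqI iffI)
    fix k assume "k \<in> {..<k0}"
    then have "k = k0 - 1 - int (nat (k0 - 1 - k))" by simp
    then show "k \<in> range (\<lambda>j. k0 - 1 - int j)" by blast
  qed auto
  ultimately have "((\<lambda>k. v (k + 1) - v k) has_sum L) {..<k0}" by simp
  then show ?thesis
    by (subst has_sum_cong_neutral[where T = "{..<k0}" and g = "\<lambda>k. v (k + 1) - v k"]) (auto simp: top)
qed

text \<open>The full setting: a Hardy functional over a regular atomic filtration and an exponent as above.\<close>

locale hardy_atomic = regular_atomic M p pm F D R K pp + hardy_functional M F T \<phi> B
  for M :: "'a measure" and p pm F D R K pp T \<phi> B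
begin

sublocale variable_hardy ..

text \<open>The index is shifted: the \<open>n\<close>-th level set belongs to \<open>F (Suc n)\<close>, and its hull to \<open>F n\<close>. Hence
  the level time below stops one step before \<open>\<phi>\<close> can exceed \<open>t\<close>.\<close>

definition level_set :: "(nat \<Rightarrow> 'a \<Rightarrow> real) \<Rightarrow> real \<Rightarrow> nat \<Rightarrow> 'a set" where
  "level_set g t n = {x \<in> space M. t < \<phi> (Suc n) (\<lambda>i. g i x)}"

text \<open>The first \<open>n\<close> such that the atom of \<open>F n\<close> at \<open>x\<close> meets, in positive measure, the set where
  \<open>\<phi>\<close> exceeds \<open>t\<close> at time \<open>n + 1\<close>.\<close>

definition level_time :: "(nat \<Rightarrow> 'a \<Rightarrow> real) \<Rightarrow> real \<Rightarrow> 'a \<Rightarrow> enat" where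
  "level_time g t = hitting_time (\<lambda>n. atom_hull n (level_set g t n))"

lemma level_set_F:
  assumes "\<And>n. g n \<in> borel_measurable (F n)"
  shows "level_set g t n \<in> sets (F (Suc n))"
proof -
  have [measurable]: "(\<lambda>x. \<phi> (Suc n) (\<lambda>i. g i x)) \<in> borel_measurable (F (Suc n))"
    using assms by (intro measurable) (auto intro: measurable_F_mono)
  have "{x \<in> space (F (Suc n)). t < \<phi> (Suc n) (\<lambda>i. g i x)} \<in> sets (F (Suc n))" by measurable
  then show ?thesis by (simp add: level_set_def)
qed

lemma level_set_antimono: "t \<le> t' \<Longrightarrow> level_set g t' n \<subseteq> level_set g t n"
  unfolding level_set_def by auto

lemma ext_stopping_time_level_time: "ext_stopping_time M F (level_time g t)"
  unfolding ext_stopping_time_def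
proof
  fix n
  have "{x \<in> space M. level_time g t x \<le> enat n} = (\<Union>m\<le>n. atom_hull m (level_set g t m))"
    unfolding level_time_def hitting_time_le_iff
    using sets.sets_into_space[OF sets_F_imp_M[OF atom_hull_F]] by blast
  also have "\<dots> \<in> sets (F n)"
    by (intro sets.finite_UN) (auto intro: sets_F_mono[OF _ atom_hull_F])
  finally show "{x \<in> space M. level_time g t x \<le> enat n} \<in> sets (F n)" .
qed

lemma level_time_less_infinity:
  "{x \<in> space M. level_time g t x < \<infinity>} = (\<Union>n. atom_hull n (level_set g t n))"
  unfolding level_time_def hitting_time_less_infinity_iff
  using sets.sets_into_space[OF sets_F_imp_M[OF atom_hull_F]] by blast

context
  fixes g assumes g: "adapted_martingale g"
begin

lemma level_set_M: "level_set g t n \<in> sets M"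
  by (rule sets_F_imp_M[OF level_set_F[OF adapted_martingaleD(3)[OF g]]])

lemma level_time_mono: "t \<le> t' \<Longrightarrow> level_time g t x \<le> level_time g t' x"
  unfolding level_time_def
  by (intro hitting_time_antimono atom_hull_mono level_set_antimono level_set_M)

lemma AE_le_before_level_time:
  assumes start: "AE x in M. g 0 x = 0" and "0 \<le> t"
  shows "AE x in M. \<forall>N. enat N \<le> level_time g t x \<longrightarrow> \<phi> N (\<lambda>n. g n x) \<le> t"
proof -
  have "AE x in M. \<forall>n. x \<in> level_set g t n \<longrightarrow> x \<in> atom_hull n (level_set g t n)"
    unfolding AE_all_countable by (intro allI AE_in_atom_hull level_set_M)
  with start AE_space show ?thesis
  proof eventually_elim
    case (elim x)
    show ?case
    proof (intro allI impI)
      fix N assume N: "enat N \<le> level_time g t x"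
      show "\<phi> N (\<lambda>n. g n x) \<le> t"
      proof (cases N)
        case 0
        then show ?thesis using elim \<open>0 \<le> t\<close> by (simp add: at_0)
      next
        case (Suc n)
        then have "x \<notin> atom_hull n (level_set g t n)"
          using N unfolding level_time_def hitting_time_ge_iff by auto
        then have "x \<notin> level_set g t n" using elim by blast
        then show ?thesis using elim Suc by (simp add: level_set_def)
      qed
    qed
  qed
qed

lemma level_time_unbounded:
  assumes "x \<in> space M"
  shows "\<exists>k0::int. \<forall>k\<ge>k0. enat n \<le> level_time g (2 powr real_of_int k) x"
proof -
  have "\<exists>k::nat. x \<notin> atom_hull m (level_set g (2 ^ k) m)" for m
  proof (rule not_in_atom_hull_eventually[OF _ _ _ assms])
    show "level_set g (2 ^ k) m \<in> sets (F (Suc m))" for k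
      by (rule level_set_F[OF adapted_martingaleD(3)[OF g]])
    show "decseq (\<lambda>k. level_set g (2 ^ k) m)"
      unfolding decseq_def by (intro allI impI level_set_antimono) (simp add: power_increasing)
    have "\<exists>k. y \<notin> level_set g (2 ^ k) m" for y
      using real_arch_pow[of 2 "\<phi> (Suc m) (\<lambda>i. g i y)"] unfolding level_set_def
      by (auto intro: less_imp_le simp: not_less)
    then show "(\<Inter>k. level_set g (2 ^ k) m) = {}" by blast
  qed
  then obtain c where c: "x \<notin> atom_hull m (level_set g (2 ^ c m) m)" for m by metis
  show ?thesis
  proof (intro exI allI impI)
    fix k assume k: "int (\<Sum>m<n. c m) \<le> k"
    show "enat n \<le> level_time g (2 powr real_of_int k) x"
      unfolding level_time_def hitting_time_ge_iff
    proof (intro allI impI notI)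
      fix m assume "m < n" and x: "x \<in> atom_hull m (level_set g (2 powr real_of_int k) m)"
      have "c m \<le> (\<Sum>m<n. c m)" using \<open>m < n\<close> by (intro member_le_sum) auto
      then have "(2::real) powr real (c m) \<le> 2 powr real_of_int k"
        using k by (intro powr_mono) linarith+
      then have "level_set g (2 powr real_of_int k) m \<subseteq> level_set g (2 ^ c m) m"
        by (intro level_set_antimono) (simp add: powr_realpow)
      then show False using x c[of m] atom_hull_mono level_set_M by blast
    qed
  qed
qed

lemma AE_stopped_at_level_time:
  assumes "AE x in M. g 0 x = 0" and "0 \<le> t"
  shows "AE x in M. \<forall>N. \<phi> N (\<lambda>n. stopped (level_time g t) g n x) \<le> t"
  using AE_le_before_level_time[OF assms]
proof eventually_elim
  case (elim x)
  then show ?case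
    unfolding stopped_def using phi_stopped[of _ "\<lambda>n. g n x"] stop_index_le(2) by simp
qed

lemma norm_level_time_le:
  "set_var_norm M p {x \<in> space M. level_time g t x < \<infinity>}
    \<le> ennreal (comparison_const powr (1 / pm)) * set_var_norm M p {x \<in> space M. ennreal t < T g x}"
  if "0 \<le> t"
  unfolding level_time_less_infinity
proof (rule set_var_norm_atom_hulls_le)
  show "level_set g t n \<in> sets (F (Suc n))" for n
    by (rule level_set_F[OF adapted_martingaleD(3)[OF g]])
  show "level_set g t n \<subseteq> {x \<in> space M. ennreal t < T g x}" for n
  proof
    fix x assume "x \<in> level_set g t n"
    then have "x \<in> space M" "ennreal t < ennreal (\<phi> (Suc n) (\<lambda>i. g i x))"
      using that by (auto simp: level_set_def ennreal_less_iff)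
    then show "x \<in> {x \<in> space M. ennreal t < T g x}"
      using phi_le_T[of "Suc n" g x] by (auto intro: less_le_trans)
  qed
  have [measurable]: "T g \<in> borel_measurable M" by (intro T_measurable adapted_martingaleD(4)[OF g])
  show "{x \<in> space M. ennreal t < T g x} \<in> sets M" by measurable
qed

text \<open>The part of \<open>g\<close> between the level times for \<open>2\<^sup>k\<close> and \<open>2\<^sup>k\<^sup>+\<^sup>1\<close>, that is \<open>\<mu>\<^sub>k\<close> times the
  \<open>k\<close>-th atom.\<close>

definition layer :: "int \<Rightarrow> nat \<Rightarrow> 'a \<Rightarrow> real" where
  "layer k n x = stopped (level_time g (2 powr real_of_int (k + 1))) g n x
    - stopped (level_time g (2 powr real_of_int k)) g n x"

lemma layer_eq_0:
  assumes "enat n \<le> level_time g (2 powr real_of_int k) x"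
  shows "layer k n x = 0"
proof -
  have "level_time g (2 powr real_of_int k) x \<le> level_time g (2 powr real_of_int (k + 1)) x"
    by (intro level_time_mono powr_mono) auto
  with assms show ?thesis by (simp add: layer_def stopped_def stop_index_eq)
qed

lemma AE_layer_le:
  assumes "AE x in M. g 0 x = 0"
  shows "AE x in M. \<forall>N. \<phi> N (\<lambda>n. layer k n x) \<le> 3 * 2 powr real_of_int k"
proof -
  have "AE x in M. \<forall>N. \<phi> N (\<lambda>n. stopped (level_time g (2 powr real_of_int j)) g n x) \<le> 2 powr real_of_int j" for j
    by (rule AE_stopped_at_level_time[OF assms]) simp
  from this[of k] this[of "k + 1"] show ?thesis
  proof eventually_elim
    case (elim x)
    show ?case
    proof
      fix N
      have "\<phi> N (\<lambda>n. layer k n x) \<le> 2 powr real_of_int (k + 1) + 2 powr real_of_int k"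
        unfolding layer_def using elim by (intro order_trans[OF phi_diff] add_mono) auto
      then show "\<phi> N (\<lambda>n. layer k n x) \<le> 3 * 2 powr real_of_int k" by (simp add: powr_add)
    qed
  qed
qed

lemma layer_closed:
  assumes start: "AE x in M. g 0 x = 0"
  obtains b where "integrable M b" "\<And>n. AE x in M. real_cond_exp M (F n) b x = layer k n x"
proof -
  have mart: "adapted_martingale (layer k)"
    unfolding layer_def[abs_def]
    by (intro adapted_martingale_diff adapted_martingale_stopped g ext_stopping_time_level_time)
  have le: "AE x in M. \<phi> N (\<lambda>n. layer k n x) \<le> 3 * 2 powr real_of_int k" for N
    using AE_layer_le[OF start, of k] by eventually_elim blast
  have "AE x in M. \<bar>layer k n x\<bar> \<le> B n * (3 * 2 powr real_of_int k)" for n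
    using le[of n]
  proof eventually_elim
    case (elim x)
    show ?case
      using coordinate[of "\<lambda>n. layer k n x" n] mult_left_mono[OF elim B_nonneg[of n]] by simp
  qed
  from L2_bounded_martingale_closed[OF mart this energy[OF mart le]] that show thesis by blast
qed

lemma layers_has_sum:
  assumes start: "AE x in M. g 0 x = 0"
  shows "AE x in M. ((\<lambda>k. layer k n x) has_sum g n x) UNIV"
proof -
  have "AE x in M. \<forall>k::int. \<forall>N. \<phi> N (\<lambda>n. stopped (level_time g (2 powr real_of_int k)) g n x) \<le> 2 powr real_of_int k"
    by (subst AE_all_countable) (intro allI AE_stopped_at_level_time[OF start], simp)
  with AE_space show ?thesis
  proof eventually_elim
    case (elim x)
    obtain k0 where k0: "\<And>k. k0 \<le> k \<Longrightarrow> enat n \<le> level_time g (2 powr real_of_int k) x"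
      using level_time_unbounded[OF elim(1)] by blast
    show ?case
      unfolding layer_def
    proof (rule telescoping_has_sum)
      show "stopped (level_time g (2 powr real_of_int k)) g n x = g n x" if "k0 \<le> k" for k
        using k0[OF that] by (simp add: stopped_def stop_index_eq)
      show "\<bar>stopped (level_time g (2 powr real_of_int k)) g n x\<bar> \<le> B n * 2 powr real_of_int k" for k
        using coordinate[of "\<lambda>n. stopped (level_time g (2 powr real_of_int k)) g n x" n]
          mult_left_mono[OF elim(2)[rule_format, of n k] B_nonneg[of n]] by linarith
    qed
  qed
qed

lemma adapted_atomic_decomposition:
  assumes start: "AE x in M. g 0 x = 0"
  shows "\<exists>a. atomic_decomposition T M F p g a (\<lambda>k. level_time g (2 powr real_of_int k))"
proof -
  define \<tau> where "\<tau> k = level_time g (2 powr real_of_int k)" for k :: int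
  define \<nu> where "\<nu> k = set_var_norm M p {x \<in> space M. \<tau> k x < \<infinity>}" for k
  define \<mu> where "\<mu> k = 3 * 2 powi k * enn2real (\<nu> k)" for k
  have \<tau>_meas: "{x \<in> space M. \<tau> k x < \<infinity>} \<in> sets M" for k
    unfolding \<tau>_def level_time_less_infinity using sets_F_imp_M[OF atom_hull_F] by blast
  have "\<exists>b. \<forall>k. integrable M (b k) \<and> (\<forall>n. AE x in M. real_cond_exp M (F n) (b k) x = layer k n x)"
    by (rule choice) (metis layer_closed[OF start])
  then obtain b where b: "\<And>k. integrable M (b k)"
    "\<And>k n. AE x in M. real_cond_exp M (F n) (b k) x = layer k n x" by blast
  \<comment> \<open>If \<open>\<mu> k = 0\<close>, the quotient is \<open>0\<close>, a valid atom; the layer then vanishes as well, because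
    \<open>{\<tau> k < \<infinity>}\<close> is a null set.\<close>
  define a where "a k x = b k x / \<mu> k" for k x
  have a_int: "integrable M (a k)" for k unfolding a_def using b(1) by simp
  have Ea: "AE x in M. real_cond_exp M (F n) (a k) x = layer k n x / \<mu> k" for n k
    using sigma_finite_subalgebra.real_cond_exp_cdiv[OF sigma_finite_subalgebra_F b(1), of n k "\<mu> k"] b(2)[of n k]
    unfolding a_def by eventually_elim simp
  have atom: "hardy_atom T M F p (a k) (\<tau> k)" for k
    unfolding hardy_atom_def
  proof (intro conjI allI a_int)
    show "ext_stopping_time M F (\<tau> k)" unfolding \<tau>_def by (rule ext_stopping_time_level_time)
    show "AE x in M. enat n \<le> \<tau> k x \<longrightarrow> real_cond_exp M (F n) (a k) x = 0" for n
      using Ea[of n k] by eventually_elim (simp add: layer_eq_0 \<tau>_def)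
    have "AE x in M. T (\<lambda>n. real_cond_exp M (F n) (a k)) x \<le> 1 / \<nu> k"
    proof (cases "\<nu> k = 0")
      case False
      define v where "v = enn2real (\<nu> k)"
      have v: "0 < v" "\<nu> k = ennreal v"
        using False unfolding v_def \<nu>_def by (auto simp: less_le enn2real_eq_0_iff)
      have \<mu>: "\<mu> k = 3 * 2 powr real_of_int k * v" by (simp add: \<mu>_def v_def powi_2_eq)
      have "AE x in M. T (\<lambda>n. real_cond_exp M (F n) (a k)) x = T (\<lambda>n x. layer k n x / \<mu> k) x"
        by (rule T_cong_AE[OF Ea])
      with AE_layer_le[OF start, of k] show ?thesis
      proof eventually_elim
        case (elim x)
        have "\<phi> N (\<lambda>n. layer k n x / \<mu> k) \<le> 1 / v" for N
        proof -
          have "\<phi> N (\<lambda>n. layer k n x / \<mu> k) = \<phi> N (\<lambda>n. layer k n x) / \<mu> k"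
            using scale[of N "1 / \<mu> k" "\<lambda>n. layer k n x"] v by (simp add: \<mu>)
          also have "\<dots> \<le> (3 * 2 powr real_of_int k) / \<mu> k"
            using elim v by (intro divide_right_mono) (auto simp: \<mu>)
          also have "\<dots> = 1 / v" using v by (simp add: \<mu>)
          finally show ?thesis .
        qed
        then have "T (\<lambda>n x. layer k n x / \<mu> k) x \<le> ennreal (1 / v)"
          using v by (subst T_le_iff) auto
        also have "ennreal (1 / v) = 1 / \<nu> k" using v by (simp add: divide_ennreal[symmetric])
        finally show ?case using elim by simp
      qed
    qed simp
    then show "esssup M (T (\<lambda>n. real_cond_exp M (F n) (a k))) \<le> 1 / set_var_norm M p {x \<in> space M. \<tau> k x < \<infinity>}"
      unfolding \<nu>_def by (intro esssup_I T_measurable) auto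
  qed
  have sum: "AE x in M. ((\<lambda>k. \<mu> k * real_cond_exp M (F n) (a k) x) has_sum g n x) UNIV" for n
  proof -
    have "AE x in M. \<mu> k * real_cond_exp M (F n) (a k) x = layer k n x" for k
    proof (cases "\<mu> k = 0")
      case True
      then have "\<nu> k = 0" unfolding \<mu>_def \<nu>_def by (auto simp: enn2real_eq_0_iff)
      then have "measure M {x \<in> space M. \<tau> k x < \<infinity>} = 0"
        unfolding \<nu>_def by (intro set_var_norm_eq_0_imp_null \<tau>_meas)
      then have "{x \<in> space M. \<tau> k x < \<infinity>} \<in> null_sets M"
        using \<tau>_meas by (simp add: null_sets_def emeasure_eq_measure)
      from AE_not_in[OF this] AE_space show ?thesis
      proof eventually_elim
        case (elim x)
        then have "enat n \<le> level_time g (2 powr real_of_int k) x" by (simp add: \<tau>_def)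
        then show ?case using True by (simp add: layer_eq_0)
      qed
    next
      case False
      then show ?thesis using Ea[of n k] by (auto elim!: eventually_mono)
    qed
    then have "AE x in M. \<forall>k. \<mu> k * real_cond_exp M (F n) (a k) x = layer k n x"
      by (simp add: AE_all_countable)
    with layers_has_sum[OF start, of n] show ?thesis by eventually_elim simp
  qed
  have "atomic_decomposition T M F p g a \<tau>"
    unfolding atomic_decomposition_def using atom sum unfolding \<mu>_def \<nu>_def by blast
  then show ?thesis unfolding \<tau>_def by blast
qed

end

lemma atomic_decomposition_exists:
  assumes f: "martingale M F f" and start: "AE x in M. f 0 x = 0"
  obtains a \<tau> where "atomic_decomposition T M F p f a \<tau>"
    "\<And>k. set_var_norm M p {x \<in> space M. \<tau> k x < \<infinity>} \<le> ennreal (comparison_const powr (1 / pm))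
      * set_var_norm M p {x \<in> space M. ennreal (2 powr real_of_int k) < T f x}"
proof -
  obtain g where g: "adapted_martingale g" and gf: "\<And>n. AE x in M. g n x = f n x"
    using martingale_adapted_version[OF f] by blast
  have g_start: "AE x in M. g 0 x = 0" using gf[of 0] start by eventually_elim simp
  define \<tau> where "\<tau> k = level_time g (2 powr real_of_int k)" for k :: int
  obtain a where a: "atomic_decomposition T M F p g a \<tau>"
    using adapted_atomic_decomposition[OF g g_start] unfolding \<tau>_def by blast
  have "AE x in M. ((\<lambda>k. 3 * 2 powi k * enn2real (set_var_norm M p {x \<in> space M. \<tau> k x < \<infinity>})
               * real_cond_exp M (F n) (a k) x) has_sum f n x) UNIV" for n
  proof -
    have "AE x in M. ((\<lambda>k. 3 * 2 powi k * enn2real (set_var_norm M p {x \<in> space M. \<tau> k x < \<infinity>})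
               * real_cond_exp M (F n) (a k) x) has_sum g n x) UNIV"
      using a unfolding atomic_decomposition_def by blast
    with gf[of n] show ?thesis by eventually_elim simp
  qed
  then have "atomic_decomposition T M F p f a \<tau>" using a unfolding atomic_decomposition_def by blast
  moreover have "set_var_norm M p {x \<in> space M. \<tau> k x < \<infinity>} \<le> ennreal (comparison_const powr (1 / pm))
      * set_var_norm M p {x \<in> space M. ennreal (2 powr real_of_int k) < T f x}" for k
  proof -
    have "set_var_norm M p {x \<in> space M. \<tau> k x < \<infinity>} \<le> ennreal (comparison_const powr (1 / pm))
      * set_var_norm M p {x \<in> space M. ennreal (2 powr real_of_int k) < T g x}"
      unfolding \<tau>_def by (rule norm_level_time_le[OF g]) simp
    also have "set_var_norm M p {x \<in> space M. ennreal (2 powr real_of_int k) < T g x}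
        \<le> set_var_norm M p {x \<in> space M. ennreal (2 powr real_of_int k) < T f x}"
      by (rule set_var_norm_mono_AE, use T_cong_AE[of g f, OF gf] in eventually_elim) simp
    finally show ?thesis by (simp add: mult_left_mono)
  qed
  ultimately show thesis by (rule that)
qed

text \<open>The decomposition constructed above needs only \<open>f\<^sub>0 = 0\<close>, not finiteness of the Hardy norm; the
  norm estimates then give equality of the spaces and equivalence of the norms at once.\<close>

theorem hardy_space_eq_atomic:
  assumes "0 < q"
  shows "hardy_space T M F p q \<inter> null_start M = atomic_hardy_space T M F p q"
    and "equivalent_norms_on (atomic_hardy_space T M F p q) (hardy_norm T M p q) (atomic_norm T M F p q)"
proof -
  obtain C1 :: real where C1: "0 < C1" "\<And>f a \<tau>. atomic_decomposition T M F p f a \<tau> \<Longrightarrow>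
    hardy_norm T M p q f \<le> ennreal C1 * decomposition_norm M p q \<tau>"
    using hardy_norm_le_decomposition_norm[OF assms] by blast
  have pos: "0 < comparison_const powr (1 / pm)" using comparison_const_ge_1 by simp
  obtain C2 where C2: "0 < C2" "\<And>(\<tau> :: int \<Rightarrow> 'a \<Rightarrow> enat) g.
    (\<And>k. set_var_norm M p {x \<in> space M. \<tau> k x < \<infinity>} \<le> ennreal (comparison_const powr (1 / pm))
        * set_var_norm M p {x \<in> space M. ennreal (2 powr real_of_int k) < g x}) \<Longrightarrow>
    decomposition_norm M p q \<tau> \<le> ennreal C2 * lorentz_norm M p q g"
    using decomposition_norm_le_lorentz_norm[OF assms pos] by blast
  have lower: "ennreal (1 / C1) * hardy_norm T M p q f \<le> atomic_norm T M F p q f" for f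
    unfolding atomic_norm_def
  proof (rule Inf_greatest, safe)
    fix a \<tau> assume "atomic_decomposition T M F p f a \<tau>"
    then have "ennreal (1 / C1) * hardy_norm T M p q f
        \<le> ennreal (1 / C1) * (ennreal C1 * decomposition_norm M p q \<tau>)"
      by (intro mult_left_mono C1(2)) auto
    also have "\<dots> = ennreal (1 / C1 * C1) * decomposition_norm M p q \<tau>"
      using C1(1) by (subst ennreal_mult) (auto simp: mult.assoc)
    also have "\<dots> = decomposition_norm M p q \<tau>" using C1(1) by simp
    finally show "ennreal (1 / C1) * hardy_norm T M p q f \<le> decomposition_norm M p q \<tau>" .
  qed
  have upper: "atomic_norm T M F p q f \<le> ennreal C2 * hardy_norm T M p q f"
    if f: "martingale M F f" "AE x in M. f 0 x = 0" for f
  proof -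
    obtain a \<tau> where dec: "atomic_decomposition T M F p f a \<tau>"
      and le: "\<And>k. set_var_norm M p {x \<in> space M. \<tau> k x < \<infinity>} \<le> ennreal (comparison_const powr (1 / pm))
        * set_var_norm M p {x \<in> space M. ennreal (2 powr real_of_int k) < T f x}"
      using atomic_decomposition_exists[OF f] by blast
    have "atomic_norm T M F p q f \<le> decomposition_norm M p q \<tau>"
      unfolding atomic_norm_def using dec by (intro Inf_lower) blast
    also have "\<dots> \<le> ennreal C2 * hardy_norm T M p q f"
      unfolding hardy_norm_def by (rule C2(2)[OF le])
    finally show ?thesis .
  qed
  have start: "AE x in M. f 0 x = 0" if "f \<in> atomic_hardy_space T M F p q" for f
  proof -
    have "atomic_norm T M F p q f < \<infinity>" using that by (simp add: atomic_hardy_space_def)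
    then obtain a \<tau> where "atomic_decomposition T M F p f a \<tau>"
      unfolding atomic_norm_def Inf_less_iff by blast
    then show ?thesis by (rule atomic_decomposition_null_start)
  qed
  show "hardy_space T M F p q \<inter> null_start M = atomic_hardy_space T M F p q"
  proof (intro set_eqI iffI)
    fix f assume "f \<in> hardy_space T M F p q \<inter> null_start M"
    then have f: "martingale M F f" "AE x in M. f 0 x = 0" "hardy_norm T M p q f < \<infinity>"
      by (auto simp: hardy_space_def null_start_def)
    have "ennreal C2 * hardy_norm T M p q f < \<infinity>"
      using f(3) by (simp add: ennreal_mult_less_top)
    then have "atomic_norm T M F p q f < \<infinity>" using upper[OF f(1,2)] by (rule le_less_trans[rotated])
    with f show "f \<in> atomic_hardy_space T M F p q" by (simp add: atomic_hardy_space_def)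
  next
    fix f assume f: "f \<in> atomic_hardy_space T M F p q"
    then have "ennreal (1 / C1) * hardy_norm T M p q f < \<infinity>"
      using lower[of f] by (auto simp: atomic_hardy_space_def intro: le_less_trans)
    then have "hardy_norm T M p q f < \<infinity>"
      using C1(1) by (auto simp: ennreal_mult_less_top)
    with f start[OF f] show "f \<in> hardy_space T M F p q \<inter> null_start M"
      by (auto simp: atomic_hardy_space_def hardy_space_def null_start_def)
  qed
  show "equivalent_norms_on (atomic_hardy_space T M F p q) (hardy_norm T M p q) (atomic_norm T M F p q)"
    unfolding equivalent_norms_on_def
    using C1(1) C2(1) lower upper start
    by (intro exI[of _ "1 / C1"] exI[of _ C2]) (auto simp: atomic_hardy_space_def)
qed

end

section \<open>Equality of Hardy spaces and atomic Hardy spaces\<close>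

lemma AE_exponent_bounds:
  assumes "A \<in> sets M"
  shows "AE x in M. x \<in> A \<longrightarrow> exponent_inf M p A \<le> ereal (p x) \<and> ereal (p x) \<le> exponent_sup M p A"
proof -
  have A: "A \<inter> space M \<in> sets M" using assms by auto
  have "AE x in M. x \<in> A \<longrightarrow> - ereal (p x) \<le> esssup (restrict_space M A) (\<lambda>x. - ereal (p x))"
    using esssup_AE[of "\<lambda>x. - ereal (p x)" "restrict_space M A"] AE_restrict_space_iff[OF A] by simp
  moreover have "AE x in M. x \<in> A \<longrightarrow> ereal (p x) \<le> esssup (restrict_space M A) (\<lambda>x. ereal (p x))"
    using esssup_AE[of "\<lambda>x. ereal (p x)" "restrict_space M A"] AE_restrict_space_iff[OF A] by simp
  ultimately show ?thesis
    unfolding exponent_inf_def exponent_sup_def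
  proof eventually_elim
    case (elim x)
    then show ?case by (metis ereal_uminus_le_reorder)
  qed
qed

lemma exponent_bounds_mono:
  assumes A: "A \<in> sets M" and [measurable]: "p \<in> borel_measurable M"
    and bd: "AE x in M. c \<le> p x \<and> p x \<le> d"
  shows "ereal c \<le> exponent_inf M p A" "exponent_sup M p A \<le> ereal d"
proof -
  have A': "A \<inter> space M \<in> sets M" using A by auto
  have meas: "(\<lambda>x. ereal (p x)) \<in> borel_measurable (restrict_space M A)"
    "(\<lambda>x. - ereal (p x)) \<in> borel_measurable (restrict_space M A)"
    by (rule measurable_restrict_space1, measurable)+
  have bd': "AE x in restrict_space M A. c \<le> p x \<and> p x \<le> d"
    unfolding AE_restrict_space_iff[OF A'] using bd by eventually_elim simp
  have "esssup (restrict_space M A) (\<lambda>x. - ereal (p x)) \<le> - ereal c"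
    by (rule esssup_I[OF meas(2)], use bd' in eventually_elim) simp
  then show "ereal c \<le> exponent_inf M p A"
    unfolding exponent_inf_def by (metis ereal_uminus_le_reorder ereal_uminus_uminus)
  show "exponent_sup M p A \<le> ereal d"
    unfolding exponent_sup_def by (rule esssup_I[OF meas(1)], use bd' in eventually_elim) simp
qed

lemma regular_atomic_exists:
  assumes "prob_space M" and fil: "atomic_filtration M F" and p: "p \<in> borel_measurable M"
    and "0 < exponent_inf M p (space M)" and "exponent_sup M p (space M) < \<infinity>"
    and exp: "exponent_condition M F p" and reg: "regular_filtration M F"
  obtains pm D R K pp where "regular_atomic M p pm F D R K pp"
proof -
  interpret prob_space M by fact
  obtain pm where pm: "0 < pm" "ereal pm < exponent_inf M p (space M)"
    using ereal_dense2[OF assms(4)] by auto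
  obtain z where z: "exponent_sup M p (space M) < ereal z"
    using ereal_dense2[OF assms(5)] by auto
  have bd: "AE x in M. pm \<le> p x \<and> p x \<le> z"
    using AE_exponent_bounds[OF sets.top, of M p] AE_space
  proof eventually_elim
    case (elim x)
    then have "ereal pm \<le> ereal (p x)" "ereal (p x) \<le> ereal z"
      using pm(2) z by (meson order_trans less_imp_le)+
    then show ?case by simp
  qed
  have filt: "filtration (space M) F" and sub: "\<And>n. subalgebra M (F n)"
    using fil unfolding atomic_filtration_def by auto
  have "\<exists>D :: nat \<Rightarrow> 'a set. disjoint_family D \<and> (\<Union>i. D i) = space M \<and> (\<forall>i. sigma_atom M (F n) (D i))" for n
  proof -
    obtain \<C> where "countable \<C>" "\<forall>B\<in>\<C>. sigma_atom M (F n) B" "generated_by M (F n) \<C>"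
      using fil unfolding atomic_filtration_def by blast
    from atomic_partition[OF sub this finite_measure_axioms] show ?thesis by metis
  qed
  then obtain D :: "nat \<Rightarrow> nat \<Rightarrow> 'a set" where D: "\<And>n. disjoint_family (D n)" "\<And>n. (\<Union>i. D n i) = space M"
    "\<And>n i. sigma_atom M (F n) (D n i)" by metis
  obtain R where R: "0 < R" "\<And>n A. 1 \<le> n \<Longrightarrow> A \<in> sets (F n) \<Longrightarrow> \<exists>B\<in>sets (F (n - 1)). A \<subseteq> B \<and> measure M B \<le> R * measure M A"
    using reg unfolding regular_filtration_def by blast
  obtain K where K: "1 \<le> K" "\<And>n A. sigma_atom M (F n) A \<Longrightarrow>
      measure M A powr (real_of_ereal (exponent_inf M p A) - real_of_ereal (exponent_sup M p A)) \<le> K"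
    using exp unfolding exponent_condition_def by blast
  have "regular_atomic M p pm F D (max 1 R) K (max 0 z)"
  proof (intro regular_atomic.intro variable_exponent.intro variable_exponent_axioms.intro
      filtered_prob_space.intro filtered_prob_space_axioms.intro regular_atomic_axioms.intro
      prob_space_axioms)
    show "p \<in> borel_measurable M" "0 < pm" "filtration (space M) F" "1 \<le> K"
      using p pm filt K by auto
    show "disjoint_family (D n)" "(\<Union>i. D n i) = space M" "subalgebra M (F n)" for n
      using sub D by auto
    show "sigma_atom M (F n) (D n i)" for n i by (rule D)
    show "AE x in M. pm \<le> p x" using bd by eventually_elim simp
    show "\<exists>B\<in>sets (F n). A \<subseteq> B \<and> measure M B \<le> max 1 R * measure M A" if A: "A \<in> sets (F (Suc n))" for n A
    proof -
      obtain B where "B \<in> sets (F n)" "A \<subseteq> B" "measure M B \<le> R * measure M A"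
        using R(2)[OF _ A] by auto
      moreover have "R * measure M A \<le> max 1 R * measure M A" by (intro mult_right_mono) auto
      ultimately show ?thesis by (intro bexI[of _ B]) auto
    qed
    fix n i assume pos: "0 < measure M (D n i)"
    define a b where "a = exponent_inf M p (D n i)" and "b = exponent_sup M p (D n i)"
    have D_M: "D n i \<in> sets M"
      using D(3)[of n i] sub[of n] by (auto simp: sigma_atom_def subalgebra_def)
    have AE_ab: "AE x in M. x \<in> D n i \<longrightarrow> a \<le> ereal (p x) \<and> ereal (p x) \<le> b"
      unfolding a_def b_def by (rule AE_exponent_bounds[OF D_M])
    have ab: "ereal pm \<le> a" "b \<le> ereal z"
      unfolding a_def b_def by (rule exponent_bounds_mono[OF D_M p bd])+
    have "\<exists>x. a \<le> ereal (p x) \<and> ereal (p x) \<le> b"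
    proof (rule ccontr)
      assume "\<not> ?thesis"
      with AE_ab have "AE x in M. x \<notin> D n i" by (auto elim!: eventually_mono)
      then have "measure M (D n i) = 0" using AE_iff_null_sets[OF D_M] by (simp add: measure_eq_emeasure_eq_ennreal null_setsD1)
      with pos show False by simp
    qed
    then obtain x where x: "a \<le> ereal (p x)" "ereal (p x) \<le> b" by blast
    obtain a' b' where ab': "a = ereal a'" "b = ereal b'"
      using ab x by (cases a; cases b) auto
    have "a' \<le> b'" "b' - a' \<le> max 0 z" using ab x pm(1) unfolding ab' by auto
    moreover have "measure M (D n i) powr (a' - b') \<le> K"
      using K(2)[OF D(3)[of n i]] ab' unfolding a_def b_def by simp
    moreover have "AE x in M. x \<in> D n i \<longrightarrow> a' \<le> p x \<and> p x \<le> b'"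
      using AE_ab unfolding ab' by simp
    ultimately show "\<exists>a b. a \<le> b \<and> b - a \<le> max 0 z \<and> measure M (D n i) powr (a - b) \<le> K
        \<and> (AE x in M. x \<in> D n i \<longrightarrow> a \<le> p x \<and> p x \<le> b)" by blast
  qed auto
  then show thesis by (rule that)
qed

theorem theorem3p13:
  fixes M :: "'a measure" and F :: "nat \<Rightarrow> 'a measure"
    and p :: "'a \<Rightarrow> real" and q :: ennreal
  assumes "prob_space M" and "complete_measure M"
    and "atomic_filtration M F"
    and "p \<in> borel_measurable M" and "\<And>x. x \<in> space M \<Longrightarrow> 0 < p x"
    and "0 < exponent_inf M p (space M)" and "exponent_sup M p (space M) < \<infinity>"
    and "exponent_condition M F p"
    and "0 < q"
    and "regular_filtration M F"
  shows "hardy_space square_fun M F p q \<inter> null_start M = atomic_hardy_space square_fun M F p q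
    \<and> equivalent_norms_on (atomic_hardy_space square_fun M F p q)
        (hardy_norm square_fun M p q) (atomic_norm square_fun M F p q)
    \<and> hardy_space maximal_fun M F p q \<inter> null_start M = atomic_hardy_space maximal_fun M F p q
    \<and> equivalent_norms_on (atomic_hardy_space maximal_fun M F p q)
        (hardy_norm maximal_fun M p q) (atomic_norm maximal_fun M F p q)"
proof -
  obtain pm D R K pp where "regular_atomic M p pm F D R K pp"
    using regular_atomic_exists[of M F p] assms by blast
  then interpret regular_atomic M p pm F D R K pp .
  interpret S: hardy_atomic M p pm F D R K pp square_fun
    "\<lambda>N s. L2_set (seq_diff s) {..N}" "\<lambda>n. real (Suc n)"
    by (intro hardy_atomic.intro regular_atomic_axioms hardy_functional_square_fun)
  interpret Max: hardy_atomic M p pm F D R K pp maximal_fun "\<lambda>N s. running_max s N" "\<lambda>n. 1"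
    by (intro hardy_atomic.intro regular_atomic_axioms hardy_functional_maximal_fun)
  show ?thesis
    using S.hardy_space_eq_atomic[OF \<open>0 < q\<close>] Max.hardy_space_eq_atomic[OF \<open>0 < q\<close>] by blast
qed

end
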